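(* Let $\mathbb{F}$ be a field of characteristic different from $2$. Let $b$ be a non-degenerate symmetric bilinear form on a finite-dimensional vector space $V$ over $\mathbb{F}$ and let $u$ be a $b$-skew-selfadjoint automorphism of $V$. The following conditions are equivalent: (a) there exist $b$-skew-selfadjoint endomorphisms $a_1,a_2$ of $V$ with $a_1^2=a_2^2=0$ and $u=a_1+a_2$; (b) all the Hermitian invariants $(b,u)_{p,k}$ of $(b,u)$ (for $p\in\mathrm{Irr}_0(\mathbb{F})$ and $k\ge 1$) are hyperbolic, and all the Jordan numbers $n_{p,k}(u)$ (for $p \in \mathrm{Irr}(\mathbb{F})$ and $k\geq 1$) are even.
   Context: $u$ is $b$-skew-selfadjoint if $b(u(x),y)=-b(x,u(y))$ for all $x,y$. $\mathrm{Irr}(\mathbb{F})$ is the set of monic irreducible polynomials of $\mathbb{F}[t]$, and $\mathrm{Irr}_0(\mathbb{F})=\mathrm{Irr}(\mathbb{F})\cap\mathbb{F}[t^2]$. For $p\in\mathrm{Irr}(\mathbb{F})$ and $k\ge1$, set $V_{p,k}:=\mathrm{Ker}\,p(u)^k/\bigl(\mathrm{Ker}\,p(u)^{k-1}+(\mathrm{Ker}\,p(u)^k\cap\mathrm{Im}\,p(u))\bigr)$, which is naturally a vector space over the field $\mathbb{L}:=\mathbb{F}[t]/(p)$ (the class of $t$ acting through $u$). The Jordan number is $n_{p,k}(u):=\dim_{\mathbb{L}}V_{p,k}$, i.e. the number of primary invariants (elementary divisors) of $u$ equal to $p^k$. Hermitian invariants. Let $p\in\mathrm{Irr}_0(\mathbb{F})$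 have degree $d$, and let $\mathbb{L}=\mathbb{F}[t]/(p)$ be equipped with the involution $x\mapsto x^\bullet$ taking the class of $q(t)$ to the class of $q(-t)$. Let $e_p:\mathbb{L}\to\mathbb{F}$ be the $\mathbb{F}$-linear form with $e_p(\overline{1})=1$ and $e_p(\overline{t^i})=0$ for $1\le i\le d-1$. The form $(x,y)\mapsto b(x,p(u)^{k-1}[y])$ on $\mathrm{Ker}\,p(u)^k$ induces a non-degenerate $\mathbb{F}$-bilinear form $B$ on $V_{p,k}$, and $(b,u)_{p,k}$ denotes the unique map $B^{\mathbb{L}}:V_{p,k}^2\to\mathbb{L}$ such that $B(x,\lambda y)=e_p(\lambda B^{\mathbb{L}}(x,y))$ for all $\lambda\in\mathbb{L}$ and all $x,y$. It is a non-degenerate Hermitian form over $(\mathbb{L},\bullet)$ (linear in the right variable, semilinear in the left one). A non-degenerate Hermitian form is hyperbolic if its space has even dimension $2m$ and contains a totally isotropic subspace of dimension $m$ (the form on the zero space is hyperbolic). *)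

theory Defs
  imports
    "HOL-Library.Set_Algebras"
    "HOL-Computational_Algebra.Computational_Algebra"
    "HOL-Algebra.Algebraic_Closure_Type"
    "Jordan_Normal_Form.Missing_VectorSpace"
begin

text \<open>
  The ambient space is a whole type \<open>'v\<close> with a scalar multiplication \<open>scale\<close> over the field \<open>'a\<close>
  (locale \<open>vector_space\<close> of HOL). The residue field \<open>F[t]/(p)\<close> and the spaces \<open>V_{p,k}\<close> depend
  on the values \<open>p\<close>, \<open>k\<close>, \<open>u\<close>, so they are HOL-Algebra structures whose elements are cosets.
\<close>

section \<open>Bilinear forms and skew-selfadjoint endomorphisms\<close>

definition bilinear_form :: "('a::field \<Rightarrow> 'v::ab_group_add \<Rightarrow> 'v) \<Rightarrow> ('v \<Rightarrow> 'v \<Rightarrow> 'a) \<Rightarrow> bool" where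
  "bilinear_form scale b \<longleftrightarrow>
     (\<forall>x. Vector_Spaces.linear scale (*) (\<lambda>y. b x y)) \<and>
     (\<forall>y. Vector_Spaces.linear scale (*) (\<lambda>x. b x y))"

definition symmetric_form :: "('v \<Rightarrow> 'v \<Rightarrow> 'a) \<Rightarrow> bool" where
  "symmetric_form b \<longleftrightarrow> (\<forall>x y. b x y = b y x)"

text \<open>Only the left radical is mentioned; it is the right radical for a symmetric form.\<close>

definition nondegenerate_form :: "('v::zero \<Rightarrow> 'v \<Rightarrow> 'a::zero) \<Rightarrow> bool" where
  "nondegenerate_form b \<longleftrightarrow> (\<forall>x. (\<forall>y. b x y = 0) \<longrightarrow> x = 0)"

definition skew_selfadjoint :: "('v \<Rightarrow> 'v \<Rightarrow> 'a::uminus) \<Rightarrow> ('v \<Rightarrow> 'v) \<Rightarrow> bool" where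
  "skew_selfadjoint b u \<longleftrightarrow> (\<forall>x y. b (u x) y = - b x (u y))"

section \<open>Irreducible polynomials and residue fields\<close>

definition Irr :: "'a::field poly set" where
  "Irr = {p. irreducible p \<and> lead_coeff p = 1}"

text \<open>\<open>F[t\<^sup>2]\<close> consists of the polynomials \<open>q(t\<^sup>2)\<close>.\<close>

definition Irr0 :: "'a::field poly set" where
  "Irr0 = Irr \<inter> range (\<lambda>q. pcompose q [:0, 0, 1:])"

definition residue_field :: "'a::field poly \<Rightarrow> 'a poly set ring" where
  "residue_field p = ring_of_type_algebra Quot (PIdl\<^bsub>ring_of_type_algebra\<^esub> p)"

text \<open>
  The class of \<open>q(t)\<close> is sent to the class of \<open>q(-t)\<close>. For \<open>p\<close> even, the substitution of \<open>-t\<close> fixes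
  \<open>p\<close>, so the image of the coset \<open>q + (p)\<close> is again a coset, namely \<open>q(-t) + (p)\<close>.
\<close>

definition residue_involution :: "'a::field poly set \<Rightarrow> 'a poly set" where
  "residue_involution C = (\<lambda>q. pcompose q [:0, -1:]) ` C"

text \<open>
  The form \<open>e_p\<close> is the coordinate along the class of 1 in the basis given by the classes of
  \<open>1, t, ..., t^(d-1)\<close>, i.e. the constant coefficient of the reduced representative.
\<close>

definition residue_form :: "'a::field poly \<Rightarrow> 'a poly set \<Rightarrow> 'a" where
  "residue_form p C = the_elem ((\<lambda>q. coeff (q mod p) 0) ` C)"

section \<open>The spaces \<open>V_{p,k}\<close> and the Jordan numbers\<close>

definition poly_endo ::
  "('a::field \<Rightarrow> 'v::ab_group_add \<Rightarrow> 'v) \<Rightarrow> ('v \<Rightarrow> 'v) \<Rightarrow> 'a poly \<Rightarrow> 'v \<Rightarrow> 'v" where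
  "poly_endo scale u q x = (\<Sum>i\<le>degree q. scale (coeff q i) ((u ^^ i) x))"

definition primary_kernel ::
  "('a::field \<Rightarrow> 'v::ab_group_add \<Rightarrow> 'v) \<Rightarrow> ('v \<Rightarrow> 'v) \<Rightarrow> 'a poly \<Rightarrow> nat \<Rightarrow> 'v set" where
  "primary_kernel scale u p k = {x. (poly_endo scale u p ^^ k) x = 0}"

definition primary_denominator ::
  "('a::field \<Rightarrow> 'v::ab_group_add \<Rightarrow> 'v) \<Rightarrow> ('v \<Rightarrow> 'v) \<Rightarrow> 'a poly \<Rightarrow> nat \<Rightarrow> 'v set" where
  "primary_denominator scale u p k =
     primary_kernel scale u p (k - 1) +
     (primary_kernel scale u p k \<inter> range (poly_endo scale u p))"

text \<open>
  The class of \<open>q\<close> acts on the class of \<open>x\<close> by \<open>q(u)\<close>; the union over representatives follows the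
  convention of \<open>rcoset_mult\<close>. The fields \<open>mult\<close> and \<open>one\<close> are inherited from the record type
  \<open>module\<close> and play no role.
\<close>

definition primary_quotient ::
  "('a::field \<Rightarrow> 'v::ab_group_add \<Rightarrow> 'v) \<Rightarrow> ('v \<Rightarrow> 'v) \<Rightarrow> 'a poly \<Rightarrow> nat \<Rightarrow>
     ('a poly set, 'v set) module" where
  "primary_quotient scale u p k =
     (let W = primary_denominator scale u p k in
      \<lparr>carrier = (\<lambda>x. x +o W) ` primary_kernel scale u p k,
       monoid.mult = (\<lambda>_ _. W), one = W,
       zero = W, add = (+),
       module.smult = (\<lambda>C A. \<Union>q\<in>C. \<Union>x\<in>A. poly_endo scale u q x +o W)\<rparr>)"

definition jordan_number ::
  "('a::field \<Rightarrow> 'v::ab_group_add \<Rightarrow> 'v) \<Rightarrow> ('v \<Rightarrow> 'v) \<Rightarrow> 'a poly \<Rightarrow> nat \<Rightarrow> nat" where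
  "jordan_number scale u p k =
     vectorspace.dim (residue_field p) (primary_quotient scale u p k)"

section \<open>Hermitian invariants\<close>

text \<open>The common value of \<open>b(x, p(u)^(k-1) y)\<close> over all representatives \<open>x\<close>, \<open>y\<close>.\<close>

definition induced_form ::
  "('a::field \<Rightarrow> 'v::ab_group_add \<Rightarrow> 'v) \<Rightarrow> ('v \<Rightarrow> 'v \<Rightarrow> 'a) \<Rightarrow> ('v \<Rightarrow> 'v) \<Rightarrow> 'a poly \<Rightarrow> nat \<Rightarrow>
     'v set \<Rightarrow> 'v set \<Rightarrow> 'a" where
  "induced_form scale b u p k A B =
     the_elem ((\<lambda>(x, y). b x ((poly_endo scale u p ^^ (k - 1)) y)) ` (A \<times> B))"

definition hermitian_invariant ::
  "('a::field \<Rightarrow> 'v::ab_group_add \<Rightarrow> 'v) \<Rightarrow> ('v \<Rightarrow> 'v \<Rightarrow> 'a) \<Rightarrow> ('v \<Rightarrow> 'v) \<Rightarrow> 'a poly \<Rightarrow> nat \<Rightarrow>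
     'v set \<Rightarrow> 'v set \<Rightarrow> 'a poly set" where
  "hermitian_invariant scale b u p k A B =
     (THE h. h \<in> carrier (residue_field p) \<and>
        (\<forall>l\<in>carrier (residue_field p).
           induced_form scale b u p k A (l \<odot>\<^bsub>primary_quotient scale u p k\<^esub> B) =
           residue_form p (l \<otimes>\<^bsub>residue_field p\<^esub> h)))"

definition nondegenerate_hermitian ::
  "('l, 'm) ring_scheme \<Rightarrow> ('l \<Rightarrow> 'l) \<Rightarrow> ('l, 'w, 'n) module_scheme \<Rightarrow> ('w \<Rightarrow> 'w \<Rightarrow> 'l) \<Rightarrow> bool" where
  "nondegenerate_hermitian L \<sigma> M H \<longleftrightarrow>
     (\<forall>x\<in>carrier M. \<forall>y\<in>carrier M. H x y \<in> carrier L) \<and>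
     (\<forall>x\<in>carrier M. \<forall>y\<in>carrier M. \<forall>z\<in>carrier M.
        H x (y \<oplus>\<^bsub>M\<^esub> z) = H x y \<oplus>\<^bsub>L\<^esub> H x z \<and> H (x \<oplus>\<^bsub>M\<^esub> y) z = H x z \<oplus>\<^bsub>L\<^esub> H y z) \<and>
     (\<forall>l\<in>carrier L. \<forall>x\<in>carrier M. \<forall>y\<in>carrier M.
        H x (l \<odot>\<^bsub>M\<^esub> y) = l \<otimes>\<^bsub>L\<^esub> H x y \<and> H (l \<odot>\<^bsub>M\<^esub> x) y = \<sigma> l \<otimes>\<^bsub>L\<^esub> H x y) \<and>
     (\<forall>x\<in>carrier M. \<forall>y\<in>carrier M. H y x = \<sigma> (H x y)) \<and>
     (\<forall>x\<in>carrier M. (\<forall>y\<in>carrier M. H x y = \<zero>\<^bsub>L\<^esub>) \<longrightarrow> x = \<zero>\<^bsub>M\<^esub>)"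

definition hyperbolic ::
  "('l, 'm) ring_scheme \<Rightarrow> ('l \<Rightarrow> 'l) \<Rightarrow> ('l, 'w, 'n) module_scheme \<Rightarrow> ('w \<Rightarrow> 'w \<Rightarrow> 'l) \<Rightarrow> bool" where
  "hyperbolic L \<sigma> M H \<longleftrightarrow>
     nondegenerate_hermitian L \<sigma> M H \<and>
     (\<exists>m. vectorspace.dim L M = 2 * m \<and>
        (\<exists>U. VectorSpace.subspace L U M \<and> vectorspace.dim L (M\<lparr>carrier := U\<rparr>) = m \<and>
             (\<forall>x\<in>U. \<forall>y\<in>U. H x y = \<zero>\<^bsub>L\<^esub>)))"

end

theory Submission
  imports Defs
begin

text \<open>
  Decompositions \<open>u = a1 + a2\<close> correspond to linear involutions \<open>s\<close> with \<open>s u = - u s\<close> and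
  \<open>b(s x, y) = - b(x, s y)\<close>.

  Given \<open>s\<close> and \<open>p\<close> even, a maximal \<open>s\<close>-stable totally isotropic subspace of \<open>V_{p,k}\<close> equals its
  orthogonal: otherwise there is an eigenvector \<open>x\<close> of \<open>s\<close> orthogonal to it and outside it, and \<open>x\<close>
  is isotropic because \<open>s\<close> reverses the sign of the form. For arbitrary \<open>p\<close>, the alternating form
  \<open>b(x, s y)\<close>, for which \<open>u\<close> is selfadjoint, gives the parity of the Jordan numbers.

  Conversely take \<open>s\<close> of maximal rank with \<open>s^3 = s\<close>, anticommuting with \<open>u\<close> and skew-selfadjoint.
  Its range satisfies (b) by the first part, hence so does its kernel, by cancellation of Lagrangians
  and additivity of dimensions. If the kernel is not zero, choose \<open>p\<close> and the largest exponent \<open>k\<close> for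
  which \<open>p^k\<close> is an elementary divisor of \<open>u\<close> on it. If \<open>p\<close> is even, an isotropic vector of
  \<open>V_{p,k}\<close> lifts to an isotropic generator \<open>x\<close>, which with a dual isotropic \<open>y\<close> spans a non-degenerate stable subspace on which
  \<open>x \<mapsto> x\<close>, \<open>y \<mapsto> - y\<close> extends to such an involution. If \<open>p\<close> is not even, two independent vectors
  \<open>x1, x2\<close> of \<open>V_{p,k}\<close> and dual vectors \<open>y1, y2\<close> for \<open>p(-t)\<close> give one exchanging \<open>x_i\<close> and \<open>y_i\<close>.
  Both contradict maximality.
\<close>

section \<open>Lagrangian subspaces\<close>

text \<open>Everything before the last section takes place inside \<open>V\<close>. For
  \<open>p\<close> even, \<open>V_{p,k}\<close> is replaced by \<open>Ker p(u)^k\<close> with the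
  degenerate form \<open>b(x, p(u)^(k-1) y)\<close>, whose radical is
  \<open>primary_denominator\<close>; dimensions over \<open>F[t]/(p)\<close> are read off from
  dimensions over \<open>F\<close>, which differ by the factor \<open>deg p\<close>. The condition
  \<open>s^3 = s\<close> replaces an induction on \<open>dim V\<close>: \<open>s\<close> is an
  involution on its range and zero on the orthogonal of that range, so the part of \<open>V\<close>
  still to be treated is the kernel of \<open>s\<close>, and no smaller space has to be introduced.
  Maximality of \<open>k\<close> gives each \<open>x\<close> in the kernel of \<open>s\<close> with
  \<open>p(u)^k x = 0\<close> and \<open>p(u)^(k-1) x\<close> non-zero a dual partner in
  \<open>Ker p(-u)^k\<close>. For \<open>p\<close> not even, one pair of generators is not enough:
  if \<open>s\<close> exchanged \<open>x\<close> and \<open>y\<close>, then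
  \<open>b(x, f(u) y)\<close> would be its own opposite. This is where parity of the Jordan numbers
  enters. As \<open>u\<close> is injective, \<open>p = t\<close> never occurs, so \<open>p\<close>
  has a non-zero constant coefficient. This makes the constant coefficient of the remainder modulo
  \<open>p^k\<close> a non-degenerate functional, by which all pairings are expressed.\<close>

definition annihilator :: "('v \<Rightarrow> 'v \<Rightarrow> 'a::zero) \<Rightarrow> 'v set \<Rightarrow> 'v set" where
  "annihilator B Y = {x. \<forall>y\<in>Y. B x y = 0}"

text \<open>This covers two cases: the symmetric form \<open>b(x, p(u)^(k-1) y)\<close> for even
  \<open>p\<close>, and the alternating form \<open>b(x, s p(u)^(k-1) y)\<close> for a sign map
  \<open>s\<close>.\<close>

definition reflexive_form :: "('v \<Rightarrow> 'v \<Rightarrow> 'a::zero) \<Rightarrow> bool" where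
  "reflexive_form B \<longleftrightarrow> (\<forall>x y. B x y = 0 \<longrightarrow> B y x = 0)"

text \<open>\<open>L\<close> is its own orthogonal inside \<open>K\<close>. The form on
  \<open>K\<close> may be degenerate: \<open>L\<close> then contains the radical and stands for a
  Lagrangian of the quotient of \<open>K\<close> by the radical.\<close>

definition lagrangian :: "('v \<Rightarrow> 'v \<Rightarrow> 'a::zero) \<Rightarrow> 'v set \<Rightarrow> 'v set \<Rightarrow> bool" where
  "lagrangian B K L \<longleftrightarrow>
     L \<subseteq> K \<and> (\<forall>x\<in>L. \<forall>y\<in>L. B x y = 0) \<and> (\<forall>x\<in>K. (\<forall>y\<in>L. B x y = 0) \<longrightarrow> x \<in> L)"

lemma
  assumes "lagrangian B K L"
  shows lagrangian_subset: "L \<subseteq> K"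
    and lagrangian_isotropic: "x \<in> L \<Longrightarrow> y \<in> L \<Longrightarrow> B x y = 0"
    and lagrangian_maximal: "x \<in> K \<Longrightarrow> (\<And>y. y \<in> L \<Longrightarrow> B x y = 0) \<Longrightarrow> x \<in> L"
  using assms unfolding lagrangian_def by blast+

lemma lagrangian_iff_eq: "lagrangian B K L \<longleftrightarrow> K \<inter> annihilator B L = L"
  unfolding lagrangian_def annihilator_def by (rule iffI, blast, blast elim: equalityE)

section \<open>Sums of subspaces, bilinear forms and annihilators\<close>

context vector_space
begin

lemma subspace_set_plus:
  assumes "subspace S" "subspace T"
  shows "subspace (S + T)"
proof -
  have "S + T = {x + y |x y. x \<in> S \<and> y \<in> T}" unfolding set_plus_def by blast
  then show ?thesis using subspace_sums[OF assms] by simp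
qed

lemma subset_set_plus_left:
  assumes "subspace T"
  shows "S \<subseteq> S + T"
proof
  fix x assume "x \<in> S"
  then have "x + 0 \<in> S + T" using subspace_0[OF assms] by (rule set_plus_intro)
  then show "x \<in> S + T" by simp
qed

lemma subset_set_plus_right:
  assumes "subspace S"
  shows "T \<subseteq> S + T"
proof
  fix x assume "x \<in> T"
  with subspace_0[OF assms] have "0 + x \<in> S + T" by (rule set_plus_intro)
  then show "x \<in> S + T" by simp
qed

lemma set_plus_least: "subspace U \<Longrightarrow> S \<subseteq> U \<Longrightarrow> T \<subseteq> U \<Longrightarrow> S + T \<subseteq> U"
  by (auto elim!: set_plus_elim intro: subspace_add)

lemma
  assumes "bilinear_form scale B"
  shows bilinear_add_left: "B (x + y) z = B x z + B y z"
    and bilinear_add_right: "B z (x + y) = B z x + B z y"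
    and bilinear_scale_left: "B (scale c x) z = c * B x z"
    and bilinear_scale_right: "B z (scale c x) = c * B z x"
    and bilinear_zero_left: "B 0 z = 0"
    and bilinear_zero_right: "B z 0 = 0"
    and bilinear_minus_left: "B (- x) z = - B x z"
    and bilinear_minus_right: "B z (- x) = - B z x"
    and bilinear_diff_left: "B (x - y) z = B x z - B y z"
    and bilinear_diff_right: "B z (x - y) = B z x - B z y"
proof -
  have l: "Vector_Spaces.linear scale (*) (\<lambda>x. B x z)" for z
    using assms unfolding bilinear_form_def by blast
  have r: "Vector_Spaces.linear scale (*) (\<lambda>x. B z x)" for z
    using assms unfolding bilinear_form_def by blast
  interpret l: Vector_Spaces.linear scale "(*)" "\<lambda>x. B x z" by (rule l)
  interpret r: Vector_Spaces.linear scale "(*)" "\<lambda>x. B z x" by (rule r)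
  show "B (x + y) z = B x z + B y z" by (rule l.add)
  show "B z (x + y) = B z x + B z y" by (rule r.add)
  show "B (scale c x) z = c * B x z" by (rule l.scale)
  show "B z (scale c x) = c * B z x" by (rule r.scale)
  show "B 0 z = 0" by (rule l.zero)
  show "B z 0 = 0" by (rule r.zero)
  show "B (- x) z = - B x z" by (rule l.neg)
  show "B z (- x) = - B z x" by (rule r.neg)
  show "B (x - y) z = B x z - B y z" by (rule l.diff)
  show "B z (x - y) = B z x - B z y" by (rule r.diff)
qed

lemmas bilinear_simps = bilinear_add_left bilinear_add_right bilinear_scale_left
  bilinear_scale_right bilinear_zero_left bilinear_zero_right bilinear_minus_left
  bilinear_minus_right bilinear_diff_left bilinear_diff_right

lemma linear_into_field_iff:
  "Vector_Spaces.linear scale (*) f \<longleftrightarrow> (\<forall>x y. f (x + y) = f x + f y) \<and> (\<forall>c x. f (scale c x) = c * f x)"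
proof
  assume "Vector_Spaces.linear scale (*) f"
  then interpret Vector_Spaces.linear scale "(*)" f .
  show "(\<forall>x y. f (x + y) = f x + f y) \<and> (\<forall>c x. f (scale c x) = c * f x)"
    by (simp add: add scale)
next
  assume *: "(\<forall>x y. f (x + y) = f x + f y) \<and> (\<forall>c x. f (scale c x) = c * f x)"
  interpret F: vector_space "(*) :: 'a \<Rightarrow> 'a \<Rightarrow> 'a"
    by unfold_locales (simp_all add: algebra_simps)
  show "Vector_Spaces.linear scale (*) f"
    using * vector_space_axioms F.vector_space_axioms by (simp add: Vector_Spaces.linear_iff)
qed

lemma linear_self_iff:
  "Vector_Spaces.linear scale scale f \<longleftrightarrow>
     (\<forall>x y. f (x + y) = f x + f y) \<and> (\<forall>c x. f (scale c x) = scale c (f x))"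
proof
  assume "Vector_Spaces.linear scale scale f"
  then interpret Vector_Spaces.linear scale scale f .
  show "(\<forall>x y. f (x + y) = f x + f y) \<and> (\<forall>c x. f (scale c x) = scale c (f x))"
    by (simp add: add scale)
next
  assume *: "(\<forall>x y. f (x + y) = f x + f y) \<and> (\<forall>c x. f (scale c x) = scale c (f x))"
  show "Vector_Spaces.linear scale scale f"
    using * vector_space_axioms by (simp add: Vector_Spaces.linear_iff)
qed

lemma bilinear_form_iff:
  "bilinear_form scale B \<longleftrightarrow>
     (\<forall>x y z. B (x + y) z = B x z + B y z) \<and> (\<forall>x y z. B z (x + y) = B z x + B z y) \<and>
     (\<forall>c x z. B (scale c x) z = c * B x z) \<and> (\<forall>c x z. B z (scale c x) = c * B z x)"
  unfolding bilinear_form_def linear_into_field_iff by blast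

lemma bilinear_form_swap: "bilinear_form scale B \<Longrightarrow> bilinear_form scale (\<lambda>x y. B y x)"
  unfolding bilinear_form_def by blast

lemma bilinear_form_compose:
  assumes "bilinear_form scale B" "Vector_Spaces.linear scale scale f"
  shows "bilinear_form scale (\<lambda>x y. B x (f y))"
  using assms unfolding bilinear_form_iff linear_self_iff by simp

lemma subspace_annihilator: "bilinear_form scale B \<Longrightarrow> subspace (annihilator B Y)"
  by (auto simp: annihilator_def subspace_def bilinear_simps)

lemma annihilator_span:
  assumes "bilinear_form scale B"
  shows "annihilator B (span Y) = annihilator B Y"
proof
  show "annihilator B (span Y) \<subseteq> annihilator B Y"
    using span_superset unfolding annihilator_def by blast
  show "annihilator B Y \<subseteq> annihilator B (span Y)"
  proof
    fix x assume x: "x \<in> annihilator B Y"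
    have sub: "subspace {y. B x y = 0}"
      by (auto simp: subspace_def bilinear_simps[OF assms])
    have "span Y \<subseteq> {y. B x y = 0}"
      by (rule span_minimal[OF _ sub]) (use x in \<open>auto simp: annihilator_def\<close>)
    then show "x \<in> annihilator B (span Y)" unfolding annihilator_def by blast
  qed
qed

lemma lagrangian_subspace:
  "bilinear_form scale B \<Longrightarrow> subspace K \<Longrightarrow> lagrangian B K U \<Longrightarrow> subspace U"
  unfolding lagrangian_iff_eq using subspace_inter subspace_annihilator by metis

end

section \<open>Dimension counts for orthogonals, with a possibly degenerate form\<close>

context finite_dimensional_vector_space
begin

lemma dim_set_plus:
  "subspace S \<Longrightarrow> subspace T \<Longrightarrow> dim (S + T) + dim (S \<inter> T) = dim S + dim T"
proof -
  assume "subspace S" "subspace T"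
  moreover have "S + T = {x + y |x y. x \<in> S \<and> y \<in> T}" unfolding set_plus_def by blast
  ultimately show ?thesis using dim_sums_Int by simp
qed

lemma dim_le_dim_kernel_Suc:
  assumes Z: "subspace Z" and f: "Vector_Spaces.linear scale (*) f"
  shows "dim Z \<le> Suc (dim {x \<in> Z. f x = 0})"
proof (cases "\<exists>x\<in>Z. f x \<noteq> 0")
  case False
  then have "{x \<in> Z. f x = 0} = Z" by auto
  then show ?thesis by simp
next
  case True
  interpret f: Vector_Spaces.linear scale "(*)" f by (rule f)
  obtain x0 where x0: "x0 \<in> Z" "f x0 \<noteq> 0" using True by blast
  let ?K = "{x \<in> Z. f x = 0}"
  have "Z \<subseteq> span (insert x0 ?K)"
  proof
    fix x assume x: "x \<in> Z"
    define c where "c = f x / f x0"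
    have "x - scale c x0 \<in> ?K"
      using x x0 Z by (simp add: c_def subspace_diff subspace_scale f.diff f.scale)
    then have "x - scale c x0 \<in> span ?K" by (rule span_base)
    then show "x \<in> span (insert x0 ?K)" by (subst span_insert) blast
  qed
  then have "dim Z \<le> dim (insert x0 ?K)" by (rule dim_mono)
  also have "\<dots> \<le> Suc (dim ?K)" by (simp add: dim_insert)
  finally show ?thesis .
qed

lemma dim_le_dim_annihilator_card:
  assumes Z: "subspace Z" and B: "bilinear_form scale B" and "finite S"
  shows "dim Z \<le> dim (Z \<inter> annihilator B S) + card S"
  using \<open>finite S\<close>
proof (induction S rule: finite_induct)
  case empty
  then show ?case by (simp add: annihilator_def)
next
  case (insert y S)
  have "Z \<inter> annihilator B (insert y S) = {x \<in> Z \<inter> annihilator B S. B x y = 0}"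
    unfolding annihilator_def by blast
  moreover have "dim (Z \<inter> annihilator B S) \<le> Suc (dim {x \<in> Z \<inter> annihilator B S. B x y = 0})"
    using B by (intro dim_le_dim_kernel_Suc subspace_inter Z subspace_annihilator)
      (simp_all add: bilinear_form_def)
  ultimately show ?case using insert by simp
qed

text \<open>Extend a basis of the part of \<open>Y\<close> that is orthogonal to \<open>Z\<close> to
  a basis of \<open>Y\<close>. Only the added vectors impose conditions on \<open>Z\<close>, and
  each of them lowers the dimension by at most one.\<close>

lemma dim_pairing_le:
  assumes Z: "subspace Z" and Y: "subspace Y" and B: "bilinear_form scale B"
  shows "dim Z + dim (Y \<inter> annihilator (\<lambda>y x. B x y) Z) \<le> dim Y + dim (Z \<inter> annihilator B Y)"
proof -
  let ?N = "Y \<inter> annihilator (\<lambda>y x. B x y) Z"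
  have N: "subspace ?N"
    by (rule subspace_inter[OF Y subspace_annihilator[OF bilinear_form_swap[OF B]]])
  obtain C where C: "C \<subseteq> ?N" "independent C" "?N \<subseteq> span C" "card C = dim ?N"
    by (rule basis_exists)
  have "C \<subseteq> Y" using C by blast
  then obtain C' where C': "C \<subseteq> C'" "C' \<subseteq> Y" "independent C'" "Y \<subseteq> span C'"
    using maximal_independent_subset_extend C(2) by blast
  have fin: "finite C'" using C'(3) by (rule finiteI_independent)
  have card': "card C' = dim Y" using C' by (metis basis_card_eq_dim)
  have eq: "Z \<inter> annihilator B Y = Z \<inter> annihilator B (C' - C)"
  proof -
    have "span C' = Y" using C'(2,4) Y by (metis span_subspace)
    then have "annihilator B Y = annihilator B C'" using annihilator_span[OF B] by metis
    moreover have "Z \<inter> annihilator B C' = Z \<inter> annihilator B (C' - C)"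
      using C(1) unfolding annihilator_def by blast
    ultimately show ?thesis by simp
  qed
  have "dim Z \<le> dim (Z \<inter> annihilator B (C' - C)) + card (C' - C)"
    using fin by (intro dim_le_dim_annihilator_card Z B) auto
  moreover have "card (C' - C) + card C = card C'"
    using fin C'(1) by (metis card_Diff_subset card_mono finite_subset le_add_diff_inverse2)
  ultimately show ?thesis unfolding eq using C(4) card' by linarith
qed

text \<open>The rank of the pairing of \<open>Z\<close> with \<open>Y\<close>, computed from either
  side; the second inequality is the first one for exchanged arguments.\<close>

lemma dim_pairing:
  assumes "subspace Z" "subspace Y" "bilinear_form scale B"
  shows "dim Z + dim (Y \<inter> annihilator (\<lambda>y x. B x y) Z) = dim Y + dim (Z \<inter> annihilator B Y)"
  using dim_pairing_le[OF assms] dim_pairing_le[OF assms(2,1) bilinear_form_swap[OF assms(3)]]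
  by simp

lemma dim_annihilator_reflexive:
  assumes K: "subspace K" and A: "subspace A" "A \<subseteq> K" and B: "bilinear_form scale B"
    and refl: "reflexive_form B"
    and rad: "K \<inter> annihilator B K \<subseteq> A"
  shows "dim (K \<inter> annihilator B A) + dim A = dim K + dim (K \<inter> annihilator B K)"
proof -
  have "A \<inter> annihilator (\<lambda>y x. B x y) K = K \<inter> annihilator B K"
    using A rad refl unfolding annihilator_def reflexive_form_def by blast
  then show ?thesis using dim_pairing[OF K A(1) B] by simp
qed

text \<open>The dimension formula, applied to \<open>A\<close> and then to its orthogonal, which
  also contains the radical, gives the double orthogonal the dimension of \<open>A\<close>.
  Reflexivity gives the inclusion.\<close>

lemma double_annihilator:
  assumes K: "subspace K" and A: "subspace A" "A \<subseteq> K" and B: "bilinear_form scale B"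
    and refl: "reflexive_form B"
    and rad: "K \<inter> annihilator B K \<subseteq> A"
  shows "K \<inter> annihilator B (K \<inter> annihilator B A) = A"
proof -
  let ?P = "K \<inter> annihilator B A"
  have P: "subspace ?P" by (intro subspace_inter K subspace_annihilator B)
  have "K \<inter> annihilator B K \<subseteq> ?P" using A(2) unfolding annihilator_def by blast
  then have "dim (K \<inter> annihilator B ?P) + dim ?P = dim K + dim (K \<inter> annihilator B K)"
    by (rule dim_annihilator_reflexive[OF K P Int_lower1 B refl])
  then have "dim (K \<inter> annihilator B ?P) = dim A"
    using dim_annihilator_reflexive[OF K A B refl rad] by simp
  moreover have "A \<subseteq> K \<inter> annihilator B ?P"
    using A(2) refl unfolding annihilator_def reflexive_form_def by blast
  ultimately show ?thesis
    using subspace_dim_equal[of A "K \<inter> annihilator B ?P"] A(1)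
      subspace_inter[OF K subspace_annihilator[OF B]] by simp
qed

lemma dim_lagrangian:
  assumes K: "subspace K" and B: "bilinear_form scale B"
    and refl: "reflexive_form B" and L: "lagrangian B K L"
  shows "2 * dim L = dim K + dim (K \<inter> annihilator B K)"
proof -
  have LK: "L \<subseteq> K" and eq: "K \<inter> annihilator B L = L"
    using L lagrangian_subset by (auto simp: lagrangian_iff_eq)
  have "K \<inter> annihilator B K \<subseteq> L"
    using eq LK unfolding annihilator_def by blast
  then have "dim (K \<inter> annihilator B L) + dim L = dim K + dim (K \<inter> annihilator B K)"
    by (rule dim_annihilator_reflexive[OF K lagrangian_subspace[OF B K L] LK B refl])
  then show ?thesis unfolding eq by simp
qed

text \<open>Modulo the radical \<open>L\<close> has half the dimension of \<open>K\<close>, so it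
  fills its orthogonal. This turns the half-dimensional subspaces in the definition of hyperbolic
  forms into Lagrangians.\<close>

lemma lagrangianI_dim:
  assumes K: "subspace K" and L: "subspace L" "L \<subseteq> K" and B: "bilinear_form scale B"
    and refl: "reflexive_form B"
    and rad: "K \<inter> annihilator B K \<subseteq> L" and iso: "L \<subseteq> annihilator B L"
    and dim: "2 * dim L = dim K + dim (K \<inter> annihilator B K)"
  shows "lagrangian B K L"
proof -
  have "dim (K \<inter> annihilator B L) = dim L"
    using dim_annihilator_reflexive[OF K L B refl rad] dim by simp
  then show ?thesis unfolding lagrangian_iff_eq
    using subspace_dim_equal[of L "K \<inter> annihilator B L"] L iso
      subspace_inter[OF K subspace_annihilator[OF B]] by simp
qed

text \<open>Witt cancellation for metabolic forms: symplectic reduction of \<open>L\<close> along \<open>L1\<close>.\<close>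

lemma lagrangian_cancel:
  assumes K: "subspace K" "subspace K1" "subspace K2" "K = K1 + K2"
    and B: "bilinear_form scale B" and refl: "reflexive_form B"
    and orth: "\<And>x y. x \<in> K1 \<Longrightarrow> y \<in> K2 \<Longrightarrow> B x y = 0"
    and L: "lagrangian B K L" and L1: "lagrangian B K1 L1"
  shows "lagrangian B K2 ((L + L1) \<inter> K2)"
  unfolding lagrangian_iff_eq
proof
  have sL: "subspace L" "subspace L1"
    by (rule lagrangian_subspace[OF B K(1) L], rule lagrangian_subspace[OF B K(2) L1])
  note bs = bilinear_simps[OF B]
  have orth': "B y x = 0" if "x \<in> K1" "y \<in> K2" for x y
    using refl orth[OF that] unfolding reflexive_form_def by simp
  have isoL: "B x y = 0" if "x \<in> L" "y \<in> L" for x y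
    using lagrangian_isotropic[OF L that] .
  have isoL1: "B x y = 0" if "x \<in> L1" "y \<in> L1" for x y
    using lagrangian_isotropic[OF L1 that] .
  have L1K1: "L1 \<subseteq> K1" by (rule lagrangian_subset[OF L1])
  have K1K: "K1 \<subseteq> K" "K2 \<subseteq> K"
    unfolding K(4) by (intro subset_set_plus_left subset_set_plus_right K)+
  show "(L + L1) \<inter> K2 \<subseteq> K2 \<inter> annihilator B ((L + L1) \<inter> K2)"
  proof
    fix x assume x: "x \<in> (L + L1) \<inter> K2"
    have "B x y = 0" if y: "y \<in> (L + L1) \<inter> K2" for y
    proof -
      obtain a c where ac: "x = a + c" "a \<in> L" "c \<in> L1" using x by (auto elim!: set_plus_elim)
      obtain a' c' where ac': "y = a' + c'" "a' \<in> L" "c' \<in> L1"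
        using y by (auto elim!: set_plus_elim)
      \<comment> \<open>\<open>x - c\<close> and \<open>y - c'\<close> are the
        \<open>L\<close>-components. In the expansion all terms but \<open>B x y\<close> vanish,
        because \<open>c\<close> and \<open>c'\<close> lie in \<open>L1\<close>, which is isotropic
        and orthogonal to \<open>K2\<close>.\<close>
      have "B (x - c) (y - c') = 0" using ac ac' isoL by simp
      moreover have "B x c' = 0" "B c y = 0"
        using orth'[of c' x] orth[of c y] x y ac(3) ac'(3) L1K1 by auto
      moreover have "B c c' = 0" using isoL1 ac ac' by blast
      ultimately show ?thesis by (simp add: bs)
    qed
    then show "x \<in> K2 \<inter> annihilator B ((L + L1) \<inter> K2)"
      using x unfolding annihilator_def by blast
  qed
  show "K2 \<inter> annihilator B ((L + L1) \<inter> K2) \<subseteq> (L + L1) \<inter> K2"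
  proof
    fix v assume v: "v \<in> K2 \<inter> annihilator B ((L + L1) \<inter> K2)"
    have LL: "L + L1 \<subseteq> K"
      using lagrangian_subset[OF L] L1K1 K1K by (intro set_plus_least K(1)) auto
    have LsubLL: "L \<subseteq> L + L1" "L1 \<subseteq> L + L1"
      by (intro subset_set_plus_left subset_set_plus_right sL)+
    have radL: "K \<inter> annihilator B K \<subseteq> L + L1"
      using LsubLL lagrangian_subset[OF L] by (fastforce intro: lagrangian_maximal[OF L] simp: annihilator_def)
    \<comment> \<open>So \<open>v\<close> is orthogonal to the orthogonal of \<open>L + L1\<close>:
      a vector \<open>z\<close> of the latter lies in \<open>L\<close>, its
      \<open>K1\<close>-component lies in \<open>L1\<close>, hence its \<open>K2\<close>-component
      lies in \<open>(L + L1) \<inter> K2\<close>, to which \<open>v\<close> is orthogonal.\<close>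
    have "B v z = 0" if z: "z \<in> K \<inter> annihilator B (L + L1)" for z
    proof -
      obtain z1 z2 where z12: "z = z1 + z2" "z1 \<in> K1" "z2 \<in> K2"
        using z unfolding K(4) by (auto elim!: set_plus_elim)
      have zL: "z \<in> L" using z LsubLL by (intro lagrangian_maximal[OF L]) (auto simp: annihilator_def)
      have "B z1 y = 0" if y: "y \<in> L1" for y
      proof -
        have "B z y = 0" using z y LsubLL unfolding annihilator_def by blast
        moreover have "B z2 y = 0" using orth'[of y z2] z12 y L1K1 by auto
        ultimately show ?thesis using z12 by (simp add: bs)
      qed
      then have z1: "z1 \<in> L1" by (intro lagrangian_maximal[OF L1] z12)
      then have "- z1 \<in> L1" using sL(2) by (simp add: subspace_neg)
      then have "z + - z1 \<in> L + L1" by (rule set_plus_intro[OF zL])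
      then have "z2 \<in> (L + L1) \<inter> K2" using z12 by simp
      then have "B v z2 = 0" using v unfolding annihilator_def by blast
      moreover have "B v z1 = 0" using v z12 orth'[of z1 v] by auto
      ultimately show ?thesis using z12 by (simp add: bs)
    qed
    then have "v \<in> K \<inter> annihilator B (K \<inter> annihilator B (L + L1))"
      using v K1K unfolding annihilator_def by blast
    then have "v \<in> L + L1"
      using double_annihilator[OF K(1) subspace_set_plus[OF sL] LL B refl radL] by blast
    then show "v \<in> (L + L1) \<inter> K2" using v by blast
  qed
qed

end

section \<open>The substitution of \<open>-t\<close> and residue functionals\<close>

text \<open>For skew-selfadjoint \<open>u\<close>, the adjoint of \<open>f(u)\<close> is
  \<open>(flip f)(u)\<close>; a linear map anticommuting with \<open>u\<close> likewise turns
  \<open>f(u)\<close> into \<open>(flip f)(u)\<close>.\<close>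

definition flip :: "'a::field poly \<Rightarrow> 'a poly" where
  "flip f = pcompose f [:0, -1:]"

lemma coeff_flip: "coeff (flip f) i = (- 1) ^ i * coeff f i"
  by (simp add: flip_def coeff_pcompose_linear)

lemma flip_flip [simp]: "flip (flip f) = f"
  by (rule poly_eqI) (simp add: coeff_flip flip: mult.assoc power_mult_distrib)

lemma flip_0 [simp]: "flip 0 = 0"
  and flip_1 [simp]: "flip 1 = 1"
  and flip_add: "flip (f + g) = flip f + flip g"
  and flip_diff: "flip (f - g) = flip f - flip g"
  and flip_mult: "flip (f * g) = flip f * flip g"
  by (simp_all add: flip_def pcompose_1 pcompose_add pcompose_diff pcompose_mult)

lemma flip_power: "flip (f ^ n) = flip f ^ n"
  by (induction n) (simp_all add: flip_mult)

lemma degree_flip [simp]: "degree (flip f) = degree f"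
  by (simp add: flip_def degree_pcompose)

lemma flip_eq_0_iff [simp]: "flip f = 0 \<longleftrightarrow> f = 0"
  by (metis flip_0 flip_flip)

lemma flip_dvd_flip_iff [simp]: "flip f dvd flip g \<longleftrightarrow> f dvd g"
proof -
  have *: "flip f dvd flip g" if "f dvd g" for f g :: "'a poly"
    using that by (auto simp: dvd_def flip_mult)
  show ?thesis using *[of f g] *[of "flip f" "flip g"] by auto
qed

lemma irreducible_flip_iff [simp]: "irreducible (flip p) \<longleftrightarrow> irreducible p"
proof -
  have u: "flip a dvd 1 \<longleftrightarrow> a dvd 1" for a :: "'a poly"
    using flip_dvd_flip_iff[of a 1] by simp
  have *: "irreducible (flip p)" if "irreducible p" for p :: "'a poly"
  proof (rule irreducibleI)
    show "flip p \<noteq> 0" "\<not> flip p dvd 1" using that by (auto simp: irreducible_def u)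
    fix a c assume "flip p = a * c"
    then have "p = flip a * flip c" by (metis flip_flip flip_mult)
    from irreducibleD[OF that this] show "a dvd 1 \<or> c dvd 1" by (simp add: u)
  qed
  show ?thesis using *[of p] *[of "flip p"] by auto
qed

text \<open>By Euclidean division, a non-zero combination of \<open>f\<close> and \<open>g\<close>
  of least degree divides every combination.\<close>

lemma poly_bezout:
  fixes f g :: "'a::field poly"
  assumes "f \<noteq> 0"
  shows "\<exists>h a c. h = a * f + c * g \<and> h dvd f \<and> h dvd g"
proof -
  define I where "I = {h. h \<noteq> 0 \<and> (\<exists>a c. h = a * f + c * g)}"
  have "f = 1 * f + 0 * g" by simp
  then have "f \<in> I" using assms unfolding I_def by blast
  then obtain h where h: "h \<in> I" "\<And>h'. h' \<in> I \<Longrightarrow> degree h \<le> degree h'"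
    by (rule ex_has_least_nat[THEN exE, of "\<lambda>h. h \<in> I" f degree]) blast
  then obtain a c where ac: "h = a * f + c * g" and "h \<noteq> 0" unfolding I_def by blast
  have dvd: "h dvd k" if "k = x * f + y * g" for k x y
  proof (rule ccontr)
    assume nd: "\<not> h dvd k"
    have "k mod h = k - (k div h) * h" by (simp add: minus_div_mult_eq_mod)
    also have "\<dots> = (x - (k div h) * a) * f + (y - (k div h) * c) * g"
      using ac that by (simp add: algebra_simps)
    finally have "k mod h \<in> I" using nd unfolding I_def by (auto simp: dvd_eq_mod_eq_0)
    then show False using h(2) degree_mod_less_degree[OF \<open>h \<noteq> 0\<close> nd] by fastforce
  qed
  have "h dvd f" by (rule dvd[of _ 1 0]) simp
  moreover have "h dvd g" by (rule dvd[of _ 0 1]) simp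
  ultimately show ?thesis using ac by blast
qed

lemma irreducible_bezout:
  fixes p g :: "'a::field poly"
  assumes p: "irreducible p" and nd: "\<not> p dvd g"
  shows "\<exists>a c. a * p + c * g = 1"
proof -
  have "p \<noteq> 0" using p by auto
  then obtain h a c where h: "h = a * p + c * g" "h dvd p" "h dvd g"
    using poly_bezout[of p g] by blast
  obtain r where r: "p = h * r" using h(2) by (rule dvdE)
  have "\<not> r dvd 1"
  proof
    assume "r dvd 1"
    then have "h * r dvd h * 1" by (intro mult_dvd_mono) auto
    then show False using r h(3) nd dvd_trans[of p h g] by simp
  qed
  then have "h dvd 1" using irreducibleD[OF p r] by blast
  then obtain s where "1 = h * s" by (rule dvdE)
  then have "(s * a) * p + (s * c) * g = 1" using h(1) by (simp add: algebra_simps)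
  then show ?thesis by blast
qed

lemma bezout_power:
  fixes p g :: "'a::comm_ring_1"
  assumes "a * p + c * g = 1"
  shows "\<exists>a c. a * p ^ k + c * g = 1"
proof (induction k)
  case 0
  have "1 * p ^ 0 + 0 * g = 1" by simp
  then show ?case by blast
next
  case (Suc k)
  then obtain a' c' where "a' * p ^ k + c' * g = 1" by blast
  then have "1 = (a' * p ^ k + c' * g) * (a * p + c * g)" using assms by simp
  also have "\<dots> = (a' * a) * p ^ Suc k + (a' * p ^ k * c + c' * a * p + c' * c * g) * g"
    by (simp add: algebra_simps)
  finally show ?case by metis
qed

lemma irreducible_power_bezout:
  fixes p g :: "'a::field poly"
  assumes "irreducible p" "\<not> p dvd g"
  shows "\<exists>a c. a * p ^ k + c * g = 1"
  using irreducible_bezout[OF assms] bezout_power by blast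

lemma degree_irreducible_pos:
  fixes p :: "'a::field poly"
  assumes "irreducible p"
  shows "degree p > 0"
  using assms by (metis irreducible_def is_unit_iff_degree neq0_conv)

text \<open>For \<open>m = p\<close> this is \<open>e_p\<close> on representatives. Powers
  \<open>m = p^k\<close> occur as well: when \<open>m(u) y = 0\<close>, the functional
  \<open>f \<mapsto> b(x, f(u) y)\<close> factors through \<open>F[t]/(m)\<close> and is to be
  compared with this one.\<close>

definition residue_coeff :: "'a::field poly \<Rightarrow> 'a poly \<Rightarrow> 'a" where
  "residue_coeff m f = coeff (f mod m) 0"

lemma residue_coeff_add: "residue_coeff m (f + g) = residue_coeff m f + residue_coeff m g"
  by (simp add: residue_coeff_def poly_mod_add_left)

lemma residue_coeff_diff: "residue_coeff m (f - g) = residue_coeff m f - residue_coeff m g"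
  by (simp add: residue_coeff_def poly_mod_diff_left)

lemma residue_coeff_smult: "residue_coeff m (smult c f) = c * residue_coeff m f"
  by (simp add: residue_coeff_def mod_smult_left)

lemma residue_coeff_multiple: "m dvd f \<Longrightarrow> residue_coeff m f = 0"
  by (simp add: residue_coeff_def)

lemma residue_coeff_cong: "m dvd f - g \<Longrightarrow> residue_coeff m f = residue_coeff m g"
  using residue_coeff_multiple[of m "f - g"] by (simp add: residue_coeff_diff)

text \<open>The substitution of \<open>-t\<close> preserves degrees and constant coefficients, hence
  division with remainder. For even \<open>p\<close> this is the invariance of \<open>e_p\<close>
  under the involution, the source of Hermitian symmetry.\<close>

lemma residue_coeff_flip: "residue_coeff (flip m) (flip f) = residue_coeff m f"
proof (cases "m = 0")
  case True
  then show ?thesis by (simp add: residue_coeff_def coeff_flip)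
next
  case False
  have "flip f = flip (f div m) * flip m + flip (f mod m)"
    by (simp flip: flip_mult flip_add)
  then have "flip f mod flip m = flip (f mod m) mod flip m"
    by simp
  also have "\<dots> = flip (f mod m)"
  proof (cases "f mod m = 0")
    case nz: False
    then show ?thesis using degree_mod_less'[OF False nz] by (simp add: mod_poly_less)
  qed simp
  finally show ?thesis by (simp add: residue_coeff_def coeff_flip)
qed

lemma residue_coeff_monom_less:
  "0 < i \<Longrightarrow> i < degree m \<Longrightarrow> residue_coeff m (monom c i) = 0"
  by (cases "c = 0") (simp_all add: residue_coeff_def mod_poly_less degree_monom_eq)

text \<open>Subtracting one multiple of \<open>m\<close> already produces the remainder. The value
  is non-zero exactly when \<open>coeff m 0\<close> is, and this is how that condition enters the
  next two results.\<close>

lemma residue_coeff_of_degree_eq: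
  assumes "degree f = degree m" "degree m > 0" "coeff f 0 = 0"
  shows "residue_coeff m f = - lead_coeff f / lead_coeff m * coeff m 0"
proof -
  let ?r = "f - smult (lead_coeff f / lead_coeff m) m"
  have "m \<noteq> 0" using assms by auto
  have "coeff ?r (degree m) = 0" using assms \<open>m \<noteq> 0\<close> by simp
  moreover have "degree ?r \<le> degree m"
    using assms by (intro degree_diff_le) auto
  ultimately have "?r = 0 \<or> degree ?r < degree m"
    by (metis le_neq_implies_less leading_coeff_0_iff)
  then have "?r mod m = ?r" by (auto simp: mod_poly_less)
  moreover have "residue_coeff m f = residue_coeff m ?r"
    by (rule residue_coeff_cong) (simp add: dvd_smult)
  ultimately show ?thesis using assms by (simp add: residue_coeff_def)
qed

text \<open>A triangular system: \<open>t^i * t^(deg m - n)\<close> has value 0 for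
  \<open>i < n\<close> and a non-zero value for \<open>i = n\<close>, so a multiple of
  \<open>t^(deg m - n)\<close> added to \<open>g\<close> adjusts the value at \<open>t^n\<close>
  without disturbing the earlier ones. Thus \<open>F[t]/(m)\<close> is a Frobenius algebra.\<close>

lemma residue_coeff_represents:
  fixes m :: "'a::field poly"
  assumes m0: "coeff m 0 \<noteq> 0"
    and add: "\<And>f g. \<chi> (f + g) = \<chi> f + \<chi> g" and smult: "\<And>c f. \<chi> (smult c f) = c * \<chi> f"
    and mult: "\<And>f. \<chi> (m * f) = 0"
  shows "\<exists>g. \<forall>f. \<chi> f = residue_coeff m (f * g)"
proof -
  have "m \<noteq> 0" using m0 by auto
  have *: "\<exists>g. \<forall>i<n. \<chi> (monom 1 i) = residue_coeff m (monom 1 i * g)" if "n \<le> degree m" for n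
    using that
  proof (induction n)
    case (Suc n)
    then obtain g where g: "\<And>i. i < n \<Longrightarrow> \<chi> (monom 1 i) = residue_coeff m (monom 1 i * g)"
      by auto
    let ?c = "residue_coeff m (monom 1 n * monom 1 (degree m - n))"
    have "?c = - (1 / lead_coeff m) * coeff m 0"
      using Suc.prems by (simp add: mult_monom residue_coeff_of_degree_eq degree_monom_eq)
    then have c: "?c \<noteq> 0" using m0 \<open>m \<noteq> 0\<close> by simp
    define d where "d = (\<chi> (monom 1 n) - residue_coeff m (monom 1 n * g)) / ?c"
    let ?g = "g + smult d (monom 1 (degree m - n))"
    have "\<chi> (monom 1 i) = residue_coeff m (monom 1 i * ?g)" if "i < Suc n" for i
    proof (cases "i = n")
      case True
      then show ?thesis using c
        by (simp add: distrib_left residue_coeff_add residue_coeff_smult d_def)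
    next
      case False
      then have "residue_coeff m (monom 1 i * monom 1 (degree m - n)) = 0"
        using that Suc.prems by (simp add: mult_monom residue_coeff_monom_less)
      then show ?thesis using False that g
        by (simp add: distrib_left residue_coeff_add residue_coeff_smult)
    qed
    then show ?case by blast
  qed simp
  obtain g where g: "\<And>i. i < degree m \<Longrightarrow> \<chi> (monom 1 i) = residue_coeff m (monom 1 i * g)"
    using * by blast
  define \<delta> where "\<delta> f = \<chi> f - residue_coeff m (f * g)" for f
  have \<delta>_add: "\<delta> (f + h) = \<delta> f + \<delta> h" for f h
    by (simp add: \<delta>_def add distrib_right residue_coeff_add)
  have \<delta>_smult: "\<delta> (smult c f) = c * \<delta> f" for c f
    by (simp add: \<delta>_def smult residue_coeff_smult algebra_simps)
  have \<delta>_0: "\<delta> 0 = 0" using \<delta>_smult[of 0 0] by simp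
  have \<delta>_sum: "\<delta> (sum h A) = (\<Sum>a\<in>A. \<delta> (h a))" for h and A :: "nat set"
    by (induction A rule: infinite_finite_induct) (simp_all add: \<delta>_0 \<delta>_add)
  have \<delta>_monom: "\<delta> (monom c i) = 0" if "i < degree m" for c i
  proof -
    have "\<delta> (monom c i) = c * \<delta> (monom 1 i)"
      using \<delta>_smult[of c "monom 1 i"] by (simp add: smult_monom)
    then show ?thesis using g[OF that] by (simp add: \<delta>_def)
  qed
  have "\<delta> f = 0" for f
  proof -
    have "\<delta> (f mod m) = 0"
    proof (cases "f mod m = 0")
      case False
      then have lt: "degree (f mod m) < degree m" using \<open>m \<noteq> 0\<close> by (rule degree_mod_less'[rotated])
      have "\<delta> (f mod m) = (\<Sum>i\<le>degree (f mod m). \<delta> (monom (coeff (f mod m) i) i))"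
        by (subst poly_as_sum_of_monoms[of "f mod m", symmetric]) (rule \<delta>_sum)
      also have "\<dots> = 0" using lt by (intro sum.neutral) (auto intro: \<delta>_monom)
      finally show ?thesis .
    qed (simp add: \<delta>_0)
    moreover have "\<delta> (m * (f div m)) = 0"
      by (simp add: \<delta>_def mult residue_coeff_multiple)
    ultimately have "\<delta> (m * (f div m) + f mod m) = 0"
      by (simp only: \<delta>_add add_0)
    then show ?thesis by simp
  qed
  then show ?thesis by (auto simp: \<delta>_def)
qed

text \<open>Multiply the remainder of \<open>g\<close> by the power of \<open>t\<close> that brings
  it to degree \<open>deg m\<close>: the product has no constant term, and its value is non-zero by
  the formula for that degree.\<close>

lemma residue_coeff_nondegenerate:
  fixes m :: "'a::field poly"
  assumes m0: "coeff m 0 \<noteq> 0" and zero: "\<And>f. residue_coeff m (f * g) = 0"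
  shows "m dvd g"
proof (rule ccontr)
  assume nd: "\<not> m dvd g"
  have "m \<noteq> 0" using m0 by auto
  let ?r = "g mod m"
  have r: "?r \<noteq> 0" using nd by (simp add: dvd_eq_mod_eq_0)
  have lt: "degree ?r < degree m" using degree_mod_less'[OF \<open>m \<noteq> 0\<close> r] .
  define i where "i = degree m - degree ?r"
  have deg: "degree (monom 1 i * ?r) = degree m"
    using r lt by (simp add: i_def degree_mult_eq degree_monom_eq)
  have "residue_coeff m (monom 1 i * g) = residue_coeff m (monom 1 i * ?r)"
    by (rule residue_coeff_cong) (simp add: mod_eq_dvd_iff[symmetric] flip: right_diff_distrib)
  also have "\<dots> \<noteq> 0"
    using r lt deg m0 \<open>m \<noteq> 0\<close>
    by (subst residue_coeff_of_degree_eq) (auto simp: i_def coeff_monom_mult)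
  finally show False using zero by simp
qed

section \<open>Irreducible polynomials and evenness\<close>

lemma Irr_irreducible: "p \<in> Irr \<Longrightarrow> irreducible p"
  by (simp add: Irr_def)

lemma Irr0_Irr: "p \<in> Irr0 \<Longrightarrow> p \<in> Irr"
  by (simp add: Irr0_def)

lemma Irr0_flip:
  assumes "p \<in> Irr0"
  shows "flip p = p"
proof -
  obtain q where q: "p = pcompose q [:0, 0, 1:]" using assms unfolding Irr0_def by blast
  have "pcompose [:0, 0, 1:] [:0, -1:] = [:0, 0, 1 :: 'a:]"
    by (simp add: pcompose_pCons)
  then show ?thesis unfolding q flip_def by (simp flip: pcompose_assoc)
qed

lemma irreducible_coeff_0:
  fixes p :: "'a::field poly"
  assumes "irreducible p" "\<not> p dvd [:0, 1:]"
  shows "coeff p 0 \<noteq> 0"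
proof
  assume "coeff p 0 = 0"
  then obtain q where "p = [:0, 1:] * q" by (cases p) auto
  moreover have "\<not> [:0, 1 :: 'a:] dvd 1" by (simp add: is_unit_iff_degree)
  ultimately have "q dvd 1" using irreducibleD[OF assms(1)] by blast
  then obtain r where "1 = q * r" by (rule dvdE)
  then have "[:0, 1:] = p * r" using \<open>p = [:0, 1:] * q\<close> by (metis mult.assoc mult.right_neutral)
  then show False using assms(2) by simp
qed

lemma two_neq_0_of_CHAR: "CHAR('a::field) \<noteq> 2 \<Longrightarrow> (2 :: 'a) \<noteq> 0"
  using CHAR_eq_posI[of 2, where ?'a='a] by (auto simp: less_Suc_eq numeral_2_eq_2)

lemma flip_even_imp_Irr0:
  fixes p :: "'a::field poly"
  assumes "CHAR('a) \<noteq> 2" "p \<in> Irr" "flip p = p"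
  shows "p \<in> Irr0"
proof -
  have two: "(2 :: 'a) \<noteq> 0" using assms(1) by (rule two_neq_0_of_CHAR)
  have odd: "coeff p i = 0" if "odd i" for i
  proof -
    have "coeff p i = - coeff p i"
      using that coeff_flip[of p i] assms(3) by simp
    then have "2 * coeff p i = 0" by (metis add.right_inverse mult_2)
    then show ?thesis using two by simp
  qed
  define q where "q = (\<Sum>i\<le>degree p. monom (coeff p (2 * i)) i)"
  have coeff_q: "coeff q i = coeff p (2 * i)" for i
    by (simp add: q_def coeff_sum if_distrib coeff_eq_0 not_le)
  have comp: "coeff (pcompose f [:0, 0, 1:]) n = (if even n then coeff f (n div 2) else 0)"
    for f :: "'a poly" and n
  proof (induction f arbitrary: n)
    case (pCons a f)
    have "pcompose (pCons a f) [:0, 0, 1:] = pCons a (pCons 0 (pcompose f [:0, 0, 1:]))"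
      by (simp add: pcompose_pCons)
    then show ?case
      by (cases n rule: nat.exhaust, simp)
        (auto simp: pCons.IH coeff_pCons split: nat.splits)
  qed simp
  have "pcompose q [:0, 0, 1:] = p"
    by (rule poly_eqI) (simp add: comp coeff_q odd)
  then show ?thesis using assms(2) unfolding Irr0_def by (metis IntI rangeI)
qed

section \<open>Stable subspaces of an endomorphism\<close>

locale endomorphism = finite_dimensional_vector_space scale Basis
  for scale :: "'a::field \<Rightarrow> 'v::ab_group_add \<Rightarrow> 'v" and Basis :: "'v set" +
  fixes u :: "'v \<Rightarrow> 'v"
  assumes linear_u: "Vector_Spaces.linear scale scale u"
begin

sublocale u: Vector_Spaces.linear scale scale u
  by (rule linear_u)

abbreviation E :: "'a poly \<Rightarrow> 'v \<Rightarrow> 'v" where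
  "E \<equiv> poly_endo scale u"

lemma E_eq_sum:
  assumes "degree f \<le> n"
  shows "E f x = (\<Sum>i\<le>n. scale (coeff f i) ((u ^^ i) x))"
  unfolding poly_endo_def
  by (rule sum.mono_neutral_left) (use assms in \<open>auto simp: coeff_eq_0\<close>)

lemma E_0 [simp]: "E 0 x = 0"
  by (simp add: poly_endo_def)

lemma E_pCons: "E (pCons a f) x = scale a x + u (E f x)"
proof -
  have "degree (pCons a f) \<le> Suc (degree f)" by (rule degree_pCons_le)
  then have "E (pCons a f) x = scale a x + (\<Sum>i\<le>degree f. scale (coeff f i) ((u ^^ Suc i) x))"
    by (subst E_eq_sum, assumption) (simp add: sum.atMost_Suc_shift del: sum.atMost_Suc)
  also have "(\<Sum>i\<le>degree f. scale (coeff f i) ((u ^^ Suc i) x)) = u (E f x)"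
    by (simp add: poly_endo_def u.sum u.scale)
  finally show ?thesis .
qed

lemma E_1 [simp]: "E 1 x = x"
  by (simp add: one_pCons E_pCons)

lemma E_add: "E (f + g) x = E f x + E g x"
proof -
  let ?n = "max (degree f) (degree g)"
  have "E (f + g) x = (\<Sum>i\<le>?n. scale (coeff (f + g) i) ((u ^^ i) x))"
    by (rule E_eq_sum) (rule degree_add_le_max)
  moreover have "E f x = (\<Sum>i\<le>?n. scale (coeff f i) ((u ^^ i) x))"
    by (rule E_eq_sum) simp
  moreover have "E g x = (\<Sum>i\<le>?n. scale (coeff g i) ((u ^^ i) x))"
    by (rule E_eq_sum) simp
  ultimately show ?thesis by (simp add: scale_left_distrib sum.distrib)
qed

lemma E_smult: "E (smult c f) x = scale c (E f x)"
proof -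
  have "E (smult c f) x = (\<Sum>i\<le>degree f. scale (coeff (smult c f) i) ((u ^^ i) x))"
    by (rule E_eq_sum) (rule degree_smult_le)
  then show ?thesis by (simp add: poly_endo_def scale_sum_right)
qed

lemma E_minus: "E (- f) x = - E f x"
  using E_smult[of "- 1" f x] by simp

lemma E_diff: "E (f - g) x = E f x - E g x"
  using E_add[of f "- g" x] by (simp add: E_minus)

lemma E_arg_add: "E f (x + y) = E f x + E f y"
  by (induction f) (simp_all add: E_pCons scale_right_distrib u.add)

lemma E_arg_scale: "E f (scale c x) = scale c (E f x)"
  by (induction f) (simp_all add: E_pCons scale_right_distrib u.scale mult.commute)

lemma linear_E: "Vector_Spaces.linear scale scale (E f)"
  by (simp add: linear_self_iff E_arg_add E_arg_scale)

lemma E_arg_0 [simp]: "E f 0 = 0"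
  using E_arg_scale[of f 0 0] by simp

lemma E_arg_minus: "E f (- x) = - E f x"
  using E_arg_scale[of f "- 1" x] by simp

lemma E_arg_diff: "E f (x - y) = E f x - E f y"
  using E_arg_add[of f x "- y"] by (simp add: E_arg_minus)

lemma E_mult: "E (f * g) x = E f (E g x)"
  by (induction f) (simp_all add: E_pCons mult_pCons_left E_add E_smult)

lemma E_mult_commute: "E f (E g x) = E g (E f x)"
  by (simp flip: E_mult add: mult.commute)

lemma E_power: "E (f ^ n) x = (E f ^^ n) x"
  by (induction n arbitrary: x) (simp_all add: E_mult)

lemma E_t: "E [:0, 1:] x = u x"
  by (simp add: E_pCons)

lemma E_u: "E f (u x) = u (E f x)"
  by (metis E_t E_mult_commute)

lemma E_dvd_zero: "f dvd g \<Longrightarrow> E f x = 0 \<Longrightarrow> E g x = 0"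
  by (auto elim!: dvdE simp: E_mult_commute E_mult)

definition stable :: "'v set \<Rightarrow> bool" where
  "stable S \<longleftrightarrow> subspace S \<and> u ` S \<subseteq> S"

lemma stable_subspace: "stable S \<Longrightarrow> subspace S"
  by (simp add: stable_def)

lemma stable_E: "stable S \<Longrightarrow> x \<in> S \<Longrightarrow> E f x \<in> S"
  by (induction f) (auto simp: E_pCons stable_def subspace_0 subspace_add subspace_scale)

lemma stableI:
  assumes "0 \<in> S" "\<And>x y. x \<in> S \<Longrightarrow> y \<in> S \<Longrightarrow> x + y \<in> S" "\<And>f x. x \<in> S \<Longrightarrow> E f x \<in> S"
  shows "stable S"
proof -
  have "scale c x \<in> S" if "x \<in> S" for c x
    using assms(3)[OF that, of "[:c:]"] by (simp add: E_pCons)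
  moreover have "u x \<in> S" if "x \<in> S" for x
    using assms(3)[OF that, of "[:0, 1:]"] by (simp add: E_t)
  ultimately show ?thesis using assms(1,2) by (auto simp: stable_def subspace_def)
qed

lemma stable_Int: "stable S \<Longrightarrow> stable T \<Longrightarrow> stable (S \<inter> T)"
  by (auto simp: stable_def subspace_inter)

lemma stable_plus:
  assumes "stable S" "stable T"
  shows "stable (S + T)"
proof (rule stableI)
  show "0 \<in> S + T"
    using set_plus_intro[OF subspace_0 subspace_0, of S T] assms by (simp add: stable_def)
  show "x + y \<in> S + T" if "x \<in> S + T" "y \<in> S + T" for x y
    using subspace_add[OF subspace_set_plus that] assms by (simp add: stable_def)
  show "E f x \<in> S + T" if "x \<in> S + T" for f x
    using that assms by (auto elim!: set_plus_elim simp: E_arg_add intro!: set_plus_intro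
        intro: stable_E[of S] stable_E[of T])
qed

lemma stable_kernel: "stable {x. E f x = 0}"
  by (rule stableI) (simp_all add: E_arg_add E_mult_commute[of f])

lemma stable_range: "stable (range (E f))"
proof (rule stableI)
  show "0 \<in> range (E f)" by (metis E_arg_0 rangeI)
  show "x + y \<in> range (E f)" if "x \<in> range (E f)" "y \<in> range (E f)" for x y
    using that by (auto simp flip: E_arg_add)
  show "E g x \<in> range (E f)" if "x \<in> range (E f)" for g x
    using that by (auto simp: E_mult_commute[of g])
qed

definition cyc :: "'v \<Rightarrow> 'v set" where
  "cyc x = range (\<lambda>f. E f x)"

lemma E_in_cyc [simp]: "E f x \<in> cyc x"
  by (simp add: cyc_def)

lemma in_cyc_self [simp]: "x \<in> cyc x"
  using E_in_cyc[of 1 x] by simp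

lemma stable_cyc: "stable (cyc x)"
proof (rule stableI)
  show "0 \<in> cyc x" using E_in_cyc[of 0 x] by simp
  show "y + z \<in> cyc x" if "y \<in> cyc x" "z \<in> cyc x" for y z
    using that by (auto simp: cyc_def simp flip: E_add)
  show "E f y \<in> cyc x" if "y \<in> cyc x" for f y
    using that by (auto simp: cyc_def simp flip: E_mult)
qed

lemma cyc_subset: "stable S \<Longrightarrow> x \<in> S \<Longrightarrow> cyc x \<subseteq> S"
  by (auto simp: cyc_def stable_E)

text \<open>Modulo \<open>D\<close>, the space \<open>cyc x\<close> is a copy of
  \<open>F[t]/(p)\<close>. The filtration \<open>S n\<close> by degree gains one vector at each
  step: otherwise a non-zero polynomial of degree less than \<open>deg p\<close> would send
  \<open>x\<close> into \<open>D\<close>, and Bezout with \<open>p\<close> would put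
  \<open>x\<close> itself in \<open>D\<close>.\<close>

lemma dim_plus_cyc:
  assumes p: "irreducible p" and D: "stable D" and px: "E p x \<in> D" and x: "x \<notin> D"
  shows "dim (D + cyc x) = dim D + degree p"
proof -
  have sD: "subspace D" using D by (rule stable_subspace)
  define P where "P n = {f :: 'a poly. \<forall>i\<ge>n. coeff f i = 0}" for n
  define S where "S n = D + (\<lambda>f. E f x) ` P n" for n
  have S_iff: "y \<in> S n \<longleftrightarrow> (\<exists>f\<in>P n. y - E f x \<in> D)" for y n
  proof
    assume "y \<in> S n"
    then obtain a f where "a \<in> D" "y = a + E f x" "f \<in> P n"
      unfolding S_def by (auto elim!: set_plus_elim)
    then show "\<exists>f\<in>P n. y - E f x \<in> D" by (intro bexI[of _ f]) auto
  next
    assume "\<exists>f\<in>P n. y - E f x \<in> D"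
    then obtain f where f: "f \<in> P n" "y - E f x \<in> D" by blast
    then have "(y - E f x) + E f x \<in> S n" unfolding S_def by (intro set_plus_intro) auto
    then show "y \<in> S n" by simp
  qed
  have subS: "subspace (S n)" for n
    unfolding subspace_def
  proof (intro conjI ballI allI)
    show "0 \<in> S n"
      unfolding S_iff by (rule bexI[of _ 0]) (simp_all add: P_def subspace_0[OF sD])
    show "y + z \<in> S n" if yz: "y \<in> S n" "z \<in> S n" for y z
    proof -
      obtain f g where fg: "f \<in> P n" "y - E f x \<in> D" "g \<in> P n" "z - E g x \<in> D"
        using yz unfolding S_iff by blast
      have "(y + z) - E (f + g) x = (y - E f x) + (z - E g x)" by (simp add: E_add)
      also have "\<dots> \<in> D" using fg sD by (simp only: subspace_add)
      finally show ?thesis using fg unfolding S_iff by (intro bexI[of _ "f + g"]) (auto simp: P_def)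
    qed
    show "scale c y \<in> S n" if y: "y \<in> S n" for c y
    proof -
      obtain f where f: "f \<in> P n" "y - E f x \<in> D" using y unfolding S_iff by blast
      have "scale c y - E (smult c f) x = scale c (y - E f x)"
        by (simp add: E_smult scale_right_diff_distrib)
      also have "\<dots> \<in> D" using f sD by (simp only: subspace_scale)
      finally show ?thesis using f unfolding S_iff by (intro bexI[of _ "smult c f"]) (auto simp: P_def)
    qed
  qed
  have "P 0 = {0}" by (auto simp: P_def poly_eq_iff)
  then have S0: "S 0 = D" by (auto simp: S_def set_plus_def)
  have step: "dim (S (Suc n)) = Suc (dim (S n))" if n: "n < degree p" for n
  proof -
    let ?m = "E (monom 1 n) x"
    have nm: "?m \<notin> S n"
    proof
      assume "?m \<in> S n"
      then obtain f where f: "f \<in> P n" "?m - E f x \<in> D" unfolding S_iff by blast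
      let ?g = "monom 1 n - f"
      have "coeff ?g n = 1" using f by (simp add: P_def)
      then have "?g \<noteq> 0" by (metis coeff_0 zero_neq_one)
      moreover have "degree ?g \<le> n"
        using f by (intro degree_le) (auto simp: P_def)
      ultimately have "\<not> p dvd ?g" using n dvd_imp_degree_le[of p ?g] by linarith
      then obtain a c where ac: "a * p + c * ?g = 1" using irreducible_bezout[OF p] by blast
      have gD: "E ?g x \<in> D" using f(2) by (simp only: E_diff)
      have "x = E (a * p + c * ?g) x" by (simp only: ac E_1)
      also have "\<dots> = E a (E p x) + E c (E ?g x)" by (simp only: E_add E_mult)
      also have "\<dots> \<in> D" using stable_E[OF D px] stable_E[OF D gD] sD by (simp only: subspace_add)
      finally show False using x by simp
    qed
    have "S (Suc n) = span (insert ?m (S n))"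
    proof
      show "S (Suc n) \<subseteq> span (insert ?m (S n))"
      proof
        fix y assume "y \<in> S (Suc n)"
        then obtain f where f: "f \<in> P (Suc n)" "y - E f x \<in> D" unfolding S_iff by blast
        let ?g = "f - monom (coeff f n) n"
        have g: "?g \<in> P n" using f(1) by (auto simp: P_def le_Suc_eq)
        have "monom (coeff f n) n = smult (coeff f n) (monom 1 n)" by (simp add: smult_monom)
        then have "(y - scale (coeff f n) ?m) - E ?g x = y - E f x"
          by (simp add: E_diff E_smult)
        then have "y - scale (coeff f n) ?m \<in> S n" using g f(2) unfolding S_iff by metis
        then have "y - scale (coeff f n) ?m \<in> span (S n)" by (rule span_base)
        then show "y \<in> span (insert ?m (S n))" by (subst span_insert) blast
      qed
      have "P n \<subseteq> P (Suc n)" unfolding P_def by auto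
      then have "S n \<subseteq> S (Suc n)" unfolding S_iff subset_iff by blast
      moreover have "?m \<in> S (Suc n)" unfolding S_iff
        by (rule bexI[of _ "monom 1 n"]) (auto simp: P_def subspace_0[OF sD])
      ultimately show "span (insert ?m (S n)) \<subseteq> S (Suc n)"
        by (intro span_minimal subS) auto
    qed
    then have "dim (S (Suc n)) = dim (insert ?m (S n))" by simp
    then show ?thesis using nm span_eq_iff[THEN iffD2, OF subS[of n]] by (simp add: dim_insert)
  qed
  have "n \<le> degree p \<Longrightarrow> dim (S n) = dim D + n" for n
    by (induction n) (simp_all add: S0 step)
  moreover have "S (degree p) = D + cyc x"
  proof
    show "S (degree p) \<subseteq> D + cyc x"
      unfolding S_def by (intro set_plus_mono2) (auto simp: cyc_def)
    show "D + cyc x \<subseteq> S (degree p)"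
    proof
      fix y assume "y \<in> D + cyc x"
      then obtain z f where zf: "y = z + E f x" "z \<in> D" by (auto elim!: set_plus_elim simp: cyc_def)
      have "E f x = E (f div p * p + f mod p) x" by simp
      also have "\<dots> = E (f div p) (E p x) + E (f mod p) x" by (simp only: E_add E_mult)
      finally have "y - E (f mod p) x = z + E (f div p) (E p x)" using zf by simp
      also have "\<dots> \<in> D" using zf stable_E[OF D px] sD by (simp only: subspace_add)
      finally have "y - E (f mod p) x \<in> D" .
      moreover have "f mod p \<in> P (degree p)"
        using degree_mod_less'[of p f] p
        by (cases "f mod p = 0") (auto simp: P_def irreducible_def intro!: coeff_eq_0)
      ultimately show "y \<in> S (degree p)" unfolding S_iff by blast
    qed
  qed
  ultimately show ?thesis by force
qed

text \<open>The quotient \<open>U/S\<close> is a vector space over \<open>F[t]/(p)\<close> because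
  \<open>p(u)\<close> maps \<open>U\<close> into \<open>S\<close>; \<open>n\<close> is its dimension
  and \<open>G\<close> lifts a basis. Adjoining one cyclic space after another avoids forming the
  quotient.\<close>

lemma exists_stable_generators:
  assumes p: "irreducible p" and S: "stable S" and U: "stable U" "S \<subseteq> U"
    and pU: "\<And>x. x \<in> U \<Longrightarrow> E p x \<in> S"
  shows "\<exists>n G. finite G \<and> G \<subseteq> U \<and> card G \<le> n \<and> dim U = dim S + n * degree p \<and>
    (\<forall>T. stable T \<longrightarrow> S \<subseteq> T \<longrightarrow> G \<subseteq> T \<longrightarrow> U \<subseteq> T)"
  using S U(2) pU
proof (induction "dim U - dim S" arbitrary: S rule: less_induct)
  case less
  show ?case
  proof (cases "S = U")
    case True
    then show ?thesis by (intro exI[of _ 0] exI[of _ "{}"]) simp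
  next
    case False
    then obtain x where x: "x \<in> U" "x \<notin> S" using less.prems by blast
    have dim: "dim (S + cyc x) = dim S + degree p"
      using dim_plus_cyc[OF p less.prems(1) _ x(2)] less.prems(3)[OF x(1)] by blast
    have sub: "S + cyc x \<subseteq> U"
      by (intro set_plus_least stable_subspace U(1) less.prems(2) cyc_subset x(1))
    then have "dim (S + cyc x) \<le> dim U" by (rule dim_subset)
    then have "dim U - dim (S + cyc x) < dim U - dim S"
      using dim degree_irreducible_pos[OF p] by linarith
    moreover have "S \<subseteq> S + cyc x"
      by (rule subset_set_plus_left[OF stable_subspace[OF stable_cyc]])
    ultimately obtain n G where G: "finite G" "G \<subseteq> U" "card G \<le> n"
        "dim U = dim (S + cyc x) + n * degree p"
      and gen: "\<And>T. stable T \<Longrightarrow> S + cyc x \<subseteq> T \<Longrightarrow> G \<subseteq> T \<Longrightarrow> U \<subseteq> T"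
      using less.hyps[OF _ stable_plus[OF less.prems(1) stable_cyc] sub] less.prems(3) by blast
    have "U \<subseteq> T" if T: "stable T" "S \<subseteq> T" "insert x G \<subseteq> T" for T
      using T by (intro gen set_plus_least stable_subspace cyc_subset) auto
    moreover have "card (insert x G) \<le> Suc n" using G(1,3) by (simp add: card_insert_if)
    ultimately show ?thesis using G x(1) dim
      by (intro exI[of _ "Suc n"] exI[of _ "insert x G"]) simp
  qed
qed

lemma dim_stable_diff:
  assumes "irreducible p" "stable S" "stable U" "S \<subseteq> U" "\<And>x. x \<in> U \<Longrightarrow> E p x \<in> S"
  shows "\<exists>n. dim U = dim S + n * degree p"
  using exists_stable_generators[OF assms] by blast

text \<open>Each generator adds at most \<open>deg p\<close> dimensions. Combined with the
  generators above, this makes \<open>n\<close> the least size of a generating set, which is what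
  \<open>vectorspace.dim\<close> means.\<close>

lemma dim_stable_generated_le:
  assumes p: "irreducible p" and S: "stable S" and U: "stable U" "S \<subseteq> U"
    and pU: "\<And>x. x \<in> U \<Longrightarrow> E p x \<in> S" and G: "finite G" "G \<subseteq> U"
  shows "\<exists>T. stable T \<and> S \<subseteq> T \<and> T \<subseteq> U \<and> G \<subseteq> T \<and> dim T \<le> dim S + card G * degree p"
  using G
proof (induction G rule: finite_induct)
  case empty
  then show ?case using S U by (intro exI[of _ S]) simp
next
  case (insert x G)
  then obtain T where T: "stable T" "S \<subseteq> T" "T \<subseteq> U" "G \<subseteq> T" "dim T \<le> dim S + card G * degree p"
    by auto
  show ?case
  proof (cases "x \<in> T")
    case True
    then show ?thesis using T insert.hyps by (intro exI[of _ T]) auto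
  next
    case False
    have "dim (T + cyc x) = dim T + degree p"
      using pU[of x] insert.prems T(2) by (intro dim_plus_cyc[OF p T(1) _ False]) auto
    moreover have "T + cyc x \<subseteq> U"
      using insert.prems by (intro set_plus_least stable_subspace U(1) T(3) cyc_subset) auto
    moreover have "T \<subseteq> T + cyc x" "cyc x \<subseteq> T + cyc x"
      by (rule subset_set_plus_left subset_set_plus_right, intro stable_subspace stable_cyc T(1))+
    moreover have "stable (T + cyc x)" by (intro stable_plus T(1) stable_cyc)
    ultimately show ?thesis using T insert.hyps in_cyc_self[of x]
      by (intro exI[of _ "T + cyc x"]) auto
  qed
qed

section \<open>The spaces \<open>Ker p(u)^k\<close> and their denominators\<close>

lemma primary_kernel_eq: "primary_kernel scale u p k = {x. E (p ^ k) x = 0}"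
  by (simp add: primary_kernel_def E_power)

lemma stable_primary_kernel: "stable (primary_kernel scale u p k)"
  unfolding primary_kernel_eq by (rule stable_kernel)

lemma stable_primary_denominator: "stable (primary_denominator scale u p k)"
  unfolding primary_denominator_def
  by (intro stable_plus stable_Int stable_primary_kernel stable_range)

lemma primary_kernel_mono: "j \<le> k \<Longrightarrow> primary_kernel scale u p j \<subseteq> primary_kernel scale u p k"
  unfolding primary_kernel_eq using E_dvd_zero le_imp_power_dvd by blast

lemma primary_denominator_subset:
  "primary_denominator scale u p k \<subseteq> primary_kernel scale u p k"
  unfolding primary_denominator_def
  by (intro set_plus_least stable_subspace stable_primary_kernel primary_kernel_mono) auto

lemma E_primary_kernel:
  assumes "k \<ge> 1" "x \<in> primary_kernel scale u p k"
  shows "E p x \<in> primary_kernel scale u p (k - 1)"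
proof -
  have "p ^ k = p ^ (k - 1) * p" using assms by (cases k) simp_all
  then show ?thesis using assms by (simp add: primary_kernel_eq E_mult)
qed

lemma primary_kernel_pred_subset:
  "primary_kernel scale u p (k - 1) \<subseteq> primary_denominator scale u p k"
  unfolding primary_denominator_def
  by (intro subset_set_plus_left stable_subspace stable_Int stable_primary_kernel stable_range)

lemma E_primary_denominator:
  "k \<ge> 1 \<Longrightarrow> x \<in> primary_kernel scale u p k \<Longrightarrow> E p x \<in> primary_denominator scale u p k"
  using E_primary_kernel primary_kernel_pred_subset by blast

end

section \<open>Sign maps\<close>

context endomorphism
begin

text \<open>An isotropic stable subspace with property \<open>P\<close>, of maximal dimension,
  cannot be enlarged by a \<open>cyc v\<close>. Two uses are intended: \<open>\<phi> = flip\<close>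
  with \<open>P\<close> the stability under a sign map, and \<open>\<phi>\<close> the identity with
  \<open>P\<close> always true.\<close>

lemma exists_stable_lagrangian:
  assumes K: "stable K" and B: "bilinear_form scale B" and refl: "reflexive_form B"
    and adj: "\<And>f x y. B (E f x) y = B x (E (\<phi> f) y)"
    and P0: "P {0}"
    and extend: "\<And>U z. stable U \<Longrightarrow> P U \<Longrightarrow> U \<subseteq> K \<Longrightarrow> z \<in> K \<Longrightarrow> z \<notin> U \<Longrightarrow> (\<And>y. y \<in> U \<Longrightarrow> B z y = 0) \<Longrightarrow>
      \<exists>v\<in>K. v \<notin> U \<and> (\<forall>y\<in>U. B v y = 0) \<and> (\<forall>f. B v (E f v) = 0) \<and> P (U + cyc v)"
  shows "\<exists>L. stable L \<and> lagrangian B K L"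
proof -
  note bs = bilinear_simps[OF B]
  define Q where "Q U \<longleftrightarrow> stable U \<and> P U \<and> U \<subseteq> K \<and> (\<forall>x\<in>U. \<forall>y\<in>U. B x y = 0)" for U
  have "stable {0}" by (rule stableI) auto
  moreover have "0 \<in> K" using K by (simp add: stable_def subspace_0)
  ultimately have "Q {0}" using P0 by (simp add: Q_def bs)
  moreover have "dim U < Suc (dim UNIV)" for U using dim_subset[OF subset_UNIV, of U] by (simp only: less_Suc_eq_le)
  ultimately obtain U where U: "Q U" "\<And>U'. Q U' \<Longrightarrow> dim U' \<le> dim U"
    using ex_has_greatest_nat[of Q "{0}" dim "Suc (dim UNIV)"] by blast
  have stU: "stable U" and UK: "U \<subseteq> K" and iso: "\<And>x y. x \<in> U \<Longrightarrow> y \<in> U \<Longrightarrow> B x y = 0"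
    using U(1) by (auto simp: Q_def)
  have "z \<in> U" if z: "z \<in> K" "\<And>y. y \<in> U \<Longrightarrow> B z y = 0" for z
  proof (rule ccontr)
    assume nz: "z \<notin> U"
    obtain v where v: "v \<in> K" "v \<notin> U" "\<And>y. y \<in> U \<Longrightarrow> B v y = 0"
      "\<And>f. B v (E f v) = 0" "P (U + cyc v)"
      using extend[OF stU _ UK z(1) nz z(2)] U(1) by (auto simp: Q_def)
    have "B x y = 0" if xy: "x \<in> U + cyc v" "y \<in> U + cyc v" for x y
    proof -
      obtain a f where a: "x = a + E f v" "a \<in> U" using xy(1) by (auto elim!: set_plus_elim simp: cyc_def)
      obtain c g where c: "y = c + E g v" "c \<in> U" using xy(2) by (auto elim!: set_plus_elim simp: cyc_def)
      have "B (E g v) a = 0" using v(3) stable_E[OF stU a(2)] by (simp add: adj)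
      then have "B a (E g v) = 0" using refl by (simp add: reflexive_form_def)
      moreover have "B (E f v) c = 0" using v(3) stable_E[OF stU c(2)] by (simp add: adj)
      moreover have "B (E f v) (E g v) = 0" using v(4) by (simp add: adj flip: E_mult)
      ultimately show ?thesis using iso a c by (simp add: bs)
    qed
    moreover have "U + cyc v \<subseteq> K"
      using v(1) UK by (intro set_plus_least stable_subspace K cyc_subset)
    ultimately have "Q (U + cyc v)" using stable_plus[OF stU stable_cyc] v(5) by (simp add: Q_def)
    then have "dim (U + cyc v) \<le> dim U" by (rule U(2))
    moreover have "U \<subseteq> U + cyc v"
      by (rule subset_set_plus_left[OF stable_subspace[OF stable_cyc]])
    ultimately have "U = U + cyc v"
      using subspace_dim_equal[of U "U + cyc v"] stable_subspace stU stable_plus[OF stU stable_cyc]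
      by blast
    moreover have "v \<in> U + cyc v"
      using subset_set_plus_right[OF stable_subspace[OF stU]] in_cyc_self by blast
    ultimately show False using v(2) by blast
  qed
  then have "lagrangian B K U" using UK iso unfolding lagrangian_def by blast
  then show ?thesis using stU by blast
qed

end

section \<open>Adjoints of polynomials in \<open>u\<close>, and properties of sign maps\<close>

locale skew_pair = endomorphism scale Basis u
  for scale :: "'a::field \<Rightarrow> 'v::ab_group_add \<Rightarrow> 'v" and Basis u +
  fixes b :: "'v \<Rightarrow> 'v \<Rightarrow> 'a"
  assumes char: "CHAR('a) \<noteq> 2"
    and bilinear: "bilinear_form scale b"
    and symmetric: "symmetric_form b"
    and nondegenerate: "nondegenerate_form b"
    and skew: "skew_selfadjoint b u"
begin

lemma two_neq_0: "(2 :: 'a) \<noteq> 0"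
  using char by (rule two_neq_0_of_CHAR)

lemma double_eq_0: "(a :: 'a) = - a \<Longrightarrow> a = 0"
  using two_neq_0 by (metis add.right_inverse mult_2 mult_eq_0_iff)

lemmas b_simps = bilinear_simps[OF bilinear]

lemma b_sym: "b x y = b y x"
  using symmetric by (simp add: symmetric_form_def)

lemma b_nondegenerate: "(\<And>y. b x y = 0) \<Longrightarrow> x = 0"
  using nondegenerate by (simp add: nondegenerate_form_def)

lemma b_u: "b (u x) y = - b x (u y)"
  using skew by (simp add: skew_selfadjoint_def)

lemma reflexive_b: "reflexive_form b"
  using b_sym by (simp add: reflexive_form_def)

lemma b_E: "b (E f x) y = b x (E (flip f) y)"
proof (induction f arbitrary: y)
  case (pCons a f)
  have "flip (pCons a f) = pCons a (- flip f)"
    by (simp add: flip_def pcompose_pCons)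
  then show ?case
    by (simp add: E_pCons b_simps b_u pCons E_minus u.neg E_u)
qed (simp add: b_simps)

lemma b_E_right: "b x (E f y) = b (E (flip f) x) y"
  by (simp add: b_E)

lemma double_annihilator_b:
  assumes "subspace A"
  shows "annihilator b (annihilator b A) = A"
proof -
  have "x = 0" if "x \<in> annihilator b UNIV" for x
    using that by (intro b_nondegenerate) (simp add: annihilator_def)
  then have "UNIV \<inter> annihilator b UNIV \<subseteq> A" using subspace_0[OF assms] by blast
  then show ?thesis
    using double_annihilator[OF subspace_UNIV assms subset_UNIV bilinear reflexive_b] by simp
qed

text \<open>The orthogonal of an image is the kernel of the adjoint; taking orthogonals once more
  gives this form.\<close>

lemma annihilator_kernel_E: "annihilator b {x. E (flip f) x = 0} = range (E f)"
proof -
  have "annihilator b (range (E f)) = {x. E (flip f) x = 0}"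
    using b_nondegenerate by (auto simp: annihilator_def b_E_right b_simps)
  then show ?thesis
    using double_annihilator_b[OF stable_subspace[OF stable_range]] by metis
qed

text \<open>The pairing between \<open>V_{p,k}\<close> and \<open>V_{p(-t),k}\<close> induced by \<open>b\<close> is non-degenerate.\<close>

lemma mem_primary_denominator_iff:
  assumes k: "k \<ge> 1"
  shows "x \<in> primary_denominator scale u p k \<longleftrightarrow>
    x \<in> primary_kernel scale u p k \<and>
    (\<forall>y\<in>primary_kernel scale u (flip p) k. b x (E (flip p ^ (k - 1)) y) = 0)"
    (is "_ \<longleftrightarrow> ?R")
proof
  assume x: "x \<in> primary_denominator scale u p k"
  then obtain a w where aw: "x = a + E p w" "E (p ^ (k - 1)) a = 0"
    unfolding primary_denominator_def by (auto elim!: set_plus_elim simp: primary_kernel_eq)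
  have "b x (E (flip p ^ (k - 1)) y) = 0" if "E (flip p ^ k) y = 0" for y
  proof -
    have "b (E p w) (E (flip p ^ (k - 1)) y) = b w (E (flip p * flip p ^ (k - 1)) y)"
      by (simp add: b_E E_mult)
    also have "flip p * flip p ^ (k - 1) = flip p ^ k" using k by (cases k) simp_all
    finally show ?thesis using that aw by (simp add: b_simps b_E_right flip_power E_arg_add)
  qed
  then show ?R using x primary_denominator_subset by (auto simp: primary_kernel_eq)
next
  assume R: ?R
  let ?A = "primary_kernel scale u p (k - 1) + range (E p)"
  have sub: "subspace ?A"
    by (intro subspace_set_plus stable_subspace stable_primary_kernel stable_range)
  \<comment> \<open>Orthogonality to \<open>Im p(u)\<close> and to \<open>Ker p(u)^(k-1)\<close>
    puts \<open>z\<close> in \<open>Ker p(-u)\<close> and in \<open>Im p(-u)^(k-1)\<close>. Thus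
    \<open>z = p(-u)^(k-1) y\<close> with \<open>y\<close> in \<open>Ker p(-u)^k\<close>, where the
    condition on \<open>x\<close> applies.\<close>
  have "b x z = 0" if z: "z \<in> annihilator b ?A" for z
  proof -
    have "z \<in> annihilator b (range (E p))" "z \<in> annihilator b (primary_kernel scale u p (k - 1))"
      using z subset_set_plus_right[of "primary_kernel scale u p (k - 1)" "range (E p)"]
        subset_set_plus_left[of "range (E p)" "primary_kernel scale u p (k - 1)"]
        stable_subspace stable_primary_kernel stable_range
      unfolding annihilator_def by blast+
    then have pz: "E (flip p) z = 0" and "z \<in> range (E (flip (p ^ (k - 1))))"
      using annihilator_kernel_E[of "flip (p ^ (k - 1))"] b_nondegenerate
      by (auto simp: annihilator_def b_E_right primary_kernel_eq)
    then obtain y where y: "z = E (flip p ^ (k - 1)) y" by (auto simp: flip_power)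
    have "flip p * flip p ^ (k - 1) = flip p ^ k" using k by (cases k) simp_all
    then have "E (flip p ^ k) y = 0" using pz y by (metis E_mult)
    then show ?thesis using R y by (simp add: primary_kernel_eq)
  qed
  then have "x \<in> ?A"
    using double_annihilator_b[OF sub] by (auto simp: annihilator_def)
  then obtain a c where ac: "x = a + c" "a \<in> primary_kernel scale u p (k - 1)" "c \<in> range (E p)"
    by (auto elim!: set_plus_elim)
  \<comment> \<open>The double orthogonal only gives \<open>x\<close> in
    \<open>Ker p(u)^(k-1) + Im p(u)\<close>; the second component lies in \<open>Ker p(u)^k\<close>
    because \<open>x\<close> and \<open>a\<close> do.\<close>
  have "c = x - a" using ac by simp
  also have "\<dots> \<in> primary_kernel scale u p k"
    using R ac(2) primary_kernel_mono[of "k - 1" k p] stable_subspace[OF stable_primary_kernel]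
    by (auto intro: subspace_diff)
  finally show "x \<in> primary_denominator scale u p k"
    unfolding primary_denominator_def using ac by (auto intro: set_plus_intro)
qed

text \<open>A sign map encodes a splitting of its range into two totally isotropic eigenspaces (for the
  eigenvalues \<open>1\<close> and \<open>-1\<close>) exchanged by \<open>u\<close>; it vanishes on the orthogonal complement.\<close>

definition sign_map :: "('v \<Rightarrow> 'v) \<Rightarrow> bool" where
  "sign_map s \<longleftrightarrow> Vector_Spaces.linear scale scale s \<and> (\<forall>x. s (u x) = - u (s x)) \<and>
     (\<forall>x. s (s (s x)) = s x) \<and> (\<forall>x y. b (s x) y = - b x (s y))"

context
  fixes s
  assumes s: "sign_map s"
begin

lemma sign_map_linear:
  "s (x + y) = s x + s y" "s (scale c x) = scale c (s x)" "s 0 = 0" "s (- x) = - s x"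
  "s (x - y) = s x - s y"
proof -
  interpret s: Vector_Spaces.linear scale scale s using s by (simp add: sign_map_def)
  show "s (x + y) = s x + s y" "s (scale c x) = scale c (s x)" "s 0 = 0" "s (- x) = - s x"
    "s (x - y) = s x - s y"
    by (rule s.add s.scale s.zero s.neg s.diff)+
qed

lemma sign_map_cube: "s (s (s x)) = s x"
  and sign_map_skew: "b (s x) y = - b x (s y)"
  and sign_map_u: "s (u x) = - u (s x)"
  using s by (auto simp: sign_map_def)

lemma sign_map_range: "x \<in> range s \<Longrightarrow> s (s x) = x"
  by (auto simp: sign_map_cube)

lemma sign_map_E: "s (E f x) = E (flip f) (s x)"
proof (induction f)
  case (pCons a f)
  have "flip (pCons a f) = pCons a (- flip f)"
    by (simp add: flip_def pcompose_pCons)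
  then show ?case
    by (simp add: E_pCons sign_map_linear sign_map_u pCons E_minus u.neg)
qed (simp add: sign_map_linear)

lemma stable_range_sign_map: "stable (range s)"
proof (rule stableI)
  show "0 \<in> range s" by (metis sign_map_linear(3) rangeI)
  show "x + y \<in> range s" if "x \<in> range s" "y \<in> range s" for x y
    using that by (auto simp flip: sign_map_linear)
  show "E f x \<in> range s" if "x \<in> range s" for f x
    using that sign_map_E[of "flip f"] by (metis flip_flip imageE rangeI)
qed

lemma stable_ker_sign_map: "stable {x. s x = 0}"
  by (rule stableI) (simp_all add: sign_map_linear sign_map_E)

lemma sign_map_orthogonal: "s x = 0 \<Longrightarrow> y \<in> range s \<Longrightarrow> b x y = 0"
  using sign_map_skew by (auto simp: b_simps) (metis bilinear_zero_left[OF bilinear] neg_equal_0_iff_equal)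

text \<open>\<open>s^2\<close> is the projection onto \<open>range s\<close> along the kernel of
  \<open>s\<close>. Closure is required under \<open>s^2\<close> only, since \<open>s\<close> itself
  maps \<open>Ker p(u)^k\<close> to \<open>Ker p(-u)^k\<close>.\<close>

lemma sign_map_split:
  assumes S: "subspace S" and closed: "\<And>x. x \<in> S \<Longrightarrow> s (s x) \<in> S"
  shows "S = (S \<inter> range s) + (S \<inter> {x. s x = 0})"
    and "dim S = dim (S \<inter> range s) + dim (S \<inter> {x. s x = 0})"
proof -
  have sub: "subspace (S \<inter> range s)" "subspace (S \<inter> {x. s x = 0})"
    using S stable_range_sign_map stable_ker_sign_map by (auto intro: subspace_inter stable_subspace)
  show eq: "S = (S \<inter> range s) + (S \<inter> {x. s x = 0})"
  proof
    show "S \<subseteq> (S \<inter> range s) + (S \<inter> {x. s x = 0})"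
    proof
      fix x assume x: "x \<in> S"
      have "s (s x) + (x - s (s x)) \<in> (S \<inter> range s) + (S \<inter> {x. s x = 0})"
        using x closed[OF x] S by (intro set_plus_intro) (auto simp: sign_map_linear sign_map_cube subspace_diff)
      then show "x \<in> (S \<inter> range s) + (S \<inter> {x. s x = 0})" by simp
    qed
  qed (use S in \<open>intro set_plus_least; blast\<close>)
  have "(S \<inter> range s) \<inter> (S \<inter> {x. s x = 0}) = {0}"
  proof (intro equalityI subsetI)
    fix x assume x: "x \<in> (S \<inter> range s) \<inter> (S \<inter> {x. s x = 0})"
    then have "s x = 0" "s (s x) = x" using sign_map_range by blast+
    then show "x \<in> {0}" by (simp add: sign_map_linear)
  next
    fix x :: 'v assume "x \<in> {0}"
    moreover have "0 \<in> range s" using sign_map_linear(3) by (metis rangeI)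
    ultimately show "x \<in> (S \<inter> range s) \<inter> (S \<inter> {x. s x = 0})"
      using S by (simp add: sign_map_linear subspace_0)
  qed
  then show "dim S = dim (S \<inter> range s) + dim (S \<inter> {x. s x = 0})"
    using dim_set_plus[OF sub] eq by simp
qed

lemma sign_map_primary_kernel: "x \<in> primary_kernel scale u p k \<Longrightarrow> s x \<in> primary_kernel scale u (flip p) k"
  by (simp add: primary_kernel_eq flip: flip_power) (simp flip: sign_map_E add: sign_map_linear)

lemma sign_map_square_E: "s (s (E f x)) = E f (s (s x))"
  by (simp add: sign_map_E)

lemma sign_map_square_primary_kernel:
  "x \<in> primary_kernel scale u p k \<Longrightarrow> s (s x) \<in> primary_kernel scale u p k"
  using sign_map_primary_kernel[of "s x" "flip p"] sign_map_primary_kernel[of x p] by simp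

lemma sign_map_square_primary_denominator:
  "x \<in> primary_denominator scale u p k \<Longrightarrow> s (s x) \<in> primary_denominator scale u p k"
  unfolding primary_denominator_def
  by (auto elim!: set_plus_elim simp: sign_map_linear sign_map_square_E
      intro!: set_plus_intro sign_map_square_primary_kernel)
    (metis sign_map_square_E sign_map_square_primary_kernel)

lemma exists_lagrangian_even:
  fixes p :: "'a poly" and k :: nat
  assumes p: "flip p = p"
  defines "B \<equiv> \<lambda>x y. b x (E (p ^ (k - 1)) y)"
  shows "\<exists>L. stable L \<and> lagrangian B (primary_kernel scale u p k \<inter> range s) L"
proof (rule exists_stable_lagrangian[where P = "\<lambda>U. s ` U \<subseteq> U" and \<phi> = flip])
  let ?K = "primary_kernel scale u p k \<inter> range s"
  show "stable ?K" by (intro stable_Int stable_primary_kernel stable_range_sign_map)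
  show bil: "bilinear_form scale B" unfolding B_def by (rule bilinear_form_compose[OF bilinear linear_E])
  have sym: "B x y = B y x" for x y
  proof -
    have "b x (E (p ^ (k - 1)) y) = b (E (p ^ (k - 1)) x) y"
      by (simp add: b_E_right p flip_power)
    also have "\<dots> = b y (E (p ^ (k - 1)) x)" by (rule b_sym)
    finally show ?thesis by (simp only: B_def)
  qed
  show "reflexive_form B" unfolding reflexive_form_def using sym by metis
  show adj: "B (E f x) y = B x (E (flip f) y)" for f x y
    by (simp add: B_def b_E E_mult_commute)
  show "s ` {0} \<subseteq> {0}" by (simp add: sign_map_linear)
  note bs = bilinear_simps[OF bil]
  fix U z
  assume U: "stable U" "s ` U \<subseteq> U" "U \<subseteq> ?K" and z: "z \<in> ?K" "z \<notin> U" "\<And>y. y \<in> U \<Longrightarrow> B z y = 0"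
  have Bs: "B (s x) y = - B x (s y)" for x y
    by (simp add: B_def sign_map_skew sign_map_E p flip_power)
  have ssz: "s (s z) = z" using z(1) sign_map_range by blast
  have subU: "subspace U" using U(1) by (rule stable_subspace)
  have szK: "s z \<in> ?K" using z(1) sign_map_primary_kernel[of z p k] p by simp
  have szU: "B (s z) y = 0" if "y \<in> U" for y
    using z(3)[of "s y"] that U(2) by (auto simp: Bs)
  \<comment> \<open>As 2 is invertible, \<open>z\<close> is a combination of \<open>z + s z\<close>
    and \<open>z - s z\<close>, so one of these two eigenvectors of \<open>s\<close> is outside
    \<open>U\<close>.\<close>
  have "\<not> (z + s z \<in> U \<and> z - s z \<in> U)"
  proof
    assume "z + s z \<in> U \<and> z - s z \<in> U"
    then have "(z + s z) + (z - s z) \<in> U" using subspace_add[OF subU] by blast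
    moreover have "(z + s z) + (z - s z) = scale 2 z"
      using scale_left_distrib[of 1 1 z] by simp
    ultimately have "scale (1 / 2) (scale 2 z) \<in> U" by (simp only: subspace_scale[OF subU])
    then show False using z(2) two_neq_0 by simp
  qed
  moreover have "subspace ?K"
    by (intro stable_subspace stable_Int stable_primary_kernel stable_range_sign_map)
  ultimately obtain v where v: "v \<notin> U" "v \<in> ?K" "\<And>y. y \<in> U \<Longrightarrow> B v y = 0" "s v = v \<or> s v = - v"
  proof -
    assume *: "\<And>v. v \<notin> U \<Longrightarrow> v \<in> ?K \<Longrightarrow> (\<And>y. y \<in> U \<Longrightarrow> B v y = 0) \<Longrightarrow> s v = v \<or> s v = - v \<Longrightarrow> thesis"
    assume K: "subspace ?K"
    assume "\<not> (z + s z \<in> U \<and> z - s z \<in> U)"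
    then show thesis
    proof (cases "z + s z \<in> U")
      case False
      then show thesis using K szK z szU
        by (intro *[of "z + s z"]) (simp_all add: subspace_add bs sign_map_linear ssz add.commute del: Int_iff)
    next
      case True
      then show thesis using K szK z szU \<open>\<not> (z + s z \<in> U \<and> z - s z \<in> U)\<close>
        by (intro *[of "z - s z"]) (simp_all add: subspace_diff bs sign_map_linear ssz del: Int_iff)
    qed
  qed
  have Bv: "B v (E f v) = 0" for f
  proof -
    have ssv: "s (s v) = v" using v(2) sign_map_range by blast
    \<comment> \<open>The two signs cancel whichever eigenvalue \<open>v\<close> has. Moving
      \<open>s\<close> across then yields a minus sign, whereas adjunction and symmetry yield
      none.\<close>
    have "B v (E (flip f) v) = B (s v) (E (flip f) (s v))" using v(4) by (auto simp: bs E_arg_minus)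
    also have "\<dots> = - B v (E f v)" by (simp add: Bs sign_map_E ssv)
    finally have "B (E f v) v = - B v (E f v)" by (simp add: adj)
    then show ?thesis using sym double_eq_0 by metis
  qed
  have "s ` (U + cyc v) \<subseteq> U + cyc v"
  proof
    fix w assume "w \<in> s ` (U + cyc v)"
    then obtain a f where a: "w = s a + E (flip f) (s v)" "a \<in> U"
      by (auto elim!: set_plus_elim simp: cyc_def sign_map_linear sign_map_E)
    have "E (flip f) (s v) \<in> cyc v"
      using v(4) by (auto simp: E_arg_minus simp flip: E_minus)
    then show "w \<in> U + cyc v" using a U(2) by (auto intro: set_plus_intro)
  qed
  then show "\<exists>v\<in>?K. v \<notin> U \<and> (\<forall>y\<in>U. B v y = 0) \<and> (\<forall>f. B v (E f v) = 0) \<and> s ` (U + cyc v) \<subseteq> U + cyc v"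
    using v Bv by blast
qed

text \<open>\<open>(x, y) \<mapsto> b(x, s y)\<close> is alternating and \<open>u\<close> is selfadjoint for it, which forces all
  elementary divisors to have even multiplicity.\<close>

lemma dim_primary_range_even:
  assumes p: "irreducible p" and k: "k \<ge> 1"
  shows "\<exists>n. dim (primary_kernel scale u p k \<inter> range s) =
    dim (primary_denominator scale u p k \<inter> range s) + 2 * n * degree p"
proof -
  let ?K = "primary_kernel scale u p k \<inter> range s"
  let ?D = "primary_denominator scale u p k \<inter> range s"
  define C where "C x y = b x (s (E (p ^ (k - 1)) y))" for x y
  have stK: "stable ?K" by (intro stable_Int stable_primary_kernel stable_range_sign_map)
  have stD: "stable ?D" by (intro stable_Int stable_primary_denominator stable_range_sign_map)
  have "Vector_Spaces.linear scale scale (\<lambda>y. s (E (p ^ (k - 1)) y))"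
    by (simp add: linear_self_iff E_arg_add E_arg_scale sign_map_linear)
  from bilinear_form_compose[OF bilinear this] have bil: "bilinear_form scale C"
    unfolding C_def .
  have adj: "C (E f x) y = C x (E f y)" for f x y
    by (simp add: C_def b_E sign_map_E E_mult_commute)
  have alt: "C x y = - C y x" for x y
  proof -
    have "C x y = - b (s x) (E (p ^ (k - 1)) y)" by (simp add: C_def sign_map_skew)
    also have "\<dots> = - b (s (E (p ^ (k - 1)) x)) y" by (simp add: b_E_right sign_map_E)
    also have "\<dots> = - C y x" unfolding C_def b_sym[of y] ..
    finally show ?thesis .
  qed
  then have refl: "reflexive_form C" unfolding reflexive_form_def by (metis neg_equal_0_iff_equal)
  have "\<exists>L. stable L \<and> lagrangian C ?K L"
  proof (rule exists_stable_lagrangian[where P = "\<lambda>_. True" and \<phi> = "\<lambda>f. f"])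
    show "stable ?K" "bilinear_form scale C" "reflexive_form C" by fact+
    show "C (E f x) y = C x (E f y)" for f x y by (rule adj)
    show True ..
    fix U z
    assume U: "z \<in> ?K" "z \<notin> U" "\<And>y. y \<in> U \<Longrightarrow> C z y = 0"
    moreover have "C z (E f z) = 0" for f
      using alt[of z "E f z"] unfolding adj by (rule double_eq_0)
    ultimately show "\<exists>v\<in>?K. v \<notin> U \<and> (\<forall>y\<in>U. C v y = 0) \<and> (\<forall>f. C v (E f v) = 0) \<and> True"
      by blast
  qed
  then obtain L where L: "stable L" "lagrangian C ?K L" by blast
  have rad: "?K \<inter> annihilator C ?K = ?D"
  proof (intro equalityI subsetI)
    fix x assume x: "x \<in> ?K \<inter> annihilator C ?K"
    \<comment> \<open>\<open>s y\<close> lies in \<open>Ker p(u)^k\<close>, and testing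
      \<open>x\<close> with \<open>C\<close> against such vectors amounts to testing it with
      \<open>b\<close> against \<open>Ker p(-u)^k\<close>, which is the criterion for the
      denominator.\<close>
    have "b x (E (flip p ^ (k - 1)) y) = 0" if y: "y \<in> primary_kernel scale u (flip p) k" for y
    proof -
      have "s y \<in> ?K" using sign_map_primary_kernel[OF y] by simp
      then have "0 = b x (s (E (p ^ (k - 1)) (s y)))" using x by (simp add: annihilator_def C_def)
      also have "\<dots> = b (s (s x)) (E (flip p ^ (k - 1)) y)"
        by (simp add: sign_map_skew sign_map_E flip_power)
      also have "s (s x) = x" using x sign_map_range by blast
      finally show ?thesis by simp
    qed
    then show "x \<in> ?D" using x mem_primary_denominator_iff[OF k] by blast
  next
    fix x assume x: "x \<in> ?D"
    have "C x y = 0" if y: "y \<in> ?K" for y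
      using x y sign_map_primary_kernel[of y p k] mem_primary_denominator_iff[OF k, of x p]
      by (simp add: C_def sign_map_E flip_power)
    then show "x \<in> ?K \<inter> annihilator C ?K"
      using x primary_denominator_subset by (auto simp: annihilator_def)
  qed
  \<comment> \<open>With \<open>dim L = dim ?D + n * degree p\<close>, the difference between
    \<open>?K\<close> and \<open>?D\<close> becomes twice \<open>n * degree p\<close>; the factor 2
    is that of a Lagrangian.\<close>
  have "2 * dim L = dim ?K + dim ?D"
    using dim_lagrangian[OF stable_subspace[OF stK] bil refl L(2)] rad by simp
  moreover have "?D \<subseteq> L"
    using L(2) rad unfolding lagrangian_def annihilator_def by blast
  then obtain n where "dim L = dim ?D + n * degree p"
    using dim_stable_diff[OF p stD L(1)] lagrangian_subset[OF L(2)] E_primary_denominator[OF k]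
      stable_E[OF stable_range_sign_map] by (metis (no_types, lifting) Int_iff subset_iff)
  ultimately have "dim ?K = dim ?D + 2 * n * degree p" by simp
  then show ?thesis by blast
qed

text \<open>\<open>Ker p(u)^k\<close> and its denominator both split along \<open>s^2\<close>, so
  multiplicities add up; the total and the part on \<open>range s\<close> are even.\<close>

lemma dim_primary_ker_even:
  assumes p: "irreducible p" and k: "k \<ge> 1"
    and V: "dim (primary_kernel scale u p k) = dim (primary_denominator scale u p k) + 2 * n * degree p"
  shows "\<exists>m. dim (primary_kernel scale u p k \<inter> {x. s x = 0}) =
    dim (primary_denominator scale u p k \<inter> {x. s x = 0}) + 2 * m * degree p"
proof -
  let ?K = "primary_kernel scale u p k" and ?D = "primary_denominator scale u p k"
  obtain n' where n': "dim (?K \<inter> range s) = dim (?D \<inter> range s) + 2 * n' * degree p"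
    using dim_primary_range_even[OF p k] by blast
  have K: "dim ?K = dim (?K \<inter> range s) + dim (?K \<inter> {x. s x = 0})"
    by (rule sign_map_split(2)[OF stable_subspace[OF stable_primary_kernel] sign_map_square_primary_kernel])
  have D: "dim ?D = dim (?D \<inter> range s) + dim (?D \<inter> {x. s x = 0})"
    by (rule sign_map_split(2)[OF stable_subspace[OF stable_primary_denominator]
          sign_map_square_primary_denominator])
  have "dim (?D \<inter> {x. s x = 0}) \<le> dim (?K \<inter> {x. s x = 0})"
    using primary_denominator_subset by (intro dim_subset) blast
  then have "dim (?K \<inter> {x. s x = 0}) = dim (?D \<inter> {x. s x = 0}) + (2 * n * degree p - 2 * n' * degree p)"
    using V n' K D by linarith
  then have "dim (?K \<inter> {x. s x = 0}) = dim (?D \<inter> {x. s x = 0}) + 2 * (n - n') * degree p"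
    by (simp add: diff_mult_distrib diff_mult_distrib2)
  then show ?thesis by blast
qed

end

end

section \<open>Constructing sign maps\<close>

context endomorphism
begin

lemma exists_annihilating_poly: "\<exists>f. f \<noteq> 0 \<and> E f v = 0"
proof -
  let ?w = "\<lambda>i. (u ^^ i) v" and ?I = "{..dim UNIV}"
  have E_monom: "E (monom c i) v = scale c (?w i)" for c i
    by (induction i) (simp_all add: monom_0 monom_Suc E_pCons u.scale)
  have E_sum: "E (sum h A) v = (\<Sum>i\<in>A. E (h i) v)" for h and A :: "nat set"
    by (induction A rule: infinite_finite_induct) (simp_all add: E_add)
  show ?thesis
  \<comment> \<open>Linear dependence is a property of sets, so a repetition among the
    \<open>dim V + 1\<close> iterates is treated apart; it yields \<open>t^i - t^j\<close>.\<close>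
  proof (cases "inj_on ?w ?I")
    case False
    then obtain i j where ij: "i \<noteq> j" "?w i = ?w j" by (auto simp: inj_on_def)
    let ?f = "monom (1 :: 'a) i - monom 1 j"
    have "?f \<noteq> 0"
    proof
      assume "?f = 0"
      then have "coeff ?f i = 0" by (simp only: coeff_0)
      then show False using ij by simp
    qed
    moreover have "E ?f v = 0" using ij by (simp add: E_diff E_monom)
    ultimately show ?thesis by blast
  next
    case True
    have "dependent (?w ` ?I)"
    proof (rule ccontr)
      assume "independent (?w ` ?I)"
      then have "card (?w ` ?I) \<le> dim UNIV" by (intro independent_card_le_dim) auto
      then show False using True by (simp add: card_image)
    qed
    then obtain c j where c: "j \<in> ?I" "c (?w j) \<noteq> 0" "(\<Sum>x\<in>?w ` ?I. scale (c x) x) = 0"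
      by (auto simp: dependent_finite)
    let ?f = "\<Sum>i\<in>?I. monom (c (?w i)) i"
    have "coeff ?f j = c (?w j)" using c(1) by (simp add: coeff_sum)
    then have "?f \<noteq> 0" using c(2) by (metis coeff_0)
    moreover have "E ?f v = 0" using c(3) True by (simp add: E_sum E_monom sum.reindex)
    ultimately show ?thesis by blast
  qed
qed

text \<open>Among the non-zero polynomials killing a non-zero vector of \<open>S\<close>, one of
  least degree is irreducible: if \<open>a * c\<close> kills \<open>x\<close>, then \<open>c\<close>
  kills \<open>x\<close> or \<open>a\<close> kills the non-zero vector
  \<open>c(u) x\<close>.\<close>

lemma exists_irreducible_annihilator:
  assumes S: "stable S" and v: "v \<in> S" "v \<noteq> 0"
  shows "\<exists>p\<in>Irr. \<exists>x\<in>S. x \<noteq> 0 \<and> E p x = 0"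
proof -
  define Q where "Q f \<longleftrightarrow> f \<noteq> 0 \<and> (\<exists>x\<in>S. x \<noteq> 0 \<and> E f x = 0)" for f
  obtain f0 where "Q f0" using exists_annihilating_poly v unfolding Q_def by blast
  then obtain f where f: "Q f" "\<And>g. Q g \<Longrightarrow> degree f \<le> degree g"
    using ex_has_least_nat[of Q f0 degree] by blast
  then obtain x where x: "x \<in> S" "x \<noteq> 0" "E f x = 0" and "f \<noteq> 0" by (auto simp: Q_def)
  have irr: "irreducible f"
  proof (rule irreducibleI)
    show "f \<noteq> 0" by fact
    show "\<not> f dvd 1"
    proof
      assume "f dvd 1"
      then have "E 1 x = 0" using x(3) by (rule E_dvd_zero)
      then show False using x(2) by simp
    qed
    fix a c assume ac: "f = a * c"
    then have nz: "a \<noteq> 0" "c \<noteq> 0" using \<open>f \<noteq> 0\<close> by auto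
    then have deg: "degree f = degree a + degree c" using ac by (simp add: degree_mult_eq)
    show "a dvd 1 \<or> c dvd 1"
    proof (cases "E c x = 0")
      case True
      then have "Q c" using nz x unfolding Q_def by blast
      then have "degree a = 0" using f(2)[of c] deg by simp
      then show ?thesis using nz is_unit_iff_degree by blast
    next
      case False
      moreover have "E a (E c x) = 0" using x(3) ac by (simp add: E_mult)
      ultimately have "Q a" using nz stable_E[OF S x(1)] unfolding Q_def by blast
      then have "degree c = 0" using f(2)[of a] deg by simp
      then show ?thesis using nz is_unit_iff_degree by blast
    qed
  qed
  let ?c = "inverse (lead_coeff f)"
  have c: "?c \<noteq> 0" using \<open>f \<noteq> 0\<close> by simp
  have "irreducible (smult ?c f)"
  proof (rule irreducibleI)
    show "smult ?c f \<noteq> 0" "\<not> smult ?c f dvd 1" using irr c by (auto simp: irreducible_def smult_dvd_iff)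
    fix a d assume "smult ?c f = a * d"
    then have "f = smult (lead_coeff f) (a * d)" using \<open>f \<noteq> 0\<close>
      by (metis (no_types, lifting) c field_class.field_inverse inverse_inverse_eq leading_coeff_0_iff
          mult.commute smult_1_left smult_smult)
    then have "f = smult (lead_coeff f) a * d" by simp
    then show "a dvd 1 \<or> d dvd 1"
      using irreducibleD[OF irr] \<open>f \<noteq> 0\<close> by (metis leading_coeff_0_iff smult_dvd_iff)
  qed
  then have "smult ?c f \<in> Irr" using \<open>f \<noteq> 0\<close> by (simp add: Irr_def)
  moreover have "E (smult ?c f) x = 0" using x by (simp add: E_smult)
  ultimately show ?thesis using x by blast
qed

text \<open>The kernels of the powers of \<open>p(u)\<close> in \<open>S\<close> cannot grow for
  ever. The first exponent where they stop is the \<open>k\<close> sought, and it is positive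
  because of \<open>v\<close>.\<close>

lemma exists_maximal_exponent:
  assumes S: "stable S" and v: "v \<in> S" "v \<noteq> 0" "E p v = 0"
  shows "\<exists>k\<ge>1. \<exists>x\<in>S. E (p ^ k) x = 0 \<and> E (p ^ (k - 1)) x \<noteq> 0 \<and>
    (\<forall>y\<in>S. E (p ^ Suc k) y = 0 \<longrightarrow> E (p ^ k) y = 0)"
proof -
  define T where "T j \<longleftrightarrow> (\<forall>y\<in>S. E (p ^ Suc j) y = 0 \<longrightarrow> E (p ^ j) y = 0)" for j
  let ?K = "\<lambda>j. S \<inter> {y. E (p ^ j) y = 0}"
  have subK: "subspace (?K j)" for j
    by (intro stable_subspace stable_Int S stable_kernel)
  have "\<exists>j. T j"
  proof (rule ccontr)
    assume nT: "\<nexists>j. T j"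
    have "j \<le> dim (?K j)" for j
    proof (induction j)
      case (Suc j)
      have sub: "?K j \<subseteq> ?K (Suc j)" by (auto simp: E_mult)
      obtain y where "y \<in> ?K (Suc j)" "y \<notin> ?K j" using nT unfolding T_def by blast
      then have "dim (?K j) \<noteq> dim (?K (Suc j))"
        using subspace_dim_equal[OF subK subK sub] by auto
      then show ?case using Suc dim_subset[OF sub] by linarith
    qed simp
    from this[of "Suc (dim UNIV)"] show False
      using dim_subset[OF subset_UNIV, of "?K (Suc (dim UNIV))"] by linarith
  qed
  then obtain k where k: "T k" "\<And>j. j < k \<Longrightarrow> \<not> T j"
    using exists_least_iff[of T] by blast
  have "\<not> T 0" using v unfolding T_def by auto
  then have "k \<ge> 1" using k(1) by (cases k) auto
  then have "\<not> T (k - 1)" by (intro k(2)) simp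
  then show ?thesis using k(1) \<open>k \<ge> 1\<close> unfolding T_def by (intro exI[of _ k]) auto
qed

end

section \<open>Sign maps from relations and from generators\<close>

context skew_pair
begin

text \<open>\<open>V\<close> is the direct sum of the domain of \<open>G\<close> and its orthogonal;
  the map is given by \<open>G\<close> on the former and zero on the latter. An ambiguity in
  \<open>G\<close> produces a pair \<open>(d, 0)\<close>, and \<open>Gb\<close> then makes
  \<open>d\<close> orthogonal to the whole domain.\<close>

lemma sign_map_of_relation:
  fixes G :: "('v \<times> 'v) set"
  assumes G0: "(0, 0) \<in> G"
    and Gadd: "\<And>x y x' y'. (x, y) \<in> G \<Longrightarrow> (x', y') \<in> G \<Longrightarrow> (x + x', y + y') \<in> G"
    and Gscale: "\<And>c x y. (x, y) \<in> G \<Longrightarrow> (scale c x, scale c y) \<in> G"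
    and Gsym: "\<And>x y. (x, y) \<in> G \<Longrightarrow> (y, x) \<in> G"
    and Gu: "\<And>x y. (x, y) \<in> G \<Longrightarrow> (u x, - u y) \<in> G"
    and Gb: "\<And>x y x' y'. (x, y) \<in> G \<Longrightarrow> (x', y') \<in> G \<Longrightarrow> b x x' = - b y y'"
    and nondeg: "\<And>x. x \<in> Domain G \<Longrightarrow> (\<And>y. y \<in> Domain G \<Longrightarrow> b x y = 0) \<Longrightarrow> x = 0"
  shows "\<exists>s. sign_map s \<and> range s = Domain G"
proof -
  let ?W = "Domain G"
  let ?O = "annihilator b ?W"
  have W: "subspace ?W"
    unfolding subspace_def using G0 Gadd Gscale by (auto simp: Domain_iff) blast+
  have O: "subspace ?O" by (rule subspace_annihilator[OF bilinear])
  have WO: "?W \<inter> ?O = {0}"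
    using nondeg subspace_0[OF W] subspace_0[OF O] by (auto simp: annihilator_def)
  have "x = 0" if "x \<in> annihilator b UNIV" for x
    using that by (intro b_nondegenerate) (simp add: annihilator_def)
  then have rad: "UNIV \<inter> annihilator b UNIV = {0}"
    using subspace_0[OF subspace_annihilator[OF bilinear]] by blast
  then have "dim ?O + dim ?W = dim UNIV"
    using dim_annihilator_reflexive[OF subspace_UNIV W subset_UNIV bilinear reflexive_b]
      subspace_0[OF W] by (simp del: dim_UNIV)
  then have "dim (?W + ?O) = dim UNIV"
    using dim_set_plus[OF W O] WO by (simp del: dim_UNIV)
  then have total: "?W + ?O = UNIV"
    by (intro subspace_dim_equal[OF subspace_set_plus[OF W O] subspace_UNIV]) simp_all
  have fn: "y = y'" if "(x, y) \<in> G" "(x, y') \<in> G" for x y y'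
  proof -
    have "(scale (- 1) x, scale (- 1) y') \<in> G" using that(2) by (rule Gscale)
    from Gadd[OF that(1) this] have d: "(y - y', 0) \<in> G" by (auto dest: Gsym)
    have "y - y' = 0"
    proof (rule nondeg)
      show "y - y' \<in> ?W" using d by blast
      fix z assume "z \<in> ?W"
      then obtain z' where "(z, z') \<in> G" by blast
      from Gb[OF d this] show "b (y - y') z = 0" by (simp add: b_simps)
    qed
    then show ?thesis by simp
  qed
  define R where "R x y \<longleftrightarrow> (\<exists>w. x - w \<in> ?O \<and> (w, y) \<in> G)" for x y
  have R_fun: "y = y'" if Rxy: "R x y" "R x y'" for x y y'
  proof -
    obtain w w' where w: "x - w \<in> ?O" "(w, y) \<in> G" "x - w' \<in> ?O" "(w', y') \<in> G"
      using Rxy unfolding R_def by blast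
    have "w - w' = (x - w') - (x - w)" by simp
    also have "\<dots> \<in> ?O" by (rule subspace_diff[OF O w(3,1)])
    finally have "w - w' \<in> ?W \<inter> ?O" using w subspace_diff[OF W] by blast
    then have "w = w'" using WO by simp
    then show ?thesis using fn w by blast
  qed
  have R_ex: "\<exists>y. R x y" for x
  proof -
    have "x \<in> ?W + ?O" using total by simp
    then obtain w z where "x = w + z" "w \<in> ?W" "z \<in> ?O" by (auto elim!: set_plus_elim)
    moreover from this obtain y where "(w, y) \<in> G" by blast
    ultimately show ?thesis unfolding R_def by (intro exI[of _ y] exI[of _ w]) simp
  qed
  define s where "s x = (THE y. R x y)" for x
  have sR: "R x (s x)" for x
    unfolding s_def by (rule theI') (use R_ex R_fun in blast)
  have s_eq: "s x = y" if "R x y" for x y using R_fun[OF sR that] .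
  have s_G: "s w = y" if "(w, y) \<in> G" for w y
    using that subspace_0[OF O] by (intro s_eq) (auto simp: R_def intro!: exI[of _ w])
  have s_obtain: "\<exists>w. x - w \<in> ?O \<and> (w, s x) \<in> G" for x
    using sR[of x] unfolding R_def .
  have "s (x + x') = s x + s x'" for x x'
  proof -
    obtain w w' where w: "x - w \<in> ?O" "(w, s x) \<in> G" "x' - w' \<in> ?O" "(w', s x') \<in> G"
      using s_obtain by blast
    have "(x + x') - (w + w') = (x - w) + (x' - w')" by simp
    also have "\<dots> \<in> ?O" by (rule subspace_add[OF O w(1,3)])
    finally show ?thesis using Gadd[OF w(2,4)] by (intro s_eq) (auto simp: R_def)
  qed
  moreover have "s (scale c x) = scale c (s x)" for c x
  proof -
    obtain w where w: "x - w \<in> ?O" "(w, s x) \<in> G" using s_obtain by blast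
    have "scale c x - scale c w = scale c (x - w)" by (simp add: scale_right_diff_distrib)
    also have "\<dots> \<in> ?O" by (rule subspace_scale[OF O w(1)])
    finally show ?thesis using Gscale[OF w(2)] by (intro s_eq) (auto simp: R_def)
  qed
  ultimately have lin: "Vector_Spaces.linear scale scale s" by (simp add: linear_self_iff)
  have s_u: "s (u x) = - u (s x)" for x
  proof -
    obtain w where w: "x - w \<in> ?O" "(w, s x) \<in> G" using s_obtain by blast
    have "b (u x - u w) z = 0" if "z \<in> ?W" for z
    proof -
      have "u z \<in> ?W" using that Gu by blast
      then have "b (u (x - w)) z = 0" using w(1) by (simp add: b_u annihilator_def)
      then show ?thesis by (simp add: u.diff)
    qed
    then show ?thesis using Gu[OF w(2)] by (intro s_eq) (auto simp: R_def annihilator_def)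
  qed
  have s_cube: "s (s (s x)) = s x" for x
  proof -
    obtain w where w: "(w, s x) \<in> G" using s_obtain by blast
    show ?thesis using s_G[OF w] s_G[OF Gsym[OF w]] by simp
  qed
  have s_skew: "b (s x) x' = - b x (s x')" for x x'
  proof -
    obtain w w' where w: "x - w \<in> ?O" "(w, s x) \<in> G" "x' - w' \<in> ?O" "(w', s x') \<in> G"
      using s_obtain by blast
    have "s x \<in> ?W" "s x' \<in> ?W" using w Gsym by blast+
    then have "b (x' - w') (s x) = 0" "b (x - w) (s x') = 0"
      using w(1,3) by (auto simp: annihilator_def)
    then have "b x' (s x) = b w' (s x)" "b x (s x') = b w (s x')" by (simp_all add: b_simps)
    moreover have "b (s x) w' = - b w (s x')" using Gb[OF Gsym[OF w(2)] w(4)] .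
    ultimately show ?thesis using b_sym by metis
  qed
  have "range s = ?W"
  proof (intro equalityI subsetI)
    fix y assume "y \<in> range s"
    then show "y \<in> ?W" using s_obtain Gsym by blast
  next
    fix w assume "w \<in> ?W"
    then obtain y where "(w, y) \<in> G" by blast
    then have "w = s y" using s_G Gsym by metis
    then show "w \<in> range s" by blast
  qed
  then show ?thesis using lin s_u s_cube s_skew unfolding sign_map_def by blast
qed

text \<open>The graph of a sign map prescribed on generators; that it is single-valued is not checked on
  relations but follows from non-degeneracy of \<open>b\<close> on its domain.\<close>

inductive_set twisted_span :: "('v \<times> 'v) set \<Rightarrow> ('v \<times> 'v) set" for \<Gamma> where
  zero: "(0, 0) \<in> twisted_span \<Gamma>"
| step: "(x, y) \<in> \<Gamma> \<Longrightarrow> (a, c) \<in> twisted_span \<Gamma> \<Longrightarrow> (E f x + a, E (flip f) y + c) \<in> twisted_span \<Gamma>"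

lemma twisted_span_base: "(x, y) \<in> \<Gamma> \<Longrightarrow> (E f x, E (flip f) y) \<in> twisted_span \<Gamma>"
  using twisted_span.step[OF _ twisted_span.zero] by simp

lemma twisted_span_add:
  "(a, c) \<in> twisted_span \<Gamma> \<Longrightarrow> (a', c') \<in> twisted_span \<Gamma> \<Longrightarrow> (a + a', c + c') \<in> twisted_span \<Gamma>"
  by (induction rule: twisted_span.induct) (auto simp: add.assoc intro: twisted_span.step)

lemma twisted_span_E: "(a, c) \<in> twisted_span \<Gamma> \<Longrightarrow> (E g a, E (flip g) c) \<in> twisted_span \<Gamma>"
proof (induction rule: twisted_span.induct)
  case (step x y a c f)
  then have "(E (g * f) x + E g a, E (flip (g * f)) y + E (flip g) c) \<in> twisted_span \<Gamma>"
    by (intro twisted_span.step)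
  then show ?case by (simp add: E_arg_add E_mult flip_mult)
qed (simp add: twisted_span.zero)

text \<open>By adjunction \<open>b(f(u) x, g(u) x')\<close> is
  \<open>b(x, (flip f * g)(u) x')\<close>, so a single polynomial factor in \<open>anti\<close>
  suffices.\<close>

lemma sign_map_of_generators:
  assumes sym: "\<And>x y. (x, y) \<in> \<Gamma> \<Longrightarrow> (y, x) \<in> \<Gamma>"
    and anti: "\<And>x y x' y' f. (x, y) \<in> \<Gamma> \<Longrightarrow> (x', y') \<in> \<Gamma> \<Longrightarrow> b x (E f x') = - b y (E (flip f) y')"
    and nondeg: "\<And>z. z \<in> Domain (twisted_span \<Gamma>) \<Longrightarrow> (\<And>x f. x \<in> Domain \<Gamma> \<Longrightarrow> b z (E f x) = 0) \<Longrightarrow> z = 0"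
  shows "\<exists>s. sign_map s \<and> range s = Domain (twisted_span \<Gamma>)"
proof (rule sign_map_of_relation)
  show "(0, 0) \<in> twisted_span \<Gamma>" by (rule twisted_span.zero)
  show "(x + x', y + y') \<in> twisted_span \<Gamma>"
    if "(x, y) \<in> twisted_span \<Gamma>" "(x', y') \<in> twisted_span \<Gamma>" for x y x' y'
    using that by (rule twisted_span_add)
  show "(scale c x, scale c y) \<in> twisted_span \<Gamma>" if "(x, y) \<in> twisted_span \<Gamma>" for c x y
    using twisted_span_E[OF that, of "[:c:]"] by (simp add: E_pCons flip_def)
  show "(u x, - u y) \<in> twisted_span \<Gamma>" if "(x, y) \<in> twisted_span \<Gamma>" for x y
    using twisted_span_E[OF that, of "[:0, 1:]"]
    by (simp add: E_pCons flip_def pcompose_pCons u.neg u.scale)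
  show "(y, x) \<in> twisted_span \<Gamma>" if "(x, y) \<in> twisted_span \<Gamma>" for x y
    using that
  proof (induction rule: twisted_span.induct)
    case (step x y a c f)
    then show ?case using twisted_span.step[OF sym, of x y c a "flip f"] by simp
  qed (rule twisted_span.zero)
  have base: "b (E f x) a = - b (E (flip f) y) c"
    if xy: "(x, y) \<in> \<Gamma>" and ac: "(a, c) \<in> twisted_span \<Gamma>" for x y a c f
    using ac
  proof (induction rule: twisted_span.induct)
    case (step x' y' a c g)
    have "b (E f x) (E g x') = b x (E (flip f * g) x')" by (simp add: b_E E_mult)
    also have "\<dots> = - b y (E (f * flip g) y')" using anti[OF xy step(1)] by (simp add: flip_mult)
    also have "b y (E (f * flip g) y') = b (E (flip f) y) (E (flip g) y')" by (simp add: b_E E_mult)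
    finally show ?case using step by (simp add: b_simps)
  qed (simp add: b_simps)
  show "b x x' = - b y y'" if "(x, y) \<in> twisted_span \<Gamma>" "(x', y') \<in> twisted_span \<Gamma>" for x y x' y'
    using that(1)
  proof (induction rule: twisted_span.induct)
    case (step x y a c f)
    then show ?case using base[OF step(1) that(2)] by (simp add: b_simps)
  qed (simp add: b_simps)
  show "z = 0" if "z \<in> Domain (twisted_span \<Gamma>)"
    "\<And>y. y \<in> Domain (twisted_span \<Gamma>) \<Longrightarrow> b z y = 0" for z
    using that twisted_span_base by (intro nondeg) blast+
qed

lemma sign_map_zero: "sign_map (\<lambda>_. 0)"
  by (simp add: sign_map_def linear_self_iff b_simps u.zero)

text \<open>Skewness turns \<open>s t = 0\<close> into \<open>t s = 0\<close>, so
  \<open>s + t\<close> is again a sign map. Its range contains those of \<open>s\<close> and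
  \<open>t\<close>, which meet only in 0.\<close>

lemma sign_map_extend:
  assumes s: "sign_map s" and t: "sign_map t" and st: "\<And>x. s (t x) = 0"
    and ne: "t x0 \<noteq> 0"
  shows "\<exists>r. sign_map r \<and> dim (range r) > dim (range s)"
proof -
  define r where "r x = s x + t x" for x
  note lin = sign_map_linear[OF s] sign_map_linear[OF t]
  have ts: "t (s x) = 0" for x
    by (rule b_nondegenerate) (simp add: sign_map_skew[OF s] sign_map_skew[OF t] st b_simps)
  have r: "sign_map r"
    unfolding sign_map_def linear_self_iff r_def
    by (simp add: lin sign_map_u[OF s] sign_map_u[OF t] st ts sign_map_cube[OF s]
        sign_map_cube[OF t] b_simps sign_map_skew[OF s] sign_map_skew[OF t] u.add scale_right_distrib)
  have sub: "range s \<subseteq> range r"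
  proof
    fix y assume "y \<in> range s"
    then obtain x where "y = s x" by blast
    then have "y = r (s (s x))" by (simp add: r_def ts sign_map_cube[OF s])
    then show "y \<in> range r" by blast
  qed
  have "r (t (t x0)) = t x0" by (simp add: r_def st sign_map_cube[OF t])
  then have "t x0 \<in> range r" by (metis rangeI)
  moreover have "t x0 \<notin> range s"
  proof
    assume "t x0 \<in> range s"
    then have "t x0 = s (s (t x0))" using sign_map_range[OF s] by simp
    then show False using ne by (simp add: st lin)
  qed
  ultimately have "dim (range s) \<noteq> dim (range r)"
    using subspace_dim_equal[of "range s" "range r"] sub stable_subspace
      stable_range_sign_map[OF s] stable_range_sign_map[OF r] by auto
  then show ?thesis using r dim_subset[OF sub] by (intro exI[of _ r]) simp
qed

context
  fixes s
  assumes s: "sign_map s"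
begin

text \<open>By maximality of \<open>k\<close>, \<open>p(u)^(k-1) x\<close> is not in the image of
  \<open>p(u)^k\<close> on the kernel of \<open>s\<close>, so some \<open>y0\<close> in
  \<open>Ker p(-u)^k\<close> pairs with it non-trivially. Then
  \<open>f \<mapsto> b(x, f(u) y0)\<close> is the residue functional multiplied by some
  \<open>g\<close> prime to \<open>p(-t)\<close>, and applying an inverse of \<open>g\<close> to
  \<open>y0\<close> removes that factor.\<close>

lemma dual_vector:
  assumes p: "irreducible p" "coeff p 0 \<noteq> 0" and k: "k \<ge> 1"
    and top: "\<And>y. s y = 0 \<Longrightarrow> E (p ^ Suc k) y = 0 \<Longrightarrow> E (p ^ k) y = 0"
    and x: "s x = 0" "E (p ^ k) x = 0" "E (p ^ (k - 1)) x \<noteq> 0"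
  shows "\<exists>y. s y = 0 \<and> E (flip p ^ k) y = 0 \<and> (\<forall>f. b x (E f y) = residue_coeff (flip p ^ k) f)"
proof -
  note lin = sign_map_linear[OF s]
  let ?x = "E (p ^ (k - 1)) x" and ?m = "flip p ^ k"
  have sx: "s ?x = 0" by (simp add: sign_map_E[OF s] x)
  have k': "p * p ^ (k - 1) = p ^ k" using k by (cases k) simp_all
  have proj: "s (y - s (s y)) = 0" for y by (simp add: lin sign_map_cube[OF s])
  \<comment> \<open>Replacing \<open>y\<close> by its component in the kernel of \<open>s\<close>
    does not change its pairing with a vector of that kernel.\<close>
  have bproj: "b ?x y = b ?x (y - s (s y))" for y
    using sign_map_orthogonal[OF s sx, of "s (s y)"] by (simp add: b_simps)
  have "\<exists>y0. s y0 = 0 \<and> E ?m y0 = 0 \<and> b ?x y0 \<noteq> 0"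
  proof (rule ccontr)
    assume contra: "\<nexists>y0. s y0 = 0 \<and> E ?m y0 = 0 \<and> b ?x y0 \<noteq> 0"
    have "b ?x y = 0" if "E (flip (p ^ k)) y = 0" for y
    proof -
      have "E ?m (y - s (s y)) = 0"
        using that by (simp add: E_arg_diff sign_map_square_E[OF s, symmetric] lin flip: flip_power)
      then show ?thesis using contra proj bproj by metis
    qed
    then have "?x \<in> annihilator b {y. E (flip (p ^ k)) y = 0}" by (simp add: annihilator_def)
    then obtain c where c: "?x = E (p ^ k) c" using annihilator_kernel_E by blast
    let ?c = "c - s (s c)"
    have c': "E (p ^ k) ?c = ?x"
      using sx by (simp add: E_arg_diff sign_map_square_E[OF s, symmetric] lin flip: c)
    \<comment> \<open>The right-hand side is \<open>p(u)^k x = 0\<close>. By maximality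
      \<open>p(u)^k\<close> already kills \<open>?c\<close>, although it sends it to the non-zero
      vector \<open>?x\<close>.\<close>
    then have "E (p ^ Suc k) ?c = E (p * p ^ (k - 1)) x" by (simp add: E_mult)
    then have "E (p ^ Suc k) ?c = 0" using x(2) k' by simp
    then have "E (p ^ k) ?c = 0" using top proj by blast
    then show False using c' x(3) by simp
  qed
  then obtain y0 where y0: "s y0 = 0" "E ?m y0 = 0" "b ?x y0 \<noteq> 0" by blast
  have m0: "coeff ?m 0 \<noteq> 0" using p(2) by (simp add: coeff_0_power coeff_flip)
  obtain g where g: "\<And>f. b x (E f y0) = residue_coeff ?m (f * g)"
    using residue_coeff_represents[OF m0, of "\<lambda>f. b x (E f y0)"] y0(2)
    by (auto simp: E_add E_smult E_mult_commute E_mult b_simps)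
  have "\<not> flip p dvd g"
  proof
    assume "flip p dvd g"
    then have "flip p ^ (k - 1) * flip p dvd flip p ^ (k - 1) * g" by (rule mult_dvd_mono[OF dvd_refl])
    moreover have "flip p ^ (k - 1) * flip p = ?m" using k by (cases k) simp_all
    ultimately have "?m dvd flip p ^ (k - 1) * g" by (simp only:)
    then have "b x (E (flip p ^ (k - 1)) y0) = 0" unfolding g by (rule residue_coeff_multiple)
    then show False using y0(3) by (simp add: b_E flip_power)
  qed
  then obtain a c where ac: "a * ?m + c * g = 1"
    using irreducible_power_bezout[of "flip p" g k] p(1) by auto
  let ?y = "E c y0"
  have "b x (E f ?y) = residue_coeff ?m f" for f
  proof -
    have "b x (E f ?y) = residue_coeff ?m (f * c * g)" using g[of "f * c"] by (simp add: E_mult)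
    also have "\<dots> = residue_coeff ?m f"
    proof (rule residue_coeff_cong)
      have "f * c * g - f = f * (c * g - 1)" by (simp add: algebra_simps)
      also have "c * g - 1 = - (a * ?m)" using ac by (simp add: algebra_simps eq_diff_eq)
      finally show "?m dvd f * c * g - f" by simp
    qed
    finally show ?thesis .
  qed
  moreover have "E ?m ?y = 0" using y0(2) by (simp add: E_mult_commute[of ?m])
  moreover have "s ?y = 0" using y0(1) by (simp add: sign_map_E[OF s])
  ultimately show ?thesis by blast
qed

end

end

section \<open>Extending sign maps\<close>

context skew_pair
begin

context
  fixes s p and k :: nat
  assumes s: "sign_map s" and p: "irreducible p" "coeff p 0 \<noteq> 0" and k: "k \<ge> 1"
    and top: "\<And>y. s y = 0 \<Longrightarrow> E (p ^ Suc k) y = 0 \<Longrightarrow> E (p ^ k) y = 0"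
begin

lemma flip_power_coeff_0: "coeff (flip p ^ k) 0 \<noteq> 0"
  using p(2) by (simp add: coeff_0_power coeff_flip)

text \<open>Newton iteration: write \<open>b(x, f(u) x)\<close> as the constant coefficient of \<open>f g\<close> modulo \<open>p^k\<close> and
  choose \<open>y\<close> dual to \<open>x\<close>; replacing \<open>x\<close> by \<open>x - g(u) y / 2\<close> leaves the error \<open>b(g(u) y, f(u) g(u) y) / 4\<close>,
  which is quadratic in \<open>g\<close>.\<close>

lemma exists_isotropic_generator:
  assumes even: "flip p = p"
    and x0: "s x0 = 0" "E (p ^ k) x0 = 0" "E (p ^ (k - 1)) x0 \<noteq> 0"
      "\<And>f. b x0 (E (p ^ (k - 1) * f) x0) = 0"
  shows "\<exists>x. s x = 0 \<and> E (p ^ k) x = 0 \<and> E (p ^ (k - 1)) x \<noteq> 0 \<and> (\<forall>f. b x (E f x) = 0)"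
proof -
  note lin = sign_map_linear[OF s]
  \<comment> \<open>Approximation of order \<open>m\<close>: the last condition means that
    \<open>p^m\<close> divides the polynomial representing \<open>f \<mapsto> b(x, f(u) x)\<close>.
    Order 1 is the hypothesis and order \<open>k\<close> the conclusion.\<close>
  have "\<exists>x. s x = 0 \<and> E (p ^ k) x = 0 \<and> E (p ^ (k - 1)) x \<noteq> 0 \<and>
    (\<forall>f. b x (E (p ^ (k - m) * f) x) = 0)" if "1 \<le> m" "m \<le> k" for m
    using that
  proof (induction m rule: dec_induct)
    case base
    then show ?case using x0 by (intro exI[of _ x0]) simp
  next
    case (step m)
    then obtain x where x: "s x = 0" "E (p ^ k) x = 0" "E (p ^ (k - 1)) x \<noteq> 0"
      "\<And>f. b x (E (p ^ (k - m) * f) x) = 0" by auto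
    obtain y where y: "s y = 0" "E (p ^ k) y = 0" "\<And>f. b x (E f y) = residue_coeff (p ^ k) f"
      using dual_vector[OF s p k top x(1-3)] even by auto
    have m0: "coeff (p ^ k) 0 \<noteq> 0" using flip_power_coeff_0 even by simp
    obtain g where g: "\<And>f. b x (E f x) = residue_coeff (p ^ k) (f * g)"
      using residue_coeff_represents[OF m0, of "\<lambda>f. b x (E f x)"] x(2)
      by (auto simp: E_add E_smult E_mult_commute E_mult b_simps)
    have "p ^ k dvd p ^ (k - m) * g"
    proof (rule residue_coeff_nondegenerate[OF m0])
      fix f
      show "residue_coeff (p ^ k) (f * (p ^ (k - m) * g)) = 0"
        using x(4)[of f] g[of "p ^ (k - m) * f"] by (simp add: ac_simps)
    qed
    moreover have "p ^ k = p ^ (k - m) * p ^ m" using step by (simp flip: power_add)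
    ultimately have "p ^ (k - m) * p ^ m dvd p ^ (k - m) * g" by (simp only:)
    moreover have "p \<noteq> 0" using p(1) by auto
    ultimately have pg: "p ^ m dvd g" by simp
    let ?h = "scale (1 / 2)"
    let ?z = "E g y"
    define x' where "x' = x - ?h ?z"
    have "(4 :: 'a) = 2 * 2" "(8 :: 'a) = 2 * 2 * 2" by simp_all
    then have four: "(4 :: 'a) \<noteq> 0" "(8 :: 'a) \<noteq> 0" using two_neq_0 by (metis mult_eq_0_iff)+
    have form: "b x' (E f x') = (1 / 4) * b y (E (flip g * f * g) y)" for f
    proof -
      have "b x (E f ?z) = b x (E f x)"
        using y(3)[of "f * g"] g[of f] by (simp add: E_mult)
      moreover have "b ?z (E f x) = b x (E f x)"
      proof -
        have "b ?z (E f x) = b x (E (flip f * g) y)"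
          using b_sym[of ?z "E f x"] by (simp add: b_E E_mult)
        also have "\<dots> = b x (E (flip f) x)" by (simp add: y(3) g)
        also have "\<dots> = b (E f x) x" by (simp add: b_E)
        also have "\<dots> = b x (E f x)" by (rule b_sym)
        finally show ?thesis .
      qed
      moreover have "b ?z (E f ?z) = b y (E (flip g * f * g) y)"
        by (simp add: b_E E_mult)
      ultimately show ?thesis using two_neq_0 four
        by (simp add: x'_def E_arg_diff E_arg_scale b_simps field_simps)
    qed
    have "b x' (E (p ^ (k - Suc m) * f) x') = 0" for f
    proof -
      have "p ^ m dvd flip g" using flip_dvd_flip_iff[of "p ^ m" g] pg even by (simp add: flip_power)
      then have "p ^ m * (p ^ (k - Suc m) * f) * p ^ m dvd flip g * (p ^ (k - Suc m) * f) * g"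
        using pg by (intro mult_dvd_mono dvd_refl)
      moreover have "p ^ k dvd p ^ m * (p ^ (k - Suc m) * f) * p ^ m"
      proof -
        \<comment> \<open>The exponent is \<open>k - 1 + m\<close>, at least \<open>k\<close>
          because \<open>m \<ge> 1\<close>; \<open>g\<close> and \<open>flip g\<close> contribute
          one \<open>p^m\<close> each.\<close>
        have "p ^ k dvd p ^ (m + (k - Suc m) + m)" using step by (intro le_imp_power_dvd) simp
        then show ?thesis by (simp add: power_add ac_simps dvd_mult)
      qed
      ultimately have "p ^ k dvd flip g * (p ^ (k - Suc m) * f) * g" by (rule dvd_trans[rotated])
      then have "E (flip g * (p ^ (k - Suc m) * f) * g) y = 0" using y(2) by (rule E_dvd_zero)
      then show ?thesis by (simp only: form b_simps mult_zero_right)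
    qed
    moreover have "s x' = 0" by (simp add: x'_def lin x y sign_map_E[OF s])
    moreover have "E (p ^ k) x' = 0"
      by (simp add: x'_def E_arg_diff E_arg_scale x y E_mult_commute[of "p ^ k"])
    \<comment> \<open>As \<open>p\<close> divides \<open>g\<close>, the correction is killed by
      \<open>p(u)^(k-1)\<close>, so \<open>x'\<close> still generates a cyclic space with
      annihilator \<open>p^k\<close>.\<close>
    moreover have "E (p ^ (k - 1)) x' = E (p ^ (k - 1)) x"
    proof -
      have "p dvd g" using pg step dvd_trans[OF dvd_power[of m p] pg] by simp
      then have "p ^ (k - 1) * p dvd p ^ (k - 1) * g" by (intro mult_dvd_mono dvd_refl)
      moreover have "p ^ (k - 1) * p = p ^ k" using k by (cases k) simp_all
      ultimately have "E (p ^ (k - 1) * g) y = 0" using y(2) E_dvd_zero by metis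
      then show ?thesis by (simp add: x'_def E_arg_diff E_arg_scale E_mult)
    qed
    ultimately show ?case using x(3) by (intro exI[of _ x']) simp
  qed
  from this[of k] show ?thesis using k by simp
qed

text \<open>\<open>cyc x\<close> and \<open>cyc y\<close>, for an isotropic dual vector
  \<open>y\<close>, become the eigenspaces for 1 and -1. Here a single correction makes
  \<open>y\<close> isotropic: since \<open>x\<close> is isotropic already, no quadratic error is
  left.\<close>

lemma exists_sign_map_even:
  assumes even: "flip p = p"
    and x: "s x = 0" "E (p ^ k) x = 0" "E (p ^ (k - 1)) x \<noteq> 0" "\<And>f. b x (E f x) = 0"
  shows "\<exists>t. sign_map t \<and> (\<forall>z. s (t z) = 0) \<and> (\<exists>z. t z \<noteq> 0)"
proof -
  note lin = sign_map_linear[OF s]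
  let ?m = "p ^ k"
  have fm: "flip ?m = ?m" by (simp add: flip_power even)
  have m0: "coeff ?m 0 \<noteq> 0" using flip_power_coeff_0 even by simp
  obtain y0 where y0: "s y0 = 0" "E ?m y0 = 0" "\<And>f. b x (E f y0) = residue_coeff ?m f"
    using dual_vector[OF s p k top x(1-3)] even by auto
  obtain g where g: "\<And>f. b y0 (E f y0) = residue_coeff ?m (f * g)"
    using residue_coeff_represents[OF m0, of "\<lambda>f. b y0 (E f y0)"] y0(2)
    by (auto simp: E_add E_smult E_mult_commute E_mult b_simps)
  \<comment> \<open>Both cross terms between \<open>y0\<close> and \<open>(flip g)(u) x\<close>
    equal the value \<open>b(y0, f(u) y0)\<close> that is to be removed, whence the factor
    1/2.\<close>
  define y where "y = y0 - scale (1 / 2) (E (flip g) x)"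
  have y: "s y = 0" "E ?m y = 0"
    by (simp_all add: y_def lin x y0 sign_map_E[OF s] E_arg_diff E_arg_scale E_mult_commute[of ?m])
  have xy: "b x (E f y) = residue_coeff ?m f" for f
    by (simp add: y_def E_arg_diff E_arg_scale b_simps y0(3) x(4) flip: E_mult)
  have yy: "b y (E f y) = 0" for f
  proof -
    have 1: "b (E (flip g) x) (E f y0) = b y0 (E f y0)"
      by (simp add: b_E y0(3) g mult.commute flip: E_mult)
    have "b y0 (E f (E (flip g) x)) = b (E (flip f * g) y0) x"
      by (simp add: b_E flip_mult E_mult E_mult_commute[of f])
    also have "\<dots> = b x (E (flip f * g) y0)" by (rule b_sym)
    also have "\<dots> = b y0 (E (flip f) y0)" by (simp add: y0(3) g)
    also have "\<dots> = b (E f y0) y0" by (simp add: b_E)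
    also have "\<dots> = b y0 (E f y0)" by (rule b_sym)
    finally have 2: "b y0 (E f (E (flip g) x)) = b y0 (E f y0)" .
    have 3: "b (E (flip g) x) (E f (E (flip g) x)) = 0"
      by (simp add: b_E x(4) flip: E_mult)
    show ?thesis using 1 2 3 two_neq_0
      by (simp add: y_def E_arg_diff E_arg_scale b_simps field_simps)
  qed
  have yx: "b y (E f x) = residue_coeff ?m f" for f
  proof -
    have "b y (E f x) = b (E f x) y" by (rule b_sym)
    also have "\<dots> = residue_coeff ?m (flip f)" by (simp add: b_E xy)
    finally show ?thesis using residue_coeff_flip[of ?m f] fm by simp
  qed
  \<comment> \<open>The relation has to be symmetric, so \<open>(y, - y)\<close> comes with
    \<open>(- y, y)\<close>.\<close>
  define \<Gamma> where "\<Gamma> = {(x, x), (y, - y), (- y, y)}"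
  have dom: "\<exists>f g. z = E f x + E g y" if "z \<in> Domain (twisted_span \<Gamma>)" for z
  proof -
    obtain z' where "(z, z') \<in> twisted_span \<Gamma>" using \<open>z \<in> Domain (twisted_span \<Gamma>)\<close> by blast
    then show ?thesis
    proof (induction rule: twisted_span.induct)
      case zero
      show ?case by (intro exI[of _ 0]) simp
    next
      case (step a a' c c' h)
      then obtain f g where fg: "c = E f x + E g y" by blast
      consider "a = x" | "a = y" | "a = - y" using step(1) by (auto simp: \<Gamma>_def)
      then show ?case
      proof cases
        case 1
        then have "E h a + c = E (h + f) x + E g y" using fg by (simp add: E_add)
        then show ?thesis by blast
      next
        case 2
        then have "E h a + c = E f x + E (h + g) y" using fg by (simp add: E_add)
        then show ?thesis by blast
      next
        case 3
        then have "E h a + c = E f x + E (g - h) y" using fg by (simp add: E_diff E_arg_minus)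
        then show ?thesis by blast
      qed
    qed
  qed
  have "\<exists>t. sign_map t \<and> range t = Domain (twisted_span \<Gamma>)"
  proof (rule sign_map_of_generators)
    show "(a', a) \<in> \<Gamma>" if "(a, a') \<in> \<Gamma>" for a a' using that by (auto simp: \<Gamma>_def)
    show "b a (E f c) = - b a' (E (flip f) c')" if "(a, a') \<in> \<Gamma>" "(c, c') \<in> \<Gamma>" for a a' c c' f
      using that residue_coeff_flip[of ?m f] fm
      by (auto simp: \<Gamma>_def xy yx yy x(4) b_simps E_arg_minus)
    fix z
    assume "z \<in> Domain (twisted_span \<Gamma>)" and orth: "\<And>a f. a \<in> Domain \<Gamma> \<Longrightarrow> b z (E f a) = 0"
    then obtain f g where z: "z = E f x + E g y" using dom by blast
    \<comment> \<open>The pairing of the generators is antidiagonal: orthogonality to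
      \<open>cyc x\<close> kills the coefficient of \<open>y\<close>, and orthogonality to
      \<open>cyc y\<close> that of \<open>x\<close>.\<close>
    have "?m dvd g"
    proof (rule residue_coeff_nondegenerate[OF m0])
      fix h
      have "0 = b z (E (flip h) x)" using orth[of x "flip h"] by (auto simp: \<Gamma>_def)
      also have "\<dots> = b (E g y) (E (flip h) x)"
        by (simp add: z b_simps b_E x(4) flip: E_mult)
      also have "\<dots> = b y (E (flip (h * g)) x)" by (simp add: b_E flip_mult E_mult E_mult_commute)
      also have "\<dots> = residue_coeff ?m (h * g)"
        using residue_coeff_flip[of ?m "h * g"] fm by (simp add: yx)
      finally show "residue_coeff ?m (h * g) = 0" by simp
    qed
    then have gy: "E g y = 0" using y(2) by (rule E_dvd_zero)
    have "?m dvd flip f"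
    proof (rule residue_coeff_nondegenerate[OF m0])
      fix h
      have "0 = b z (E h y)" using orth[of y h] by (auto simp: \<Gamma>_def)
      also have "\<dots> = b x (E (h * flip f) y)"
        by (simp add: z gy b_E E_mult E_mult_commute)
      finally show "residue_coeff ?m (h * flip f) = 0" by (simp add: xy)
    qed
    then have "?m dvd f" using flip_dvd_flip_iff[of ?m "flip f"] fm by simp
    then have "E f x = 0" using x(2) by (rule E_dvd_zero)
    then show "z = 0" using z gy by simp
  qed
  then obtain t where t: "sign_map t" "range t = Domain (twisted_span \<Gamma>)" by blast
  have "s (t z) = 0" for z
  proof -
    have "t z \<in> Domain (twisted_span \<Gamma>)" using rangeI[of t z] by (simp only: t(2))
    then show ?thesis using dom[of "t z"] x(1) y(1) by (auto simp: lin sign_map_E[OF s])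
  qed
  moreover have "\<exists>z. t z \<noteq> 0"
  proof -
    have "(E 1 x, E (flip 1) x) \<in> twisted_span \<Gamma>"
      by (rule twisted_span_base) (simp add: \<Gamma>_def)
    then have "x \<in> range t" unfolding t(2) by auto
    moreover have "x \<noteq> 0" using x(3) by auto
    ultimately show ?thesis by (metis imageE)
  qed
  ultimately show ?thesis using t(1) by blast
qed

text \<open>\<open>Ker p(u)^k\<close> and \<open>Ker p(-u)^k\<close> are totally isotropic and are
  to be exchanged. Antisymmetry forces exchanged generators to be orthogonal, so the duality is
  crosswise: \<open>x1\<close> with \<open>y2\<close> and, with the opposite sign, \<open>x3\<close>
  with \<open>y1\<close>, where \<open>x3\<close> is \<open>x2\<close> corrected by an element of
  \<open>cyc x1\<close>.\<close>

lemma exists_sign_map_odd: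
  assumes odd: "\<not> p dvd flip p"
    and x1: "s x1 = 0" "E (p ^ k) x1 = 0" "E (p ^ (k - 1)) x1 \<noteq> 0"
    and x2: "s x2 = 0" "E (p ^ k) x2 = 0" "\<And>f. E (p ^ (k - 1)) (x2 - E f x1) \<noteq> 0"
  shows "\<exists>t. sign_map t \<and> (\<forall>z. s (t z) = 0) \<and> (\<exists>z. t z \<noteq> 0)"
proof -
  note lin = sign_map_linear[OF s]
  let ?m = "flip p ^ k" and ?n = "p ^ k"
  have fm: "flip ?m = ?n" "flip ?n = ?m" by (simp_all add: flip_power)
  have m0: "coeff ?m 0 \<noteq> 0" by (rule flip_power_coeff_0)
  obtain a c where "a * p + c * flip p = 1" using irreducible_bezout[OF p(1) odd] by blast
  \<comment> \<open>Each use of \<open>bezout_power\<close> raises only the first polynomial to a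
    power; exchanging the roles makes both \<open>p^k\<close> and \<open>p(-t)^k\<close>
    appear.\<close>
  then have "c * flip p + a * p = 1" by (simp add: add.commute)
  then obtain a c where "c * ?m + a * p = 1" using bezout_power by blast
  then have "a * p + c * ?m = 1" by (simp add: add.commute)
  then obtain \<alpha> \<gamma> where \<alpha>\<gamma>: "\<alpha> * ?n + \<gamma> * ?m = 1" using bezout_power by blast
  \<comment> \<open>When \<open>q\<close> and \<open>flip q\<close> are coprime, a vector killed by
    \<open>q(u)\<close> lies in the image of \<open>(flip q)(u)\<close>, whose adjoint
    \<open>q(u)\<close> kills \<open>z\<close>.\<close>
  have iso: "b z (E f w) = 0" if "E q z = 0" "E q w = 0" "\<alpha>' * q + \<gamma>' * flip q = 1" for z w f q \<alpha>' \<gamma>'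
  proof -
    have "E f w = E (\<alpha>' * q + \<gamma>' * flip q) (E f w)" by (simp only: that(3) E_1)
    also have "\<dots> = E (flip q) (E (\<gamma>' * f) w)"
      using that(2) by (simp add: E_add E_mult E_mult_commute[of q] E_mult_commute[of "flip q"])
    finally have "b z (E f w) = b (E q z) (E (\<gamma>' * f) w)" by (simp add: b_E)
    then show ?thesis using that(1) by (simp add: b_simps)
  qed
  have isox: "b z (E f w) = 0" if "E ?n z = 0" "E ?n w = 0" for z w f
    using iso[OF that, of \<alpha> \<gamma>] \<alpha>\<gamma> fm by simp
  have isoy: "b z (E f w) = 0" if "E ?m z = 0" "E ?m w = 0" for z w f
    using iso[OF that, of \<gamma> \<alpha>] \<alpha>\<gamma> fm by (simp add: add.commute)
  obtain y2 where y2: "s y2 = 0" "E ?m y2 = 0" "\<And>f. b x1 (E f y2) = residue_coeff ?m f"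
    using dual_vector[OF s p k top x1] by auto
  obtain g where g: "\<And>f. b x2 (E f y2) = residue_coeff ?m (f * g)"
    using residue_coeff_represents[OF m0, of "\<lambda>f. b x2 (E f y2)"] y2(2)
    by (auto simp: E_add E_smult E_mult_commute E_mult b_simps)
  \<comment> \<open>The correction makes \<open>x3\<close> orthogonal to \<open>cyc y2\<close>;
    independence of \<open>x1\<close> and \<open>x2\<close> modulo \<open>Ker p(u)^(k-1)\<close>
    keeps \<open>p(u)^(k-1) x3\<close> non-zero.\<close>
  define x3 where "x3 = x2 - E (flip g) x1"
  have x3: "s x3 = 0" "E ?n x3 = 0" "E (p ^ (k - 1)) x3 \<noteq> 0"
    using x2(3)[of "flip g"]
    by (simp_all add: x3_def lin x1 x2 sign_map_E[OF s] E_arg_diff E_mult_commute[of ?n])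
  have x3y2: "b x3 (E f y2) = 0" for f
    by (simp add: x3_def b_simps g b_E y2(3) mult.commute flip: E_mult)
  obtain y0 where y0: "s y0 = 0" "E ?m y0 = 0" "\<And>f. b x3 (E f y0) = residue_coeff ?m f"
    using dual_vector[OF s p k top x3] by auto
  obtain h where h: "\<And>f. b x1 (E f y0) = residue_coeff ?m (f * h)"
    using residue_coeff_represents[OF m0, of "\<lambda>f. b x1 (E f y0)"] y0(2)
    by (auto simp: E_add E_smult E_mult_commute E_mult b_simps)
  \<comment> \<open>The term \<open>h(u) y2\<close> makes \<open>y1\<close> orthogonal to
    \<open>cyc x1\<close> and has no effect on \<open>x3\<close>, which is orthogonal to
    \<open>cyc y2\<close>. The minus sign before \<open>y0\<close> is the one that antisymmetry
    requires.\<close>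
  define y1 where "y1 = E h y2 - y0"
  have y1: "s y1 = 0" "E ?m y1 = 0"
    by (simp_all add: y1_def lin y0 y2 sign_map_E[OF s] E_arg_diff E_mult_commute[of ?m])
  have x1y1: "b x1 (E f y1) = 0" for f
    by (simp add: y1_def E_arg_diff b_simps h y2(3) flip: E_mult)
  have x3y1: "b x3 (E f y1) = - residue_coeff ?m f" for f
    by (simp add: y1_def E_arg_diff b_simps y0(3) x3y2 flip: E_mult)
  have rev: "b z (E f w) = b w (E (flip f) z)" for z w f
    using b_sym[of z "E f w"] by (simp add: b_E)
  define \<Gamma> where "\<Gamma> = {(x1, y1), (x3, y2), (y1, x1), (y2, x3)}"
  have dom: "\<exists>f1 f3 g1 g2. z = (E f1 x1 + E f3 x3) + (E g1 y1 + E g2 y2)"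
    if "z \<in> Domain (twisted_span \<Gamma>)" for z
  proof -
    obtain z' where "(z, z') \<in> twisted_span \<Gamma>" using \<open>z \<in> Domain (twisted_span \<Gamma>)\<close> by blast
    then show ?thesis
    proof (induction rule: twisted_span.induct)
      case zero
      show ?case by (intro exI[of _ 0]) simp
    next
      case (step a a' c c' r)
      then obtain f1 f3 g1 g2 where c: "c = (E f1 x1 + E f3 x3) + (E g1 y1 + E g2 y2)" by blast
      consider "a = x1" | "a = x3" | "a = y1" | "a = y2" using step(1) by (auto simp: \<Gamma>_def)
      then show ?case
      proof cases
        case 1
        then have "E r a + c = (E (r + f1) x1 + E f3 x3) + (E g1 y1 + E g2 y2)"
          using c by (simp add: E_add algebra_simps)
        then show ?thesis by blast
      next
        case 2
        then have "E r a + c = (E f1 x1 + E (r + f3) x3) + (E g1 y1 + E g2 y2)"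
          using c by (simp add: E_add algebra_simps)
        then show ?thesis by blast
      next
        case 3
        then have "E r a + c = (E f1 x1 + E f3 x3) + (E (r + g1) y1 + E g2 y2)"
          using c by (simp add: E_add algebra_simps)
        then show ?thesis by blast
      next
        case 4
        then have "E r a + c = (E f1 x1 + E f3 x3) + (E g1 y1 + E (r + g2) y2)"
          using c by (simp add: E_add algebra_simps)
        then show ?thesis by blast
      qed
    qed
  qed
  have "\<exists>t. sign_map t \<and> range t = Domain (twisted_span \<Gamma>)"
  proof (rule sign_map_of_generators)
    show "(a', a) \<in> \<Gamma>" if "(a, a') \<in> \<Gamma>" for a a' using that by (auto simp: \<Gamma>_def)
    have xs: "b z (E f w) = 0" if "z \<in> {x1, x3}" "w \<in> {x1, x3}" for z w f
      using that x1(2) x3(2) by (auto intro: isox)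
    have ys: "b z (E f w) = 0" if "z \<in> {y1, y2}" "w \<in> {y1, y2}" for z w f
      using that y1(2) y2(2) by (auto intro: isoy)
    have yx: "b y1 (E f x1) = 0" "b y2 (E f x3) = 0"
      "b y1 (E f x3) = - residue_coeff ?m (flip f)" "b y2 (E f x1) = residue_coeff ?m (flip f)" for f
      by (simp_all add: rev[of y1] rev[of y2] x1y1 x3y2 x3y1 y2(3))
    show "b a (E f c) = - b a' (E (flip f) c')" if "(a, a') \<in> \<Gamma>" "(c, c') \<in> \<Gamma>" for a a' c c' f
      using that unfolding \<Gamma>_def
      by (auto simp: xs ys yx x1y1 x3y2 x3y1 y2(3))
    fix z
    assume "z \<in> Domain (twisted_span \<Gamma>)" and orth: "\<And>a f. a \<in> Domain \<Gamma> \<Longrightarrow> b z (E f a) = 0"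
    then obtain f1 f3 g1 g2 where z: "z = (E f1 x1 + E f3 x3) + (E g1 y1 + E g2 y2)" using dom by blast
    have byz: "b z (E r y) = b x1 (E (r * flip f1) y) + b x3 (E (r * flip f3) y)"
      if "y \<in> {y1, y2}" for y r
    proof -
      have "b (E g1 y1) (E r y) = 0" "b (E g2 y2) (E r y) = 0"
        using that by (simp_all add: b_E ys flip: E_mult)
      then show ?thesis by (simp add: z b_simps b_E E_mult E_mult_commute[of r])
    qed
    have bxz': "b z (E (flip r) x) = b x (E (r * g1) y1) + b x (E (r * g2) y2)"
      if "x \<in> {x1, x3}" for x r
    proof -
      have "b z (E (flip r) x) = b x (E r z)" by (simp add: rev[of z])
      also have "\<dots> = b x (E (r * g1) y1) + b x (E (r * g2) y2)"
        using that by (auto simp: z b_simps E_arg_add xs simp flip: E_mult)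
      finally show ?thesis .
    qed
    have "?m dvd g2"
    proof (rule residue_coeff_nondegenerate[OF m0])
      fix r
      show "residue_coeff ?m (r * g2) = 0"
        using orth[of x1 "flip r"] bxz'[of x1 r] by (auto simp: \<Gamma>_def x1y1 y2(3))
    qed
    then have 1: "E g2 y2 = 0" using y2(2) by (rule E_dvd_zero)
    have "?m dvd g1"
    proof (rule residue_coeff_nondegenerate[OF m0])
      fix r
      show "residue_coeff ?m (r * g1) = 0"
        using orth[of x3 "flip r"] bxz'[of x3 r] by (auto simp: \<Gamma>_def x3y1 x3y2)
    qed
    then have 2: "E g1 y1 = 0" using y1(2) by (rule E_dvd_zero)
    have "?m dvd flip f1"
    proof (rule residue_coeff_nondegenerate[OF m0])
      fix r
      show "residue_coeff ?m (r * flip f1) = 0"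
        using orth[of y2 r] byz[of y2 r] by (auto simp: \<Gamma>_def x3y2 y2(3))
    qed
    then have "?n dvd f1" using flip_dvd_flip_iff[of ?m "flip f1"] fm by simp
    then have 3: "E f1 x1 = 0" using x1(2) by (rule E_dvd_zero)
    have "?m dvd flip f3"
    proof (rule residue_coeff_nondegenerate[OF m0])
      fix r
      show "residue_coeff ?m (r * flip f3) = 0"
        using orth[of y1 r] byz[of y1 r] by (auto simp: \<Gamma>_def x1y1 x3y1)
    qed
    then have "?n dvd f3" using flip_dvd_flip_iff[of ?m "flip f3"] fm by simp
    then have 4: "E f3 x3 = 0" using x3(2) by (rule E_dvd_zero)
    show "z = 0" using z 1 2 3 4 by simp
  qed
  then obtain t where t: "sign_map t" "range t = Domain (twisted_span \<Gamma>)" by blast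
  have "s (t z) = 0" for z
  proof -
    have "t z \<in> Domain (twisted_span \<Gamma>)" using rangeI[of t z] by (simp only: t(2))
    then show ?thesis
      using dom[of "t z"] x1(1) x3(1) y1(1) y2(1) by (auto simp: lin sign_map_E[OF s])
  qed
  moreover have "\<exists>z. t z \<noteq> 0"
  proof -
    have "(E 1 x1, E (flip 1) y1) \<in> twisted_span \<Gamma>"
      by (rule twisted_span_base) (simp add: \<Gamma>_def)
    then have "x1 \<in> range t" unfolding t(2) by auto
    moreover have "x1 \<noteq> 0" using x1(3) by auto
    ultimately show ?thesis by (metis imageE)
  qed
  ultimately show ?thesis using t(1) by blast
qed

end

lemma sign_map_step:
  assumes inj: "inj u"
    and lag: "\<And>p k. p \<in> Irr0 \<Longrightarrow> k \<ge> 1 \<Longrightarrow>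
      \<exists>L. stable L \<and> lagrangian (\<lambda>x y. b x (E (p ^ (k - 1)) y)) (primary_kernel scale u p k) L"
    and even: "\<And>p k. p \<in> Irr \<Longrightarrow> k \<ge> 1 \<Longrightarrow>
      \<exists>n. dim (primary_kernel scale u p k) = dim (primary_denominator scale u p k) + 2 * n * degree p"
    and s: "sign_map s" and ker: "s v = 0" "v \<noteq> 0"
  shows "\<exists>r. sign_map r \<and> dim (range r) > dim (range s)"
proof -
  note lin = sign_map_linear[OF s]
  let ?V = "{x. s x = 0}"
  have stV: "stable ?V" by (rule stable_ker_sign_map[OF s])
  obtain p x where p: "p \<in> Irr" and "s x = 0" "x \<noteq> 0" "E p x = 0"
    using exists_irreducible_annihilator[OF stV, of v] ker by auto
  then obtain k x0 where k: "k \<ge> 1" and x0: "s x0 = 0" "E (p ^ k) x0 = 0" "E (p ^ (k - 1)) x0 \<noteq> 0"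
    and top: "\<And>y. s y = 0 \<Longrightarrow> E (p ^ Suc k) y = 0 \<Longrightarrow> E (p ^ k) y = 0"
    using exists_maximal_exponent[OF stV, of x p] by auto
  have irr: "irreducible p" using p by (rule Irr_irreducible)
  have p0: "coeff p 0 \<noteq> 0"
  proof (rule irreducible_coeff_0[OF irr])
    show "\<not> p dvd [:0, 1:]"
    proof
      assume "p dvd [:0, 1:]"
      then have "E [:0, 1:] x = 0" using \<open>E p x = 0\<close> by (rule E_dvd_zero)
      then have "u x = u 0" by (simp only: E_t u.zero)
      then show False using injD[OF inj] \<open>x \<noteq> 0\<close> by blast
    qed
  qed
  let ?K = "primary_kernel scale u p k" and ?D = "primary_denominator scale u p k"
  have "\<exists>t. sign_map t \<and> (\<forall>z. s (t z) = 0) \<and> (\<exists>z. t z \<noteq> 0)"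
  proof (cases "p \<in> Irr0")
    case True
    then have fp: "flip p = p" by (rule Irr0_flip)
    let ?B = "\<lambda>x y. b x (E (p ^ (k - 1)) y)"
    have bil: "bilinear_form scale ?B" by (rule bilinear_form_compose[OF bilinear linear_E])
    have "?B x y = ?B y x" for x y
      using b_sym[of "E (p ^ (k - 1)) x" y] by (simp add: b_E_right fp flip_power)
    then have refl: "reflexive_form ?B" by (auto simp: reflexive_form_def)
    obtain L where L: "stable L" "lagrangian ?B ?K L" using lag[OF True k] by blast
    obtain L1 where L1: "stable L1" "lagrangian ?B (?K \<inter> range s) L1"
      using exists_lagrangian_even[OF s fp] by blast
    let ?K2 = "?K \<inter> ?V" and ?L2 = "(L + L1) \<inter> (?K \<inter> ?V)"
    have L2: "lagrangian ?B ?K2 ?L2"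
    proof (rule lagrangian_cancel[OF _ _ _ _ bil refl _ L(2) L1(2)])
      show "subspace ?K" "subspace (?K \<inter> range s)" "subspace ?K2"
        by (intro stable_subspace stable_Int stable_primary_kernel stable_range_sign_map[OF s] stV)+
      show "?K = (?K \<inter> range s) + ?K2"
        by (rule sign_map_split(1)[OF s stable_subspace[OF stable_primary_kernel]
              sign_map_square_primary_kernel[OF s]])
      show "?B x y = 0" if "x \<in> ?K \<inter> range s" "y \<in> ?K2" for x y
        using that sign_map_orthogonal[OF s, of "E (p ^ (k - 1)) y" x] b_sym
        by (simp add: sign_map_E[OF s])
    qed
    have stL2: "stable ?L2"
      by (intro stable_Int stable_plus L(1) L1(1) stable_primary_kernel stV)
    \<comment> \<open>If \<open>p(u)^(k-1)\<close> killed \<open>?L2\<close>, then \<open>x0\<close>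
      would be orthogonal to \<open>?L2\<close>, hence in it, hence killed as well.\<close>
    have "\<exists>x\<in>?L2. E (p ^ (k - 1)) x \<noteq> 0"
    proof (rule ccontr)
      assume "\<not> (\<exists>x\<in>?L2. E (p ^ (k - 1)) x \<noteq> 0)"
      then have z: "E (p ^ (k - 1)) x = 0" if "x \<in> ?L2" for x using that by blast
      have "x0 \<in> ?L2"
        using x0 z by (intro lagrangian_maximal[OF L2]) (simp_all add: primary_kernel_eq b_simps)
      then show False using z x0(3) by blast
    qed
    then obtain x1 where x1: "x1 \<in> ?L2" "E (p ^ (k - 1)) x1 \<noteq> 0" by blast
    have "b x1 (E (p ^ (k - 1) * f) x1) = 0" for f
      using lagrangian_isotropic[OF L2 x1(1) stable_E[OF stL2 x1(1)], of f] by (simp add: E_mult)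
    moreover have "s x1 = 0" "E (p ^ k) x1 = 0" using x1(1) by (auto simp: primary_kernel_eq)
    ultimately obtain x2 where "s x2 = 0" "E (p ^ k) x2 = 0" "E (p ^ (k - 1)) x2 \<noteq> 0"
      "\<And>f. b x2 (E f x2) = 0"
      using exists_isotropic_generator[OF s irr p0 k top fp, of x1] x1(2) by auto
    then show ?thesis using exists_sign_map_even[OF s irr p0 k top fp, of x2] by blast
  next
    case False
    \<comment> \<open>\<open>p\<close> and \<open>flip p\<close> have the same degree and the same
      non-zero constant coefficient, so divisibility would make them equal and \<open>p\<close>
      even.\<close>
    have odd: "\<not> p dvd flip p"
    proof
      assume "p dvd flip p"
      then obtain c where c: "flip p = p * c" by (rule dvdE)
      have pn0: "p \<noteq> 0" using irr by auto
      then have "c \<noteq> 0" using c by (metis flip_eq_0_iff mult_zero_right)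
      then have "degree c = 0" 
        using arg_cong[OF c, of degree] pn0 by (simp add: degree_mult_eq)
      then obtain a where a: "c = [:a:]" by (rule degree_eq_zeroE)
      then have "flip p = smult a p" using c by simp
      then have "coeff (flip p) 0 = a * coeff p 0" by simp
      then have "a = 1" using p0 by (simp add: coeff_flip)
      then have "flip p = p" using \<open>flip p = smult a p\<close> by simp
      then show False using flip_even_imp_Irr0[OF char p] False by simp
    qed
    let ?D' = "primary_kernel scale u p (k - 1) \<inter> ?V"
    have stD': "stable ?D'" by (intro stable_Int stable_primary_kernel stV)
    \<comment> \<open>In the kernel of \<open>s\<close> no exponent exceeds \<open>k\<close>: after
      projection to that kernel, \<open>c\<close> is killed by \<open>p(u)^k\<close>, so
      \<open>p(u) c\<close> falls into \<open>Ker p(u)^(k-1)\<close>.\<close>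
    have DV: "?D \<inter> ?V = ?D'"
    proof (intro equalityI subsetI)
      fix y assume y: "y \<in> ?D \<inter> ?V"
      then obtain a c where ac: "y = a + E p c" "E (p ^ (k - 1)) a = 0"
        "E (p ^ k) (E p c) = 0"
        unfolding primary_denominator_def by (auto elim!: set_plus_elim simp: primary_kernel_eq)
      let ?q = "\<lambda>z. z - s (s z)"
      have qE: "?q (E f z) = E f (?q z)" for f z by (simp add: E_arg_diff sign_map_square_E[OF s])
      have "E (p ^ Suc k) (?q c) = ?q (E (p ^ k) (E p c))"
        by (simp only: qE[symmetric] power_Suc E_mult E_mult_commute[of p])
      then have "E (p ^ Suc k) (?q c) = 0" using ac(3) by (simp add: lin)
      then have "E (p ^ k) (?q c) = 0"
        by (intro top) (simp_all add: lin sign_map_cube[OF s])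
      moreover have "p ^ k = p ^ (k - 1) * p" using k by (cases k) simp_all
      ultimately have "E (p ^ (k - 1)) (E p (?q c)) = 0" by (simp add: E_mult)
      moreover have "E (p ^ (k - 1)) (?q a) = 0" using ac(2) qE[of "p ^ (k - 1)" a] by (simp add: lin)
      moreover have "y = ?q a + E p (?q c)"
      proof -
        have "y = ?q y" using y by (simp add: lin)
        also have "\<dots> = ?q a + ?q (E p c)" unfolding ac(1) by (simp add: lin)
        finally show ?thesis by (simp only: qE)
      qed
      ultimately have "E (p ^ (k - 1)) y = 0" by (simp only: E_arg_add add_0_left)
      then show "y \<in> ?D'" using y by (simp add: primary_kernel_eq)
    qed (use primary_kernel_pred_subset in blast)
    obtain m where m: "dim (?K \<inter> ?V) = dim ?D' + 2 * m * degree p"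
      using dim_primary_ker_even[OF s irr k] even[OF p k] DV by metis
    have pK: "E p x \<in> ?D'" if "x \<in> ?K \<inter> ?V" for x
      using that E_primary_kernel[OF k] stable_E[OF stV] by blast
    have x0K: "x0 \<in> ?K \<inter> ?V" "x0 \<notin> ?D'" using x0 by (auto simp: primary_kernel_eq)
    have dim: "dim (?D' + cyc x0) = dim ?D' + degree p"
      by (rule dim_plus_cyc[OF irr stD' pK[OF x0K(1)] x0K(2)])
    have D'K: "?D' \<subseteq> ?K \<inter> ?V" using primary_kernel_mono[of "k - 1" k p] by auto
    have sub: "?D' + cyc x0 \<subseteq> ?K \<inter> ?V"
      by (intro set_plus_least stable_subspace stable_Int stable_primary_kernel stV D'K cyc_subset x0K)
    \<comment> \<open>The multiplicity is even, hence not 1, and \<open>x0\<close> alone cannot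
      generate \<open>?K \<inter> ?V\<close> over \<open>?D'\<close>.\<close>
    have "dim (?K \<inter> ?V) \<noteq> dim ?D' + degree p"
      using m degree_irreducible_pos[OF irr] by (cases m) auto
    then have "?D' + cyc x0 \<noteq> ?K \<inter> ?V" using dim by metis
    then obtain x2 where x2: "x2 \<in> ?K \<inter> ?V" "x2 \<notin> ?D' + cyc x0" using sub by blast
    have "E (p ^ (k - 1)) (x2 - E f x0) \<noteq> 0" for f
    proof
      assume "E (p ^ (k - 1)) (x2 - E f x0) = 0"
      moreover have "s (x2 - E f x0) = 0" using x2 x0 by (simp add: lin sign_map_E[OF s])
      ultimately have "x2 - E f x0 \<in> ?D'" by (simp add: primary_kernel_eq)
      then have "(x2 - E f x0) + E f x0 \<in> ?D' + cyc x0" by (intro set_plus_intro) simp_all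
      then show False using x2 by simp
    qed
    then show ?thesis
      using x2 exists_sign_map_odd[OF s irr p0 k top odd x0, of x2] by (simp add: primary_kernel_eq)
  qed
  then obtain t z where t: "sign_map t" "\<And>z. s (t z) = 0" "t z \<noteq> 0" by blast
  then show ?thesis by (intro sign_map_extend[OF s t(1)]) auto
qed

lemma exists_invertible_sign_map:
  assumes inj: "inj u"
    and lag: "\<And>p k. p \<in> Irr0 \<Longrightarrow> k \<ge> 1 \<Longrightarrow>
      \<exists>L. stable L \<and> lagrangian (\<lambda>x y. b x (E (p ^ (k - 1)) y)) (primary_kernel scale u p k) L"
    and even: "\<And>p k. p \<in> Irr \<Longrightarrow> k \<ge> 1 \<Longrightarrow>
      \<exists>n. dim (primary_kernel scale u p k) = dim (primary_denominator scale u p k) + 2 * n * degree p"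
  shows "\<exists>s. sign_map s \<and> (\<forall>x. s (s x) = x)"
proof -
  have "dim (range s) < Suc (dim UNIV)" for s :: "'v \<Rightarrow> 'v"
    using dim_subset[OF subset_UNIV, of "range s"] by (simp only: less_Suc_eq_le)
  then obtain s where s: "sign_map s" and max: "\<And>r. sign_map r \<Longrightarrow> dim (range r) \<le> dim (range s)"
    using ex_has_greatest_nat[of sign_map "\<lambda>_. 0" "\<lambda>s. dim (range s)" "Suc (dim UNIV)"]
      sign_map_zero by blast
  have "s (s x) = x" for x
  proof -
    have "s (x - s (s x)) = 0" by (simp add: sign_map_linear[OF s] sign_map_cube[OF s])
    then have "x - s (s x) = 0"
      using sign_map_step[OF inj lag even s] max by (meson not_le)
    then show ?thesis by simp
  qed
  then show ?thesis using s by blast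
qed

text \<open>The correspondence is \<open>s = u^{-1} (a2 - a1)\<close>, with inverse \<open>a1 = u (1 - s) / 2\<close> and
  \<open>a2 = u (1 + s) / 2\<close>.\<close>

lemma sum_of_square_zero_iff_sign_map:
  assumes bij: "bij u"
  shows "(\<exists>a1 a2. Vector_Spaces.linear scale scale a1 \<and> Vector_Spaces.linear scale scale a2 \<and>
      skew_selfadjoint b a1 \<and> skew_selfadjoint b a2 \<and>
      (\<forall>x. a1 (a1 x) = 0) \<and> (\<forall>x. a2 (a2 x) = 0) \<and> (\<forall>x. u x = a1 x + a2 x)) \<longleftrightarrow>
    (\<exists>s. sign_map s \<and> (\<forall>x. s (s x) = x))"
    (is "?lhs \<longleftrightarrow> ?rhs")
proof
  assume ?lhs
  then obtain a1 a2 where lin: "\<And>x y. a1 (x + y) = a1 x + a1 y" "\<And>c x. a1 (scale c x) = scale c (a1 x)"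
      "\<And>x y. a2 (x + y) = a2 x + a2 y" "\<And>c x. a2 (scale c x) = scale c (a2 x)"
    and sk: "\<And>x y. b (a1 x) y = - b x (a1 y)" "\<And>x y. b (a2 x) y = - b x (a2 y)"
    and sq: "\<And>x. a1 (a1 x) = 0" "\<And>x. a2 (a2 x) = 0" and u: "\<And>x. u x = a1 x + a2 x"
    by (auto simp: linear_self_iff skew_selfadjoint_def)
  have neg: "a1 (- x) = - a1 x" "a2 (- x) = - a2 x" for x
    using lin(2)[of "- 1" x] lin(4)[of "- 1" x] by simp_all
  have diff: "a1 (x - y) = a1 x - a1 y" "a2 (x - y) = a2 x - a2 y" for x y
    using lin(1)[of x "- y"] lin(3)[of x "- y"] by (simp_all add: neg)
  have inj: "x = y" if "u x = u y" for x y using that bij by (auto simp: bij_def inj_eq)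
  have surj: "\<exists>y. x = u y" for x using bij by (metis bij_pointE)
  define s where "s x = inv_into UNIV u (a2 x - a1 x)" for x
  have us: "u (s x) = a2 x - a1 x" for x
    unfolding s_def using bij by (simp add: bij_is_surj surj_f_inv_f)
  have "s (x + y) = s x + s y" for x y
    by (rule inj) (simp only: us u.add lin, simp)
  moreover have "s (scale c x) = scale c (s x)" for c x
    by (rule inj) (simp only: us u.scale lin scale_right_diff_distrib)
  moreover have su: "s (u x) = - u (s x)" for x
    by (rule inj) (simp only: us u.neg, simp add: u lin diff sq)
  moreover have ss: "s (s x) = x" for x
  proof -
    \<comment> \<open>As the squares vanish, \<open>(a2 - a1)^2 = - (a1 a2 + a2 a1) = - u^2\<close>,
      and \<open>u s = a2 - a1\<close>.\<close>
    have "u (u (s (s x))) = - u (s (u (s x)))" by (simp add: su u.neg)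
    also have "\<dots> = u (u x)" by (simp only: us, simp only: u lin diff sq, simp)
    finally show ?thesis using inj by blast
  qed
  moreover have "b (s x) y = - b x (s y)" for x y
  proof -
    obtain z where z: "y = u z" using surj by blast
    have "b (s x) y = - b (u (s x)) z" by (simp add: z b_u)
    also have "\<dots> = b x (u (s z))" by (simp add: us b_simps sk)
    also have "\<dots> = - b x (s y)" by (simp add: z su b_simps)
    finally show ?thesis .
  qed
  ultimately have "sign_map s" unfolding sign_map_def linear_self_iff by simp
  then show ?rhs using ss by blast
next
  assume ?rhs
  then obtain s where s: "sign_map s" and ss: "\<And>x. s (s x) = x" by blast
  note lin = sign_map_linear[OF s] and su = sign_map_u[OF s] and sb = sign_map_skew[OF s]
  define a1 where "a1 x = scale (1 / 2) (u (x - s x))" for x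
  define a2 where "a2 x = scale (1 / 2) (u (x + s x))" for x
  have half: "scale (1 / 2) x + scale (1 / 2) x = x" for x
    using scale_left_distrib[of "1 / 2" "1 / 2" x] two_neq_0 by simp
  have "Vector_Spaces.linear scale scale a1" "Vector_Spaces.linear scale scale a2"
    unfolding linear_self_iff a1_def a2_def
    by (simp_all add: lin u.add u.diff u.scale scale_right_distrib scale_right_diff_distrib mult.commute)
  moreover have "skew_selfadjoint b a1" "skew_selfadjoint b a2"
    unfolding skew_selfadjoint_def a1_def a2_def
    by (simp_all add: u.add u.diff b_simps b_u sb su algebra_simps)
  moreover have "a1 (a1 x) = 0" "a2 (a2 x) = 0" for x
  proof -
    \<comment> \<open>\<open>a1\<close> maps into the eigenspace of \<open>s\<close> for 1, where it
      vanishes, and \<open>a2\<close> into that for -1, where it vanishes too.\<close>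
    have "s (a1 x) = a1 x" "s (a2 x) = - a2 x"
      by (simp_all add: a1_def a2_def lin su ss u.add u.diff flip: scale_minus_right)
    then show "a1 (a1 x) = 0" "a2 (a2 x) = 0"
      by (simp_all add: a1_def[of "a1 x"] a2_def[of "a2 x"] u.zero)
  qed
  moreover have "u x = a1 x + a2 x" for x
  proof -
    have "a1 x + a2 x = scale (1 / 2) (u x) + scale (1 / 2) (u x)"
      unfolding a1_def a2_def by (simp add: u.add u.diff scale_right_distrib scale_right_diff_distrib)
    then show ?thesis by (simp add: half)
  qed
  ultimately show ?lhs by blast
qed

end

section \<open>Residue fields and Hermitian invariants\<close>

lemma image_eq_singletonI: "a \<in> A \<Longrightarrow> (\<And>x. x \<in> A \<Longrightarrow> f x = c) \<Longrightarrow> f ` A = {c}"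
  by auto

definition residue_class :: "'a::field poly \<Rightarrow> 'a poly \<Rightarrow> 'a poly set" where
  "residue_class p f = {g. p dvd g - f}"

lemma in_residue_class_self [simp]: "f \<in> residue_class p f"
  by (simp add: residue_class_def)

lemma residue_class_eq_iff: "residue_class p f = residue_class p g \<longleftrightarrow> p dvd f - g"
proof
  assume "residue_class p f = residue_class p g"
  then have "f \<in> residue_class p g" using in_residue_class_self by blast
  then show "p dvd f - g" by (simp add: residue_class_def)
next
  assume fg: "p dvd f - g"
  have "p dvd h - f \<longleftrightarrow> p dvd h - g" for h
    using dvd_add_left_iff[OF fg, of "h - f"] by (simp add: algebra_simps)
  then show "residue_class p f = residue_class p g" by (simp add: residue_class_def)
qed

lemma
  fixes p :: "'a::field poly"
  shows carrier_residue_field: "carrier (residue_field p) = range (residue_class p)"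
    and mult_residue_field:
      "residue_class p f \<otimes>\<^bsub>residue_field p\<^esub> residue_class p g = residue_class p (f * g)"
    and add_residue_field:
      "residue_class p f \<oplus>\<^bsub>residue_field p\<^esub> residue_class p g = residue_class p (f + g)"
    and zero_residue_field: "\<zero>\<^bsub>residue_field p\<^esub> = residue_class p 0"
    and one_residue_field: "\<one>\<^bsub>residue_field p\<^esub> = residue_class p 1"
    and cring_residue_field: "cring (residue_field p)"
proof -
  let ?R = "ring_of_type_algebra :: 'a poly ring"
  let ?I = "PIdl\<^bsub>?R\<^esub> p"
  interpret R: cring ?R by (rule cring_from_type_algebra)
  interpret I: ideal ?I ?R by (rule R.cgenideal_ideal) (simp add: ring_of_type_algebra_def)
  have coset: "?I +>\<^bsub>?R\<^esub> f = residue_class p f" for f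
  proof -
    have "?I = {g. p dvd g}"
      by (auto simp: cgenideal_def ring_of_type_algebra_def dvd_def mult.commute)
    moreover have "?I +>\<^bsub>?R\<^esub> f = (\<lambda>h. h + f) ` ?I"
      by (auto simp: a_r_coset_def' ring_of_type_algebra_def)
    moreover have "g \<in> (\<lambda>h. h + f) ` {h. p dvd h} \<longleftrightarrow> p dvd g - f" for g
      using image_eqI[of g "\<lambda>h. h + f" "g - f" "{h. p dvd h}"] by auto
    ultimately show ?thesis by (auto simp: residue_class_def)
  qed
  show "carrier (residue_field p) = range (residue_class p)"
    unfolding residue_field_def FactRing_def A_RCOSETS_def' coset
    by (auto simp: ring_of_type_algebra_def)
  show "residue_class p f \<otimes>\<^bsub>residue_field p\<^esub> residue_class p g = residue_class p (f * g)"
    using I.rcoset_mult_add[of f g]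
    by (simp add: residue_field_def FactRing_def coset) (simp add: ring_of_type_algebra_def)
  show "residue_class p f \<oplus>\<^bsub>residue_field p\<^esub> residue_class p g = residue_class p (f + g)"
    using I.a_rcos_sum[of f g]
    by (simp add: residue_field_def FactRing_def coset) (simp add: ring_of_type_algebra_def)
  show "\<zero>\<^bsub>residue_field p\<^esub> = residue_class p 0"
    using coset[of 0] by (auto simp: residue_field_def FactRing_def a_r_coset_def' ring_of_type_algebra_def)
  show "\<one>\<^bsub>residue_field p\<^esub> = residue_class p 1"
    using coset[of 1] by (simp add: residue_field_def FactRing_def ring_of_type_algebra_def)
  show "cring (residue_field p)"
    unfolding residue_field_def by (rule I.quotient_is_cring) (rule R.is_cring)
qed

lemma field_residue_field:
  fixes p :: "'a::field poly"
  assumes p: "irreducible p"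
  shows "field (residue_field p)"
proof -
  interpret cring "residue_field p" by (rule cring_residue_field)
  show ?thesis
  proof (rule cring_fieldI2)
    show "\<zero>\<^bsub>residue_field p\<^esub> \<noteq> \<one>\<^bsub>residue_field p\<^esub>"
      using p by (auto simp: zero_residue_field one_residue_field residue_class_eq_iff irreducible_def)
    fix a assume "a \<in> carrier (residue_field p)" "a \<noteq> \<zero>\<^bsub>residue_field p\<^esub>"
    then obtain f where a: "a = residue_class p f" by (auto simp: carrier_residue_field)
    then have f: "a = residue_class p f" "\<not> p dvd f"
      using \<open>a \<noteq> \<zero>\<^bsub>residue_field p\<^esub>\<close> by (simp_all add: zero_residue_field residue_class_eq_iff)
    obtain c d where cd: "c * p + d * f = 1" using irreducible_bezout[OF p f(2)] by blast
    have "f * d - 1 = p * (- c)" using cd by (simp add: algebra_simps eq_diff_eq)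
    then have "a \<otimes>\<^bsub>residue_field p\<^esub> residue_class p d = \<one>\<^bsub>residue_field p\<^esub>"
      by (simp add: f mult_residue_field one_residue_field residue_class_eq_iff)
    then show "\<exists>c\<in>carrier (residue_field p). a \<otimes>\<^bsub>residue_field p\<^esub> c = \<one>\<^bsub>residue_field p\<^esub>"
      by (auto simp: carrier_residue_field)
  qed
qed

lemma residue_form_class: "residue_form p (residue_class p f) = residue_coeff p f"
proof -
  have "(\<lambda>q. coeff (q mod p) 0) ` residue_class p f = {residue_coeff p f}"
    using residue_coeff_cong[of p] in_residue_class_self[of f p]
    by (fastforce simp: residue_class_def residue_coeff_def)
  then show ?thesis by (simp add: residue_form_def)
qed

lemma residue_involution_class:
  assumes "flip p = p"
  shows "residue_involution (residue_class p f) = residue_class p (flip f)"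
proof -
  have *: "flip g \<in> residue_class p (flip f)" if "g \<in> residue_class p f" for f g
    using that flip_dvd_flip_iff[of p "g - f"] assms by (simp add: residue_class_def flip_diff)
  have "residue_involution (residue_class p f) = flip ` residue_class p f"
    by (simp add: residue_involution_def flip_def)
  also have "\<dots> = residue_class p (flip f)"
  proof (intro equalityI subsetI)
    fix g assume "g \<in> residue_class p (flip f)"
    then have "flip g \<in> residue_class p f" using *[of g "flip f"] by simp
    then have "flip (flip g) \<in> flip ` residue_class p f" by (rule imageI)
    then show "g \<in> flip ` residue_class p f" by simp
  qed (use * in blast)
  finally show ?thesis .
qed

section \<open>\<open>V_{p,k}\<close> as a vector space over \<open>F[t]/(p)\<close>, and Jordan
  numbers\<close>

context endomorphism
begin

context
  fixes p :: "'a poly" and k :: nat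
  assumes p: "irreducible p" and k: "k \<ge> 1"
begin

abbreviation "K \<equiv> primary_kernel scale u p k"
abbreviation "D \<equiv> primary_denominator scale u p k"
abbreviation "coset \<equiv> (\<lambda>x. x +o D)"
abbreviation "M \<equiv> primary_quotient scale u p k"
abbreviation "R \<equiv> residue_field p"

declare set_zero_plus [simp del]

lemma D_subspace: "subspace D" and K_subspace: "subspace K"
  by (intro stable_subspace stable_primary_denominator stable_primary_kernel)+

lemma coset_eq_iff: "coset x = coset y \<longleftrightarrow> x - y \<in> D"
proof
  assume "coset x = coset y"
  moreover have "x + 0 \<in> coset x" by (rule set_plus_intro2) (rule subspace_0[OF D_subspace])
  ultimately have "x \<in> coset y" by simp
  then show "x - y \<in> D" by (simp add: set_minus_plus)
next
  assume xy: "x - y \<in> D"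
  have "z - x \<in> D \<longleftrightarrow> z - y \<in> D" for z
    using subspace_add[OF D_subspace, of "z - x" "x - y"] xy
      subspace_diff[OF D_subspace, of "z - y" "x - y"] by auto
  then show "coset x = coset y" by (auto simp: set_minus_plus[symmetric])
qed

lemma in_coset_iff: "y \<in> coset x \<longleftrightarrow> y - x \<in> D"
  by (simp add: set_minus_plus)

lemma carrier_M: "carrier M = coset ` K"
  by (simp add: primary_quotient_def Let_def)

lemma zero_M: "\<zero>\<^bsub>M\<^esub> = coset 0"
  by (simp add: primary_quotient_def Let_def set_zero_plus)

lemma add_M: "coset x \<oplus>\<^bsub>M\<^esub> coset y = coset (x + y)"
proof -
  have "D + D = D"
    using set_plus_least[OF D_subspace order_refl order_refl]
      subset_set_plus_left[OF D_subspace, of D] by blast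
  then show ?thesis by (simp add: primary_quotient_def Let_def set_plus_rearrange)
qed

text \<open>The union over representatives collapses to one coset, because \<open>p(u)\<close> maps
  \<open>K\<close> into \<open>D\<close> and \<open>D\<close> is stable.\<close>

lemma smult_M:
  assumes x: "x \<in> K"
  shows "residue_class p f \<odot>\<^bsub>M\<^esub> coset x = coset (E f x)"
proof -
  have "coset (E g y) = coset (E f x)" if g: "g \<in> residue_class p f" and y: "y \<in> coset x" for g y
  proof -
    obtain h where h: "g - f = h * p" using g by (auto simp: residue_class_def dvd_def mult.commute)
    have "E g y - E f x = E g (y - x) + E (g - f) x" by (simp add: E_arg_diff E_diff)
    also have "\<dots> = E g (y - x) + E h (E p x)" by (simp add: h E_mult)
    also have "\<dots> \<in> D"
    proof (rule subspace_add[OF D_subspace])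
      show "E g (y - x) \<in> D"
        using y by (intro stable_E[OF stable_primary_denominator]) (simp add: in_coset_iff)
      show "E h (E p x) \<in> D"
        by (rule stable_E[OF stable_primary_denominator E_primary_denominator[OF k x]])
    qed
    finally show ?thesis by (simp only: coset_eq_iff)
  qed
  moreover have "x \<in> coset x" by (simp add: in_coset_iff subspace_0[OF D_subspace])
  moreover have "residue_class p f \<odot>\<^bsub>M\<^esub> coset x = (\<Union>g\<in>residue_class p f. \<Union>y\<in>coset x. coset (E g y))"
    by (simp add: primary_quotient_def Let_def)
  moreover have "f \<in> residue_class p f" by simp
  ultimately show ?thesis by blast
qed

text \<open>A general \<open>U\<close> between \<open>D\<close> and \<open>K\<close> is allowed
  because the totally isotropic subspaces of \<open>V_{p,k}\<close> need a dimension as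
  well.\<close>

lemma vectorspace_part:
  assumes U: "stable U" "D \<subseteq> U" "U \<subseteq> K"
  shows "vectorspace R (M\<lparr>carrier := coset ` U\<rparr>)"
proof -
  have UK: "x \<in> K" if "x \<in> U" for x using that U by blast
  have sU: "subspace U" using U(1) by (rule stable_subspace)
  have E_K: "E f x \<in> K" if "x \<in> K" for f x using that by (rule stable_E[OF stable_primary_kernel])
  have add_K: "x + y \<in> K" if "x \<in> K" "y \<in> K" for x y using that by (rule subspace_add[OF K_subspace])
  show ?thesis
  proof (rule vs_criteria)
    show "field R" using p by (rule field_residue_field)
  qed (auto simp: zero_M add_M UK E_K add_K smult_M carrier_residue_field mult_residue_field
      one_residue_field add_residue_field E_mult E_add E_arg_add add_ac
      intro!: imageI subspace_0[OF sU] subspace_add[OF sU] stable_E[OF U(1)] subspace_neg[OF sU]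
        bexI[of _ "- _"])
qed

lemma vectorspace_M: "vectorspace R M"
proof -
  have "M\<lparr>carrier := coset ` K\<rparr> = M" by (simp add: primary_quotient_def Let_def)
  then show ?thesis
    using vectorspace_part[OF stable_primary_kernel primary_denominator_subset order_refl] by simp
qed

text \<open>\<open>T\<close> is the preimage of \<open>S\<close> in \<open>U\<close>; closure of
  \<open>S\<close> under scalars is closure of \<open>T\<close> under every
  \<open>f(u)\<close>.\<close>

lemma submodule_obtain:
  assumes U: "stable U" "D \<subseteq> U" "U \<subseteq> K" and S: "submodule R S (M\<lparr>carrier := coset ` U\<rparr>)"
  shows "\<exists>T. stable T \<and> D \<subseteq> T \<and> T \<subseteq> U \<and> S = coset ` T"
proof -
  interpret S: submodule R S "M\<lparr>carrier := coset ` U\<rparr>" by (rule S)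
  define T where "T = {x \<in> U. coset x \<in> S}"
  have zero: "coset 0 \<in> S" using S.zero_closed by (simp add: zero_M)
  have sU: "subspace U" using U(1) by (rule stable_subspace)
  have "stable T"
  proof (rule stableI)
    show "0 \<in> T" using zero by (simp add: T_def subspace_0[OF sU])
    show "x + y \<in> T" if "x \<in> T" "y \<in> T" for x y
      using that S.m_closed[of "coset x" "coset y"] by (simp add: T_def add_M subspace_add[OF sU])
    show "E f x \<in> T" if "x \<in> T" for f x
      using that S.smult_closed[of "residue_class p f" "coset x"] U
      by (auto simp: T_def smult_M carrier_residue_field stable_E)
  qed
  moreover have "D \<subseteq> T"
  proof
    fix x assume x: "x \<in> D"
    then have "coset x = coset 0" by (subst coset_eq_iff) simp
    then show "x \<in> T" using x zero U(2) by (auto simp: T_def)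
  qed
  moreover have "S = coset ` T"
  proof (intro equalityI subsetI)
    fix A assume A: "A \<in> S"
    moreover have "A \<in> coset ` U" using S.subset A by (simp add: subset_iff)
    ultimately show "A \<in> coset ` T" unfolding T_def by blast
  qed (unfold T_def, blast)
  moreover have "T \<subseteq> U" unfolding T_def by blast
  ultimately show ?thesis by blast
qed

lemma submodule_part:
  assumes U: "stable U" "D \<subseteq> U" "U \<subseteq> K" and T: "stable T" "D \<subseteq> T" "T \<subseteq> U"
  shows "submodule R (coset ` T) (M\<lparr>carrier := coset ` U\<rparr>)"
proof (rule submodule.intro)
  have sT: "subspace T" using T(1) by (rule stable_subspace)
  interpret V: vectorspace R "M\<lparr>carrier := coset ` U\<rparr>" by (rule vectorspace_part[OF U])
  show "module R (M\<lparr>carrier := coset ` U\<rparr>)" by (rule V.module_axioms)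
  show "coset ` T \<subseteq> carrier (M\<lparr>carrier := coset ` U\<rparr>)" using T(3) by auto
  show "v \<oplus>\<^bsub>M\<lparr>carrier := coset ` U\<rparr>\<^esub> w \<in> coset ` T" if "v \<in> coset ` T" "w \<in> coset ` T" for v w
    using that by (auto simp: add_M intro!: imageI subspace_add[OF sT])
  show "\<zero>\<^bsub>M\<lparr>carrier := coset ` U\<rparr>\<^esub> \<in> coset ` T"
    by (auto simp: zero_M intro!: imageI subspace_0[OF sT])
  show "c \<odot>\<^bsub>M\<lparr>carrier := coset ` U\<rparr>\<^esub> v \<in> coset ` T" if "c \<in> carrier R" "v \<in> coset ` T" for c v
    using that T U by (auto simp: carrier_residue_field smult_M subset_iff intro!: imageI stable_E)
qed

lemma coset_image_subset_iff:
  assumes "stable T" "D \<subseteq> T"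
  shows "coset ` S \<subseteq> coset ` T \<longleftrightarrow> S \<subseteq> T"
proof
  assume sub: "coset ` S \<subseteq> coset ` T"
  show "S \<subseteq> T"
  proof
    fix x assume "x \<in> S"
    then obtain y where "y \<in> T" "x - y \<in> D" using sub by (auto simp: coset_eq_iff)
    then show "x \<in> T"
      using subspace_add[OF stable_subspace[OF assms(1)], of "x - y" y] assms(2) by auto
  qed
qed blast

text \<open>The stable generators of \<open>U\<close> over \<open>D\<close> give a generating set of
  size at most \<open>n\<close>. Conversely, lifting any generating set to \<open>U\<close> shows
  that it has at least \<open>n\<close> elements.\<close>

lemma dim_part:
  assumes U: "stable U" "D \<subseteq> U" "U \<subseteq> K"
  shows "dim U = dim D + vectorspace.dim R (M\<lparr>carrier := coset ` U\<rparr>) * degree p"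
proof -
  let ?N = "M\<lparr>carrier := coset ` U\<rparr>"
  have carrier_N: "carrier ?N = coset ` U" by simp
  interpret V: vectorspace R ?N by (rule vectorspace_part[OF U])
  have pU: "E p x \<in> D" if "x \<in> U" for x using that U(3) E_primary_denominator[OF k] by blast
  obtain n G where G: "finite G" "G \<subseteq> U" "card G \<le> n" "dim U = dim D + n * degree p"
    and gen: "\<And>T. stable T \<Longrightarrow> D \<subseteq> T \<Longrightarrow> G \<subseteq> T \<Longrightarrow> U \<subseteq> T"
    using exists_stable_generators[OF p stable_primary_denominator U(1,2) pU] by blast
  have lower: "n \<le> card A" if A: "finite A" "A \<subseteq> carrier ?N" "V.gen_set A" for A
  proof -
    have "A \<subseteq> coset ` U" using A(2) by simp
    then obtain H where H: "H \<subseteq> U" "inj_on coset H" "A = coset ` H"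
      unfolding subset_image_inj by blast
    have fin: "finite H" using A(1) H(2,3) finite_imageD by blast
    obtain T where T: "stable T" "D \<subseteq> T" "T \<subseteq> U" "H \<subseteq> T" "dim T \<le> dim D + card H * degree p"
      using dim_stable_generated_le[OF p stable_primary_denominator U(1,2) pU fin H(1)] by blast
    have "V.span A \<subseteq> coset ` T"
      using T(4) by (intro V.span_is_subset submodule_part[OF U T(1-3)]) (auto simp: H(3))
    then have "coset ` U \<subseteq> coset ` T" unfolding A(3) carrier_N .
    then have "U \<subseteq> T" by (simp only: coset_image_subset_iff[OF T(1,2)])
    then have "n * degree p \<le> card H * degree p" using T(3,5) G(4) by simp
    moreover have "card H = card A" using H(2,3) by (simp add: card_image)
    ultimately show ?thesis using degree_irreducible_pos[OF p] by simp
  qed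
  have sub: "coset ` G \<subseteq> carrier ?N" using G(2) by auto
  obtain T where T: "stable T" "D \<subseteq> T" "T \<subseteq> U" "V.span (coset ` G) = coset ` T"
    using submodule_obtain[OF U V.span_is_submodule[OF sub]] by blast
  have "coset ` G \<subseteq> coset ` T" using V.in_own_span[OF sub] unfolding T(4) .
  then have "G \<subseteq> T" by (simp only: coset_image_subset_iff[OF T(1,2)])
  then have "U \<subseteq> T" by (rule gen[OF T(1,2)])
  then have gens: "V.gen_set (coset ` G)" unfolding T(4) carrier_N using T(3) by blast
  have "card (coset ` G) = n"
    using lower[OF _ sub gens] G(1,3) card_image_le[OF G(1), of coset] by simp
  then have "V.dim = n"
    unfolding V.dim_def using lower gens sub G(1)
    by (intro Least_equality) auto
  then show ?thesis using G(4) by simp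
qed

lemma jordan_number_dim: "dim K = dim D + jordan_number scale u p k * degree p"
proof -
  have "M\<lparr>carrier := coset ` K\<rparr> = M" by (simp add: primary_quotient_def Let_def)
  then show ?thesis
    using dim_part[OF stable_primary_kernel primary_denominator_subset order_refl]
    by (simp add: jordan_number_def)
qed

lemma even_jordan_number_iff:
  "even (jordan_number scale u p k) \<longleftrightarrow> (\<exists>n. dim K = dim D + 2 * n * degree p)"
  unfolding jordan_number_dim using degree_irreducible_pos[OF p] by (auto simp: dvd_def)

end

end

section \<open>The Hermitian invariants and their Lagrangians\<close>

context skew_pair
begin

text \<open>A divisor of \<open>t\<close> of positive degree has degree 1, but an even polynomial
  has no linear term. Hence \<open>e_p\<close> is non-degenerate.\<close>

lemma Irr0_coeff_0:
  fixes p :: "'a poly"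
  assumes "p \<in> Irr0"
  shows "coeff p 0 \<noteq> 0"
proof -
  have irr: "irreducible p" using assms Irr0_Irr Irr_irreducible by blast
  have "\<not> p dvd [:0, 1:]"
  proof
    assume "p dvd [:0, 1:]"
    then have "degree p \<le> degree [:0, 1 :: 'a:]" by (rule dvd_imp_degree_le) simp
    then have deg: "degree p = 1" using degree_irreducible_pos[OF irr] by simp
    have "coeff p 1 = - coeff p 1" using Irr0_flip[OF assms] coeff_flip[of p 1] by simp
    then have "coeff p 1 = 0" by (rule double_eq_0)
    then show False using deg by (metis degree_0 leading_coeff_0_iff zero_neq_one)
  qed
  then show ?thesis by (rule irreducible_coeff_0[OF irr])
qed

context
  fixes p :: "'a poly" and k :: nat
  assumes p: "p \<in> Irr0" and k: "k \<ge> 1"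
begin

declare One_nat_def [simp del]

lemma p_irreducible: "irreducible p" and flip_p: "flip p = p"
  using p Irr0_Irr Irr_irreducible Irr0_flip by blast+

abbreviation "Kp \<equiv> primary_kernel scale u p k"
abbreviation "Dp \<equiv> primary_denominator scale u p k"
abbreviation "cosetp \<equiv> (\<lambda>x. x +o Dp)"
abbreviation "Mp \<equiv> primary_quotient scale u p k"
abbreviation "Hp \<equiv> hermitian_invariant scale b u p k"
abbreviation "N \<equiv> E (p ^ (k - 1))"

lemma form_sym: "b x (N y) = b y (N x)"
proof -
  have "b x (N y) = b (N x) y" by (simp add: b_E_right flip_p flip_power)
  also have "\<dots> = b y (N x)" by (rule b_sym)
  finally show ?thesis .
qed

lemma form_denominator: "x \<in> Dp \<Longrightarrow> y \<in> Kp \<Longrightarrow> b x (N y) = 0"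
  using mem_primary_denominator_iff[OF k, of x p] by (simp add: flip_p)

lemma induced_form_coset:
  assumes "x \<in> Kp" "y \<in> Kp"
  shows "induced_form scale b u p k (cosetp x) (cosetp y) = b x (N y)"
proof -
  have eq: "b x' (N y') = b x (N y)" if "x' \<in> cosetp x" "y' \<in> cosetp y" for x' y'
  proof -
    have d: "x' - x \<in> Dp" "y' - y \<in> Dp" using that by (simp_all add: set_minus_plus)
    have "y' = y + (y' - y)" by simp
    also have "\<dots> \<in> Kp"
      using d assms(2) primary_denominator_subset[of p k]
      by (intro subspace_add[OF stable_subspace[OF stable_primary_kernel]]) auto
    finally have "b (x' - x) (N y') = 0" using d(1) by (rule form_denominator[rotated])
    moreover have "b x (N (y' - y)) = 0"
      using form_denominator[OF d(2) assms(1)] form_sym by metis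
    ultimately show ?thesis by (simp add: b_simps E_arg_diff)
  qed
  have "0 \<in> Dp" by (rule subspace_0[OF stable_subspace[OF stable_primary_denominator]])
  then have "x \<in> cosetp x" "y \<in> cosetp y" by (simp_all add: set_minus_plus[symmetric])
  then have "(x, y) \<in> cosetp x \<times> cosetp y" by blast
  then have "(\<lambda>(x, y). b x (N y)) ` (cosetp x \<times> cosetp y) = {b x (N y)}"
  proof (intro image_eq_singletonI)
    fix z assume "z \<in> cosetp x \<times> cosetp y"
    then obtain x' y' where "z = (x', y')" "x' \<in> cosetp x" "y' \<in> cosetp y" by blast
    then show "(case z of (x, y) \<Rightarrow> b x (N y)) = b x (N y)" using eq by (simp only: split_conv)
  qed
  then show ?thesis by (simp add: induced_form_def E_power)
qed

text \<open>Uniqueness in the definite description is non-degeneracy of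
  \<open>(f, g) \<mapsto> e_p(f g)\<close>. The algebraic laws of the invariant are verified through
  this criterion, by naming a representing polynomial.\<close>

lemma hermitian_invariant_eqI:
  assumes xy: "x \<in> Kp" "y \<in> Kp" and g: "\<And>f. b x (N (E f y)) = residue_coeff p (f * g)"
  shows "Hp (cosetp x) (cosetp y) = residue_class p g"
  unfolding hermitian_invariant_def
proof (rule the_equality)
  have *: "induced_form scale b u p k (cosetp x) (residue_class p f \<odot>\<^bsub>Mp\<^esub> cosetp y) = residue_coeff p (f * g)" for f
    using induced_form_coset[OF xy(1) stable_E[OF stable_primary_kernel xy(2)]] xy
    by (simp add: smult_M[OF p_irreducible k] g)
  show "residue_class p g \<in> carrier (residue_field p) \<and>
    (\<forall>l\<in>carrier (residue_field p). induced_form scale b u p k (cosetp x) (l \<odot>\<^bsub>Mp\<^esub> cosetp y) =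
      residue_form p (l \<otimes>\<^bsub>residue_field p\<^esub> residue_class p g))"
    by (auto simp: carrier_residue_field * mult_residue_field residue_form_class)
  fix h
  assume h: "h \<in> carrier (residue_field p) \<and>
    (\<forall>l\<in>carrier (residue_field p). induced_form scale b u p k (cosetp x) (l \<odot>\<^bsub>Mp\<^esub> cosetp y) =
      residue_form p (l \<otimes>\<^bsub>residue_field p\<^esub> h))"
  then obtain g' where g': "h = residue_class p g'" by (auto simp: carrier_residue_field)
  have "residue_coeff p (f * g') = residue_coeff p (f * g)" for f
    using h *[of f] by (auto simp: carrier_residue_field g' mult_residue_field residue_form_class)
  then have "p dvd g' - g"
    by (intro residue_coeff_nondegenerate Irr0_coeff_0[OF p]) (simp add: right_diff_distrib residue_coeff_diff)
  then show "h = residue_class p g" by (simp add: g' residue_class_eq_iff)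
qed

text \<open>The functional of \<open>f\<close> vanishes on multiples of \<open>p\<close>, because
  \<open>p(u)\<close> maps \<open>Kp\<close> into \<open>Dp\<close>, the radical of the
  form.\<close>

lemma exists_hermitian_representative:
  assumes "x \<in> Kp" "y \<in> Kp"
  shows "\<exists>g. \<forall>f. b x (N (E f y)) = residue_coeff p (f * g)"
proof (rule residue_coeff_represents)
  show "coeff p 0 \<noteq> 0" by (rule Irr0_coeff_0[OF p])
  show "b x (N (E (f + g) y)) = b x (N (E f y)) + b x (N (E g y))" for f g
    by (simp add: E_add E_arg_add b_simps)
  show "b x (N (E (smult c f) y)) = c * b x (N (E f y))" for c f
    by (simp add: E_smult E_arg_scale b_simps)
  show "b x (N (E (p * f) y)) = 0" for f
  proof -
    have "E f y \<in> Kp" using stable_E[OF stable_primary_kernel assms(2)] .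
    then have "E p (E f y) \<in> Dp" by (rule E_primary_denominator[OF k])
    then show ?thesis using form_denominator[OF _ assms(1)] form_sym by (metis E_mult)
  qed
qed

lemma hermitian_invariant_obtain:
  assumes "x \<in> Kp" "y \<in> Kp"
  shows "\<exists>g. Hp (cosetp x) (cosetp y) = residue_class p g \<and>
    (\<forall>f. b x (N (E f y)) = residue_coeff p (f * g))"
  using exists_hermitian_representative[OF assms] hermitian_invariant_eqI[OF assms] by metis

lemma nondegenerate_hermitian_invariant:
  "nondegenerate_hermitian (residue_field p) residue_involution Mp Hp"
proof -
  note carr = carrier_M[OF p_irreducible k] carrier_residue_field
  note sK = stable_subspace[OF stable_primary_kernel, of p k]
  have 1: "Hp (cosetp x) (cosetp y) \<in> carrier (residue_field p)" if xy: "x \<in> Kp" "y \<in> Kp" for x y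
    using hermitian_invariant_obtain[OF xy] by (metis carrier_residue_field rangeI)
  have 2: "Hp (cosetp x) (cosetp y \<oplus>\<^bsub>Mp\<^esub> cosetp z) =
      Hp (cosetp x) (cosetp y) \<oplus>\<^bsub>residue_field p\<^esub> Hp (cosetp x) (cosetp z)"
    and 3: "Hp (cosetp x \<oplus>\<^bsub>Mp\<^esub> cosetp y) (cosetp z) =
      Hp (cosetp x) (cosetp z) \<oplus>\<^bsub>residue_field p\<^esub> Hp (cosetp y) (cosetp z)"
    if xyz: "x \<in> Kp" "y \<in> Kp" "z \<in> Kp" for x y z
  proof -
    obtain g1 where g1: "Hp (cosetp x) (cosetp y) = residue_class p g1"
      "\<And>f. b x (N (E f y)) = residue_coeff p (f * g1)"
      using hermitian_invariant_obtain[OF xyz(1,2)] by blast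
    obtain g2 where g2: "Hp (cosetp x) (cosetp z) = residue_class p g2"
      "\<And>f. b x (N (E f z)) = residue_coeff p (f * g2)"
      using hermitian_invariant_obtain[OF xyz(1,3)] by blast
    obtain g3 where g3: "Hp (cosetp y) (cosetp z) = residue_class p g3"
      "\<And>f. b y (N (E f z)) = residue_coeff p (f * g3)"
      using hermitian_invariant_obtain[OF xyz(2,3)] by blast
    have "Hp (cosetp x) (cosetp (y + z)) = residue_class p (g1 + g2)"
      by (rule hermitian_invariant_eqI[OF xyz(1) subspace_add[OF sK xyz(2,3)]])
        (simp add: E_arg_add b_simps g1 g2 distrib_left residue_coeff_add)
    then show "Hp (cosetp x) (cosetp y \<oplus>\<^bsub>Mp\<^esub> cosetp z) =
        Hp (cosetp x) (cosetp y) \<oplus>\<^bsub>residue_field p\<^esub> Hp (cosetp x) (cosetp z)"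
      by (simp add: add_M[OF p_irreducible k] g1 g2 add_residue_field)
    have "Hp (cosetp (x + y)) (cosetp z) = residue_class p (g2 + g3)"
      by (rule hermitian_invariant_eqI[OF subspace_add[OF sK xyz(1,2)] xyz(3)])
        (simp add: b_simps g2 g3 distrib_left residue_coeff_add)
    then show "Hp (cosetp x \<oplus>\<^bsub>Mp\<^esub> cosetp y) (cosetp z) =
        Hp (cosetp x) (cosetp z) \<oplus>\<^bsub>residue_field p\<^esub> Hp (cosetp y) (cosetp z)"
      by (simp add: add_M[OF p_irreducible k] g2 g3 add_residue_field)
  qed
  have 4: "Hp (cosetp x) (residue_class p c \<odot>\<^bsub>Mp\<^esub> cosetp y) =
      residue_class p c \<otimes>\<^bsub>residue_field p\<^esub> Hp (cosetp x) (cosetp y)"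
    and 5: "Hp (residue_class p c \<odot>\<^bsub>Mp\<^esub> cosetp x) (cosetp y) =
      residue_involution (residue_class p c) \<otimes>\<^bsub>residue_field p\<^esub> Hp (cosetp x) (cosetp y)"
    and 6: "Hp (cosetp y) (cosetp x) = residue_involution (Hp (cosetp x) (cosetp y))"
    if xy: "x \<in> Kp" "y \<in> Kp" for x y c
  proof -
    obtain g where g: "Hp (cosetp x) (cosetp y) = residue_class p g"
      "\<And>f. b x (N (E f y)) = residue_coeff p (f * g)"
      using hermitian_invariant_obtain[OF xy] by blast
    have EK: "E c x \<in> Kp" "E c y \<in> Kp" using xy stable_E[OF stable_primary_kernel] by blast+
    have "Hp (cosetp x) (cosetp (E c y)) = residue_class p (c * g)"
      by (rule hermitian_invariant_eqI[OF xy(1) EK(2)])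
        (simp add: g mult.assoc flip: E_mult[of _ c])
    then show "Hp (cosetp x) (residue_class p c \<odot>\<^bsub>Mp\<^esub> cosetp y) =
        residue_class p c \<otimes>\<^bsub>residue_field p\<^esub> Hp (cosetp x) (cosetp y)"
      using xy by (simp add: smult_M[OF p_irreducible k] g mult_residue_field)
    \<comment> \<open>Semilinearity on the left: the adjoint of \<open>c(u)\<close> is
      \<open>(flip c)(u)\<close>, and \<open>flip\<close> induces the involution on classes.\<close>
    have "Hp (cosetp (E c x)) (cosetp y) = residue_class p (flip c * g)"
    proof (rule hermitian_invariant_eqI[OF EK(1) xy(2)])
      fix f
      have "b (E c x) (N (E f y)) = b x (N (E (f * flip c) y))"
        by (simp add: b_E E_mult E_mult_commute[of "flip c"])
      then show "b (E c x) (N (E f y)) = residue_coeff p (f * (flip c * g))"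
        by (simp add: g mult.assoc)
    qed
    then show "Hp (residue_class p c \<odot>\<^bsub>Mp\<^esub> cosetp x) (cosetp y) =
        residue_involution (residue_class p c) \<otimes>\<^bsub>residue_field p\<^esub> Hp (cosetp x) (cosetp y)"
      using xy by (simp add: smult_M[OF p_irreducible k] g mult_residue_field
          residue_involution_class[OF flip_p])
    \<comment> \<open>Exchanging the arguments replaces \<open>f\<close> by \<open>flip f\<close>;
      invariance of \<open>e_p\<close> under the involution transfers this to
      \<open>g\<close>.\<close>
    have "Hp (cosetp y) (cosetp x) = residue_class p (flip g)"
    proof (rule hermitian_invariant_eqI[OF xy(2,1)])
      fix f
      have "b y (N (E f x)) = b (E f x) (N y)" by (rule form_sym)
      also have "\<dots> = b x (N (E (flip f) y))" by (simp add: b_E E_mult_commute)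
      also have "\<dots> = residue_coeff p (flip (f * flip g))" by (simp add: g flip_mult)
      also have "\<dots> = residue_coeff p (f * flip g)"
        using residue_coeff_flip[of p "f * flip g"] by (simp only: flip_p)
      finally show "b y (N (E f x)) = residue_coeff p (f * flip g)" .
    qed
    then show "Hp (cosetp y) (cosetp x) = residue_involution (Hp (cosetp x) (cosetp y))"
      by (simp add: g residue_involution_class[OF flip_p])
  qed
  have 7: "cosetp x = \<zero>\<^bsub>Mp\<^esub>"
    if x: "x \<in> Kp" and zero: "\<And>y. y \<in> Kp \<Longrightarrow> Hp (cosetp x) (cosetp y) = \<zero>\<^bsub>residue_field p\<^esub>" for x
  proof -
    have "b x (N y) = 0" if y: "y \<in> Kp" for y
    proof -
      obtain g where g: "Hp (cosetp x) (cosetp y) = residue_class p g"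
        "\<And>f. b x (N (E f y)) = residue_coeff p (f * g)"
        using hermitian_invariant_obtain[OF x y] by blast
      have "p dvd g" using zero[OF y] g(1) by (simp add: zero_residue_field residue_class_eq_iff)
      then show ?thesis using g(2)[of 1] by (simp add: residue_coeff_multiple)
    qed
    then have "x \<in> Dp" using x mem_primary_denominator_iff[OF k, of x p] by (simp add: flip_p)
    then show ?thesis unfolding zero_M[OF p_irreducible k] coset_eq_iff[OF p_irreducible k] by simp
  qed
  show ?thesis
    unfolding nondegenerate_hermitian_def carr ball_simps(9) ball_UNIV
    by (intro conjI ballI allI impI)
      (rule 1[unfolded carrier_residue_field] 2 3 4 5 6 7; (assumption | erule bspec, assumption))+
qed

lemma hermitian_invariant_zero_iff:
  assumes "x \<in> Kp" "y \<in> Kp"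
  shows "Hp (cosetp x) (cosetp y) = \<zero>\<^bsub>residue_field p\<^esub> \<longleftrightarrow> (\<forall>f. b x (N (E f y)) = 0)"
proof -
  obtain g where g: "Hp (cosetp x) (cosetp y) = residue_class p g"
    "\<And>f. b x (N (E f y)) = residue_coeff p (f * g)"
    using hermitian_invariant_obtain[OF assms] by blast
  have "p dvd g \<longleftrightarrow> (\<forall>f. residue_coeff p (f * g) = 0)"
    using residue_coeff_nondegenerate[OF Irr0_coeff_0[OF p], of g]
    by (auto simp: residue_coeff_multiple)
  then show ?thesis using g by (simp add: zero_residue_field residue_class_eq_iff)
qed

text \<open>Subspaces of \<open>V_{p,k}\<close> over \<open>F[t]/(p)\<close> are the images of the
  stable \<open>L\<close> between \<open>Dp\<close> and \<open>Kp\<close>. Half the dimension of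
  \<open>V_{p,k}\<close> means \<open>2 dim L = dim Kp + dim Dp\<close>, which for isotropic
  \<open>L\<close> is equality with its orthogonal.\<close>

lemma hyperbolic_iff_lagrangian:
  "hyperbolic (residue_field p) residue_involution Mp Hp \<longleftrightarrow>
    (\<exists>L. stable L \<and> lagrangian (\<lambda>x y. b x (N y)) Kp L)"
proof -
  let ?B = "\<lambda>x y. b x (N y)"
  have bil: "bilinear_form scale ?B" by (rule bilinear_form_compose[OF bilinear linear_E])
  have refl: "reflexive_form ?B" unfolding reflexive_form_def using form_sym by metis
  have sK: "subspace Kp" by (rule stable_subspace[OF stable_primary_kernel])
  have rad: "Kp \<inter> annihilator ?B Kp = Dp"
    using mem_primary_denominator_iff[OF k, of _ p] by (auto simp: annihilator_def flip_p)
  have MK: "Mp\<lparr>carrier := cosetp ` Kp\<rparr> = Mp" by (simp add: primary_quotient_def Let_def)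
  have dimM: "dim Kp = dim Dp + vectorspace.dim (residue_field p) Mp * degree p"
    using jordan_number_dim[OF p_irreducible k] by (simp add: jordan_number_def)
  have deg: "degree p > 0" by (rule degree_irreducible_pos[OF p_irreducible])
  show ?thesis
  proof
    assume "hyperbolic (residue_field p) residue_involution Mp Hp"
    then obtain m U where m: "vectorspace.dim (residue_field p) Mp = 2 * m"
      and U: "VectorSpace.subspace (residue_field p) U Mp"
        "vectorspace.dim (residue_field p) (Mp\<lparr>carrier := U\<rparr>) = m"
        "\<And>x y. x \<in> U \<Longrightarrow> y \<in> U \<Longrightarrow> Hp x y = \<zero>\<^bsub>residue_field p\<^esub>"
      unfolding hyperbolic_def by blast
    have "submodule (residue_field p) U (Mp\<lparr>carrier := cosetp ` Kp\<rparr>)"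
      using U(1) by (simp add: MK VectorSpace.subspace_def)
    then obtain L where L: "stable L" "Dp \<subseteq> L" "L \<subseteq> Kp" "U = cosetp ` L"
      using submodule_obtain[OF p_irreducible k stable_primary_kernel primary_denominator_subset order_refl]
      by blast
    have "lagrangian ?B Kp L"
    proof (rule lagrangianI_dim[OF sK stable_subspace[OF L(1)] L(3) bil refl])
      show "Kp \<inter> annihilator ?B Kp \<subseteq> L" using rad L(2) by simp
      have "b x (N y) = 0" if xy: "x \<in> L" "y \<in> L" for x y
      proof -
        have "x \<in> Kp" "y \<in> Kp" using xy L(3) by blast+
        moreover have "Hp (cosetp x) (cosetp y) = \<zero>\<^bsub>residue_field p\<^esub>"
          using xy by (intro U(3)) (simp_all add: L(4))
        ultimately have "b x (N (E 1 y)) = 0" using hermitian_invariant_zero_iff by blast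
        then show ?thesis by simp
      qed
      then show "L \<subseteq> annihilator ?B L" by (auto simp: annihilator_def)
      have "dim L = dim Dp + m * degree p"
        using dim_part[OF p_irreducible k L(1-3)] U(2) L(4) by simp
      then show "2 * dim L = dim Kp + dim (Kp \<inter> annihilator ?B Kp)"
        unfolding rad using dimM m by simp
    qed
    then show "\<exists>L. stable L \<and> lagrangian ?B Kp L" using L(1) by blast
  next
    assume "\<exists>L. stable L \<and> lagrangian ?B Kp L"
    then obtain L where L: "stable L" "lagrangian ?B Kp L" by blast
    have LK: "L \<subseteq> Kp" by (rule lagrangian_subset[OF L(2)])
    have DL: "Dp \<subseteq> L"
      using LK form_denominator primary_denominator_subset[of p k]
      by (intro subsetI lagrangian_maximal[OF L(2)]) auto
    let ?m = "vectorspace.dim (residue_field p) (Mp\<lparr>carrier := cosetp ` L\<rparr>)"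
    have "dim L = dim Dp + ?m * degree p" by (rule dim_part[OF p_irreducible k L(1) DL LK])
    moreover have "2 * dim L = dim Kp + dim Dp"
      using dim_lagrangian[OF sK bil refl L(2)] rad by simp
    ultimately have "vectorspace.dim (residue_field p) Mp * degree p = 2 * ?m * degree p"
      using dimM by linarith
    then have dim: "vectorspace.dim (residue_field p) Mp = 2 * ?m" using deg by simp
    have "submodule (residue_field p) (cosetp ` L) Mp"
      using submodule_part[OF p_irreducible k stable_primary_kernel primary_denominator_subset order_refl L(1) DL LK]
      by (simp only: MK)
    then have "VectorSpace.subspace (residue_field p) (cosetp ` L) Mp"
      using vectorspace_M[OF p_irreducible k] by (simp add: VectorSpace.subspace_def)
    moreover have "Hp x y = \<zero>\<^bsub>residue_field p\<^esub>" if xy: "x \<in> cosetp ` L" "y \<in> cosetp ` L" for x y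
    proof -
      obtain x' y' where x'y': "x = cosetp x'" "x' \<in> L" "y = cosetp y'" "y' \<in> L" using xy by blast
      have "b x' (N (E f y')) = 0" for f
        using lagrangian_isotropic[OF L(2) x'y'(2) stable_E[OF L(1) x'y'(4)]] .
      then show ?thesis using x'y' LK hermitian_invariant_zero_iff by blast
    qed
    ultimately show "hyperbolic (residue_field p) residue_involution Mp Hp"
      unfolding hyperbolic_def using nondegenerate_hermitian_invariant dim by blast
  qed
qed

end

end

theorem theorem1p12:
  fixes scale :: "'a::field \<Rightarrow> 'v::ab_group_add \<Rightarrow> 'v"
    and Basis :: "'v set"
    and b :: "'v \<Rightarrow> 'v \<Rightarrow> 'a"
    and u :: "'v \<Rightarrow> 'v"
  assumes "CHAR('a) \<noteq> 2"
    and "finite_dimensional_vector_space scale Basis"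
    and "bilinear_form scale b" and "symmetric_form b" and "nondegenerate_form b"
    and "Vector_Spaces.linear scale scale u" and "bij u" and "skew_selfadjoint b u"
  shows "(\<exists>a1 a2. Vector_Spaces.linear scale scale a1 \<and> Vector_Spaces.linear scale scale a2 \<and>
            skew_selfadjoint b a1 \<and> skew_selfadjoint b a2 \<and>
            (\<forall>x. a1 (a1 x) = 0) \<and> (\<forall>x. a2 (a2 x) = 0) \<and> (\<forall>x. u x = a1 x + a2 x)) \<longleftrightarrow>
         (\<forall>p\<in>Irr0. \<forall>k\<ge>1. hyperbolic (residue_field p) residue_involution
            (primary_quotient scale u p k) (hermitian_invariant scale b u p k)) \<and>
         (\<forall>p\<in>Irr. \<forall>k\<ge>1. even (jordan_number scale u p k))"
proof -
  interpret skew_pair scale Basis u b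
    by (intro skew_pair.intro endomorphism.intro endomorphism_axioms.intro
        skew_pair_axioms.intro assms)
  \<comment> \<open>Both conditions of (b) enter in their form inside \<open>V\<close>: Lagrangians
    of \<open>Ker p(u)^k\<close> for hyperbolic invariants, dimensions over \<open>F\<close> for
    Jordan numbers.\<close>
  have "(\<exists>s. sign_map s \<and> (\<forall>x. s (s x) = x)) \<longleftrightarrow>
    (\<forall>p\<in>Irr0. \<forall>k\<ge>1. \<exists>L. stable L \<and>
      lagrangian (\<lambda>x y. b x (E (p ^ (k - 1)) y)) (primary_kernel scale u p k) L) \<and>
    (\<forall>p\<in>Irr. \<forall>k\<ge>1. \<exists>n. dim (primary_kernel scale u p k) =
      dim (primary_denominator scale u p k) + 2 * n * degree p)"
    (is "?S \<longleftrightarrow> ?H \<and> ?J")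
  proof
    assume ?S
    then obtain s where s: "sign_map s" "\<And>x. s (s x) = x" by blast
    \<comment> \<open>An involutive sign map is surjective, so the intersections with
      \<open>range s\<close> in the two results below disappear.\<close>
    then have "range s = UNIV" by (metis surjI)
    then show "?H \<and> ?J"
      using exists_lagrangian_even[OF s(1) Irr0_flip] dim_primary_range_even[OF s(1) Irr_irreducible]
      by simp
  next
    assume "?H \<and> ?J"
    then show ?S
      by (intro exists_invertible_sign_map bij_is_inj[OF \<open>bij u\<close>]) auto
  qed
  then show ?thesis
    unfolding sum_of_square_zero_iff_sign_map[OF \<open>bij u\<close>]
    by (simp add: hyperbolic_iff_lagrangian even_jordan_number_iff[OF Irr_irreducible])
qed

end
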